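(* Let $G$ be a finite simple graph and let $\mathcal L(G)$ be its Dani-Mainkar Lie algebra. Then $b^k_B(\mathcal L(G))=s_k(G)$ for all integers $k\ge 0$, where $b^k_B(\mathcal L(G))$ is the $k$-th basic Betti number of $\mathcal L(G)$ and $s_k(G)$ is the number of independent sets of size $k$ of $G$.
   Context: Independent sets of graphs: for a finite simple graph $G$ with vertex set $V(G)$ and edge set $E(G)$, an independent set is a subset $S\subseteq V(G)$ no two elements of which are joined by an edge (the empty set is independent). $s_k(G)$ is the number of independent sets with exactly $k$ elements. 2-step nilpotent Lie algebra: a real vector space $\mathfrak g$ with an antisymmetric bilinear bracket $[\,,\,]:\mathfrak g\times\mathfrak g\to\mathfrak g$ such that $[x,[y,z]]=0$ for all $x,y,z\in\mathfrak g$ (abelian Lie algebras are included). Dani-Mainkar Lie algebra: let $V(G)=\{1,\ldots,n\}$, let $V$ be the real vector space with basis $\{x_1,\ldots,x_n\}$ and let $W\subseteq\bigwedge^2V$ be the span of the $x_i\wedge x_j$ with $\{i,j\}\notin E(G)$. Then $\mathcal L(G)=V\oplus(\bigwedge^2V)/W$ with bracket $[x,y]=x\wedge y \bmod W$ for $x,y\in V$, the summand $(\bigwedge^2V)/W$ being central. It is 2-step nilpotent. Cohomology: the Cartan-Chevalley-Eilenberg complex of $\mathfrak g$ is the exterior algebra $\mathcal C^\bullet(\mathfrak g)=\bigwedge^\bullet\mathfrak g^\vee$ of the dual of $\mathfrak g$, with differential $d$ the odd derivation determined by $d(\varphi)(x,y)=\varphi([x,y])$ for $\varphi\in\mathfrak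 g^\vee$, $x,y\in\mathfrak g$. $H^\bullet(\mathfrak g)$ is its cohomology. Basic cohomology: let $\pi:\mathfrak g\to\mathfrak g/[\mathfrak g,\mathfrak g]$ be the canonical quotient map. $H^\bullet_B(\mathfrak g)$ is the image of the induced linear map $\pi^\bullet:H^\bullet(\mathfrak g/[\mathfrak g,\mathfrak g])\to H^\bullet(\mathfrak g)$, and the $k$-th basic Betti number is $b^k_B(\mathfrak g)=\dim H^k_B(\mathfrak g)$. *)

theory Defs
  imports
    "Jordan_Normal_Form.VS_Connect"
    "HOL-Algebra.QuotRing"
    "HOL-Library.Ramsey"
begin

text \<open>
  Real vector spaces are modules in the sense of \<open>HOL-Algebra\<close> over the field of real numbers.
  The ring operations of the record are junk except for the algebras defined below.
\<close>

abbreviation real_field :: "real ring" where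
  "real_field \<equiv> class_ring"

text \<open>
  The quotient of a vector space by a subspace, consisting of cosets. It is the quotient algebra
  if \<open>M\<close> is an algebra and \<open>N\<close> is a two-sided ideal.
\<close>

definition quot_module ::
  "(real, 'a, 'm) module_scheme \<Rightarrow> 'a set \<Rightarrow> (real, 'a set) module" where
  "quot_module M N =
    \<lparr>carrier = carrier (M Quot N), mult = mult (M Quot N), one = one (M Quot N),
     zero = zero (M Quot N), add = add (M Quot N),
     smult = (\<lambda>c X. \<Union>x\<in>X. N +>\<^bsub>M\<^esub> (c \<odot>\<^bsub>M\<^esub> x))\<rparr>"

definition dual_space :: "(real, 'a, 'm) module_scheme \<Rightarrow> (real, 'a \<Rightarrow> real) module" where
  "dual_space V = (ring.func_space real_field (carrier V))
    \<lparr>carrier := {\<phi> \<in> carrier V \<rightarrow>\<^sub>E UNIV.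
       (\<forall>x\<in>carrier V. \<forall>y\<in>carrier V. \<phi> (x \<oplus>\<^bsub>V\<^esub> y) = \<phi> x + \<phi> y) \<and>
       (\<forall>c. \<forall>x\<in>carrier V. \<phi> (c \<odot>\<^bsub>V\<^esub> x) = c * \<phi> x)}\<rparr>"

definition dual_map ::
  "(real, 'a, 'm) module_scheme \<Rightarrow> ('a \<Rightarrow> 'b) \<Rightarrow> ('b \<Rightarrow> real) \<Rightarrow> ('a \<Rightarrow> real)" where
  "dual_map V h \<phi> = restrict (\<phi> \<circ> h) (carrier V)"


section \<open>The exterior algebra of a real vector space\<close>

text \<open>
  The free unital associative algebra on a set: finitely supported families of coefficients
  indexed by words, multiplied by concatenating words.
\<close>

definition free_algebra :: "'a set \<Rightarrow> (real, 'a list \<Rightarrow> real) module" where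
  "free_algebra S =
    \<lparr>carrier = {f. finite {w. f w \<noteq> 0} \<and> {w. f w \<noteq> 0} \<subseteq> lists S},
     mult = (\<lambda>f g w. \<Sum>i\<le>length w. f (take i w) * g (drop i w)),
     one = (\<lambda>w. if w = [] then 1 else 0),
     zero = (\<lambda>w. 0),
     add = (\<lambda>f g w. f w + g w),
     smult = (\<lambda>c f w. c * f w)\<rparr>"

definition free_gen :: "'a \<Rightarrow> 'a list \<Rightarrow> real" where
  "free_gen u = (\<lambda>w. if w = [u] then 1 else 0)"

text \<open>
  The first two families of relations turn the free algebra on the set \<open>carrier U\<close> into the
  tensor algebra of \<open>U\<close>, and the third one turns the latter into the exterior algebra.
\<close>

definition exterior_relations :: "(real, 'a, 'm) module_scheme \<Rightarrow> ('a list \<Rightarrow> real) set" where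
  "exterior_relations U = (let F = free_algebra (carrier U) in
      {free_gen (u \<oplus>\<^bsub>U\<^esub> v) \<ominus>\<^bsub>F\<^esub> (free_gen u \<oplus>\<^bsub>F\<^esub> free_gen v) | u v.
         u \<in> carrier U \<and> v \<in> carrier U}
    \<union> {free_gen (c \<odot>\<^bsub>U\<^esub> u) \<ominus>\<^bsub>F\<^esub> c \<odot>\<^bsub>F\<^esub> free_gen u | c u. u \<in> carrier U}
    \<union> {free_gen u \<otimes>\<^bsub>F\<^esub> free_gen u | u. u \<in> carrier U})"

definition exterior_ideal :: "(real, 'a, 'm) module_scheme \<Rightarrow> ('a list \<Rightarrow> real) set" where
  "exterior_ideal U = Idl\<^bsub>free_algebra (carrier U)\<^esub> (exterior_relations U)"

definition exterior_algebra ::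
  "(real, 'a, 'm) module_scheme \<Rightarrow> (real, ('a list \<Rightarrow> real) set) module" where
  "exterior_algebra U = quot_module (free_algebra (carrier U)) (exterior_ideal U)"

definition ext_incl :: "(real, 'a, 'm) module_scheme \<Rightarrow> 'a \<Rightarrow> ('a list \<Rightarrow> real) set" where
  "ext_incl U u = exterior_ideal U +>\<^bsub>free_algebra (carrier U)\<^esub> free_gen u"

definition ext_wedge ::
  "(real, 'a, 'm) module_scheme \<Rightarrow> 'a list \<Rightarrow> ('a list \<Rightarrow> real) set" where
  "ext_wedge U us =
    foldr (\<lambda>u a. ext_incl U u \<otimes>\<^bsub>exterior_algebra U\<^esub> a) us \<one>\<^bsub>exterior_algebra U\<^esub>"

definition ext_power ::
  "(real, 'a, 'm) module_scheme \<Rightarrow> nat \<Rightarrow> (real, ('a list \<Rightarrow> real) set) module" where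
  "ext_power U k = (exterior_algebra U)
    \<lparr>carrier := LinearCombinations.module.span real_field (exterior_algebra U)
       {ext_wedge U us | us. us \<in> lists (carrier U) \<and> length us = k}\<rparr>"

text \<open>The algebra homomorphism between exterior algebras induced by a linear map \<open>T\<close>.\<close>

definition ext_map ::
  "(real, 'a, 'm) module_scheme \<Rightarrow> (real, 'b, 'n) module_scheme \<Rightarrow> ('a \<Rightarrow> 'b) \<Rightarrow>
   ('a list \<Rightarrow> real) set \<Rightarrow> ('b list \<Rightarrow> real) set" where
  "ext_map U U' T = (THE F.
     F \<in> extensional (carrier (exterior_algebra U)) \<and>
     F \<in> LinearCombinations.module_hom real_field (exterior_algebra U) (exterior_algebra U') \<and>
     F \<in> Ring.ring_hom (exterior_algebra U) (exterior_algebra U') \<and>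
     (\<forall>u\<in>carrier U. F (ext_incl U u) = ext_incl U' (T u)))"

text \<open>
  Elements of the exterior square of a dual space as alternating bilinear forms, with
  \<open>(\<alpha> \<and> \<beta>) (x, y) = \<alpha> x * \<beta> y - \<alpha> y * \<beta> x\<close>. The value does not depend on the representative
  \<open>f\<close> of the coset \<open>\<theta>\<close>.
\<close>

definition two_form_eval :: "(('a \<Rightarrow> real) list \<Rightarrow> real) set \<Rightarrow> 'a \<Rightarrow> 'a \<Rightarrow> real" where
  "two_form_eval \<theta> x y = the_elem
    ((\<lambda>f. \<Sum>w | f w \<noteq> 0 \<and> length w = 2.
         f w * ((w ! 0) x * (w ! 1) y - (w ! 0) y * (w ! 1) x)) ` \<theta>)"


section \<open>Lie algebras and their cohomology\<close>

record 'a lie_algebra = "(real, 'a) module" +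
  bracket :: "'a \<Rightarrow> 'a \<Rightarrow> 'a"

locale two_step_nilpotent_lie_algebra = vectorspace real_field \<gg>
  for \<gg> :: "('a, 'm) lie_algebra_scheme" (structure) +
  assumes bracket_closed:
      "\<lbrakk>x \<in> carrier \<gg>; y \<in> carrier \<gg>\<rbrakk> \<Longrightarrow> bracket \<gg> x y \<in> carrier \<gg>"
    and bracket_add_left:
      "\<lbrakk>x \<in> carrier \<gg>; y \<in> carrier \<gg>; z \<in> carrier \<gg>\<rbrakk> \<Longrightarrow>
        bracket \<gg> (x \<oplus>\<^bsub>\<gg>\<^esub> y) z = bracket \<gg> x z \<oplus>\<^bsub>\<gg>\<^esub> bracket \<gg> y z"
    and bracket_smult_left:
      "\<lbrakk>x \<in> carrier \<gg>; y \<in> carrier \<gg>\<rbrakk> \<Longrightarrow>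
        bracket \<gg> (c \<odot>\<^bsub>\<gg>\<^esub> x) y = c \<odot>\<^bsub>\<gg>\<^esub> bracket \<gg> x y"
    and bracket_antisym:
      "\<lbrakk>x \<in> carrier \<gg>; y \<in> carrier \<gg>\<rbrakk> \<Longrightarrow> bracket \<gg> y x = \<ominus>\<^bsub>\<gg>\<^esub> bracket \<gg> x y"
    and bracket_bracket:
      "\<lbrakk>x \<in> carrier \<gg>; y \<in> carrier \<gg>; z \<in> carrier \<gg>\<rbrakk> \<Longrightarrow>
        bracket \<gg> x (bracket \<gg> y z) = \<zero>\<^bsub>\<gg>\<^esub>"

definition commutator_ideal :: "('a, 'm) lie_algebra_scheme \<Rightarrow> 'a set" where
  "commutator_ideal \<gg> = LinearCombinations.module.span real_field \<gg>
     {bracket \<gg> x y | x y. x \<in> carrier \<gg> \<and> y \<in> carrier \<gg>}"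

definition abelianization :: "('a, 'm) lie_algebra_scheme \<Rightarrow> 'a set lie_algebra" where
  "abelianization \<gg> = module.extend (quot_module \<gg> (commutator_ideal \<gg>))
     (lie_algebra.fields
       (\<lambda>X Y. \<Union>x\<in>X. \<Union>y\<in>Y. commutator_ideal \<gg> +>\<^bsub>\<gg>\<^esub> bracket \<gg> x y))"

definition abelianization_map :: "('a, 'm) lie_algebra_scheme \<Rightarrow> 'a \<Rightarrow> 'a set" where
  "abelianization_map \<gg> x = commutator_ideal \<gg> +>\<^bsub>\<gg>\<^esub> x"

abbreviation cochains ::
  "('a, 'm) lie_algebra_scheme \<Rightarrow> (real, (('a \<Rightarrow> real) list \<Rightarrow> real) set) module" where
  "cochains \<gg> \<equiv> exterior_algebra (dual_space \<gg>)"

text \<open>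
  An odd derivation on the exterior algebra is determined by its values on the generators.
\<close>

definition is_ce_differential ::
  "('a, 'm) lie_algebra_scheme \<Rightarrow>
   ((('a \<Rightarrow> real) list \<Rightarrow> real) set \<Rightarrow> (('a \<Rightarrow> real) list \<Rightarrow> real) set) \<Rightarrow> bool" where
  "is_ce_differential \<gg> d \<longleftrightarrow>
     d \<in> extensional (carrier (cochains \<gg>)) \<and>
     d \<in> LinearCombinations.module_hom real_field (cochains \<gg>) (cochains \<gg>) \<and>
     (\<forall>k. \<forall>a\<in>carrier (ext_power (dual_space \<gg>) k). \<forall>b\<in>carrier (cochains \<gg>).
        d (a \<otimes>\<^bsub>cochains \<gg>\<^esub> b) =
          d a \<otimes>\<^bsub>cochains \<gg>\<^esub> b \<oplus>\<^bsub>cochains \<gg>\<^esub>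
          (-1) ^ k \<odot>\<^bsub>cochains \<gg>\<^esub> (a \<otimes>\<^bsub>cochains \<gg>\<^esub> d b)) \<and>
     (\<forall>\<phi>\<in>carrier (dual_space \<gg>).
        d (ext_incl (dual_space \<gg>) \<phi>) \<in> carrier (ext_power (dual_space \<gg>) 2) \<and>
        (\<forall>x\<in>carrier \<gg>. \<forall>y\<in>carrier \<gg>.
           two_form_eval (d (ext_incl (dual_space \<gg>) \<phi>)) x y = \<phi> (bracket \<gg> x y)))"

definition ce_differential ::
  "('a, 'm) lie_algebra_scheme \<Rightarrow>
   (('a \<Rightarrow> real) list \<Rightarrow> real) set \<Rightarrow> (('a \<Rightarrow> real) list \<Rightarrow> real) set" where
  "ce_differential \<gg> = (THE d. is_ce_differential \<gg> d)"

definition cocycles ::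
  "('a, 'm) lie_algebra_scheme \<Rightarrow> nat \<Rightarrow> (('a \<Rightarrow> real) list \<Rightarrow> real) set set" where
  "cocycles \<gg> k =
     {\<omega> \<in> carrier (ext_power (dual_space \<gg>) k). ce_differential \<gg> \<omega> = \<zero>\<^bsub>cochains \<gg>\<^esub>}"

definition coboundaries ::
  "('a, 'm) lie_algebra_scheme \<Rightarrow> nat \<Rightarrow> (('a \<Rightarrow> real) list \<Rightarrow> real) set set" where
  "coboundaries \<gg> k = (case k of
       0 \<Rightarrow> {\<zero>\<^bsub>cochains \<gg>\<^esub>}
     | Suc j \<Rightarrow> ce_differential \<gg> ` carrier (ext_power (dual_space \<gg>) j))"

definition cohomology ::
  "('a, 'm) lie_algebra_scheme \<Rightarrow> nat \<Rightarrow> (real, (('a \<Rightarrow> real) list \<Rightarrow> real) set set) module" where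
  "cohomology \<gg> k = quot_module ((cochains \<gg>)\<lparr>carrier := cocycles \<gg> k\<rparr>) (coboundaries \<gg> k)"

text \<open>The map in cohomology induced by a homomorphism \<open>h\<close> from \<open>\<gg>\<close> to \<open>\<hh>\<close>.\<close>

definition cohomology_map ::
  "('a, 'm) lie_algebra_scheme \<Rightarrow> ('b, 'n) lie_algebra_scheme \<Rightarrow> ('a \<Rightarrow> 'b) \<Rightarrow> nat \<Rightarrow>
   (('b \<Rightarrow> real) list \<Rightarrow> real) set set \<Rightarrow> (('a \<Rightarrow> real) list \<Rightarrow> real) set set" where
  "cohomology_map \<gg> \<hh> h k X =
     (\<Union>\<omega>\<in>X. coboundaries \<gg> k +>\<^bsub>cochains \<gg>\<^esub>
        ext_map (dual_space \<hh>) (dual_space \<gg>) (dual_map \<gg> h) \<omega>)"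

definition basic_cohomology ::
  "('a, 'm) lie_algebra_scheme \<Rightarrow> nat \<Rightarrow> (real, (('a \<Rightarrow> real) list \<Rightarrow> real) set set) module" where
  "basic_cohomology \<gg> k = (cohomology \<gg> k)
    \<lparr>carrier := cohomology_map \<gg> (abelianization \<gg>) (abelianization_map \<gg>) k `
       carrier (cohomology (abelianization \<gg>) k)\<rparr>"

definition basic_betti :: "('a, 'm) lie_algebra_scheme \<Rightarrow> nat \<Rightarrow> nat" where
  "basic_betti \<gg> k = vectorspace.dim real_field (basic_cohomology \<gg> k)"


section \<open>The Lie algebra of a graph\<close>

definition vertex_space :: "'v set \<Rightarrow> (real, 'v \<Rightarrow> real) module" where
  "vertex_space V = ring.func_space real_field V"

definition vertex_vector :: "'v set \<Rightarrow> 'v \<Rightarrow> 'v \<Rightarrow> real" where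
  "vertex_vector V i = (\<lambda>j\<in>V. if j = i then 1 else 0)"

definition non_edge_space :: "'v set \<Rightarrow> 'v set set \<Rightarrow> (('v \<Rightarrow> real) list \<Rightarrow> real) set set" where
  "non_edge_space V E =
     LinearCombinations.module.span real_field (ext_power (vertex_space V) 2)
       {ext_wedge (vertex_space V) [vertex_vector V i, vertex_vector V j] | i j.
          i \<in> V \<and> j \<in> V \<and> {i, j} \<notin> E}"

definition dani_mainkar ::
  "'v set \<Rightarrow> 'v set set \<Rightarrow> (('v \<Rightarrow> real) \<times> (('v \<Rightarrow> real) list \<Rightarrow> real) set set) lie_algebra" where
  "dani_mainkar V E =
     module.extend
       (direct_sum (vertex_space V)
          (quot_module (ext_power (vertex_space V) 2) (non_edge_space V E)))
       (lie_algebra.fields (\<lambda>p q.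
          (\<zero>\<^bsub>vertex_space V\<^esub>,
           non_edge_space V E +>\<^bsub>ext_power (vertex_space V) 2\<^esub>
             ext_wedge (vertex_space V) [fst p, fst q])))"

definition independent_sets :: "'v set \<Rightarrow> 'v set set \<Rightarrow> nat \<Rightarrow> 'v set set" where
  "independent_sets V E k = {S. S \<subseteq> V \<and> indep S E \<and> card S = k}"

end

theory Submission
  imports Defs
begin

text \<open>
  Let \<open>x\<^sub>1, \<dots>, x\<^sub>n\<close> be the linear coordinates of the Lie algebra that belong to the vertices. The
  abelianization has these as a basis of its dual and zero differential, so the basic cohomology in
  degree \<open>k\<close> consists of the classes of all polynomials of degree \<open>k\<close> in the \<open>x\<^sub>i\<close> in the exterior
  algebra. The claim is that it has the classes of the monomials \<open>x\<^sub>S\<close> of the independent sets \<open>S\<close> with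
  \<open>k\<close> elements as a basis.

  They span. An edge \<open>{i, j}\<close> gives a coordinate \<open>\<epsilon>\<close> on the central summand, whose differential is
  \<open>x\<^sub>i \<and> x\<^sub>j\<close>. As the \<open>x\<^sub>i\<close> are closed, each monomial that contains an edge is a coboundary (lemmas
  \<open>d_edge_coord\<close>, \<open>monomial_edge\<close>, \<open>pullback_in_normal_span\<close>).

  They are linearly independent. Functions on the independent sets form the exterior face algebra, in
  which \<open>x\<^sub>S\<close> is zero unless \<open>S\<close> is independent. Send each \<open>x\<^sub>i\<close> to its generator there and the
  coordinates of the central summand to zero. The differential of a one-form is a combination of products of
  adjacent vertices, which this homomorphism kills; by the Leibniz rule it kills all coboundaries, and
  so the coefficient of \<open>x\<^sub>S\<close> is a functional on cohomology (lemmas \<open>face_rep_d\<close>,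
  \<open>coefficient_coboundary\<close>, \<open>coefficient_monomial\<close>).

  Much of the work goes into the objects themselves. The exterior algebra is a quotient of a free
  algebra, and each map out of it comes from its universal property (\<open>ext_lift_hom\<close>). The face
  algebra is realized by creation operators on functions of sets, so that only their anticommutation
  has to be verified; the same operators for a set with two elements show that a two-form has
  well-defined values at pairs of vectors. The differential is characterized by these values. It is
  unique because in finite dimension a two-form is determined by them (\<open>two_form_eqI\<close>), and it
  exists because derivations are homomorphisms into a square-zero extension
  (\<open>odd_derivation_exists\<close>).
\<close>


section \<open>Real vector spaces given by records\<close>

text \<open>
  The locale of modules over the field of real numbers, freed from the carrier conditions on
  scalars and from the record operations of that field.
\<close>

locale real_space = abelian_group M for M :: "(real, 'a, 'm) module_scheme" (structure) +
  assumes smult_closed [simp, intro]: "x \<in> carrier M \<Longrightarrow> c \<odot> x \<in> carrier M"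
    and smult_l_distr: "x \<in> carrier M \<Longrightarrow> (a + b) \<odot> x = a \<odot> x \<oplus> b \<odot> x"
    and smult_r_distr: "\<lbrakk>x \<in> carrier M; y \<in> carrier M\<rbrakk> \<Longrightarrow> c \<odot> (x \<oplus> y) = c \<odot> x \<oplus> c \<odot> y"
    and smult_assoc: "x \<in> carrier M \<Longrightarrow> (a * b) \<odot> x = a \<odot> (b \<odot> x)"
    and smult_one [simp]: "x \<in> carrier M \<Longrightarrow> 1 \<odot> x = x"

lemma real_space_iff_module: "real_space M \<longleftrightarrow> Module.module real_field M"
proof
  assume "real_space M"
  then interpret real_space M .
  show "Module.module real_field M"
    by (rule moduleI)
      (auto simp: class_cring.cring_axioms abelian_group_axioms smult_l_distr smult_r_distr smult_assoc)
next
  assume "Module.module real_field M"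
  then interpret M: Module.module real_field M .
  show "real_space M"
    using M.smult_closed M.smult_l_distr M.smult_r_distr M.smult_assoc1 M.smult_one
    by unfold_locales (auto)
qed

lemma real_space_cong:
  assumes "real_space M"
    and eq: "carrier M' = carrier M" "add M' = add M" "zero M' = zero M" "smult M' = smult M"
  shows "real_space M'"
proof -
  interpret M: real_space M by fact
  have "abelian_group M'"
    by (rule abelian_groupI) (auto simp: eq M.a_ac intro: M.l_neg bexI[of _ "\<ominus>\<^bsub>M\<^esub> x" for x])
  then show ?thesis
    by (rule real_space.intro)
      (auto intro!: real_space_axioms.intro
        simp: eq M.smult_l_distr M.smult_r_distr M.smult_assoc)
qed

lemma real_space_iff_vectorspace: "real_space M \<longleftrightarrow> vectorspace real_field M"
  by (auto simp: real_space_iff_module vectorspace_def class_field)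

abbreviation real_subspace :: "'a set \<Rightarrow> (real, 'a, 'm) module_scheme \<Rightarrow> bool" where
  "real_subspace H M \<equiv> submodule real_field H M"

abbreviation real_span :: "(real, 'a, 'm) module_scheme \<Rightarrow> 'a set \<Rightarrow> 'a set" where
  "real_span M B \<equiv> LinearCombinations.module.span real_field M B"

abbreviation linear_maps ::
  "(real, 'a, 'm) module_scheme \<Rightarrow> (real, 'b, 'n) module_scheme \<Rightarrow> ('a \<Rightarrow> 'b) set" where
  "linear_maps M N \<equiv> LinearCombinations.module_hom real_field M N"

lemma linear_maps_iff:
  "h \<in> linear_maps M N \<longleftrightarrow>
     (\<forall>x\<in>carrier M. h x \<in> carrier N) \<and>
     (\<forall>x\<in>carrier M. \<forall>y\<in>carrier M. h (x \<oplus>\<^bsub>M\<^esub> y) = h x \<oplus>\<^bsub>N\<^esub> h y) \<and>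
     (\<forall>c. \<forall>x\<in>carrier M. h (c \<odot>\<^bsub>M\<^esub> x) = c \<odot>\<^bsub>N\<^esub> h x)"
  by (auto simp: LinearCombinations.module_hom_def)

lemma linear_mapsI:
  assumes "\<And>x. x \<in> carrier M \<Longrightarrow> h x \<in> carrier N"
    and "\<And>x y. \<lbrakk>x \<in> carrier M; y \<in> carrier M\<rbrakk> \<Longrightarrow> h (x \<oplus>\<^bsub>M\<^esub> y) = h x \<oplus>\<^bsub>N\<^esub> h y"
    and "\<And>c x. x \<in> carrier M \<Longrightarrow> h (c \<odot>\<^bsub>M\<^esub> x) = c \<odot>\<^bsub>N\<^esub> h x"
  shows "h \<in> linear_maps M N"
  using assms by (auto simp: linear_maps_iff)

lemma linear_mapsD:
  assumes "h \<in> linear_maps M N"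
  shows "x \<in> carrier M \<Longrightarrow> h x \<in> carrier N"
    and "\<lbrakk>x \<in> carrier M; y \<in> carrier M\<rbrakk> \<Longrightarrow> h (x \<oplus>\<^bsub>M\<^esub> y) = h x \<oplus>\<^bsub>N\<^esub> h y"
    and "x \<in> carrier M \<Longrightarrow> h (c \<odot>\<^bsub>M\<^esub> x) = c \<odot>\<^bsub>N\<^esub> h x"
  using assms by (auto simp: linear_maps_iff)

context real_space
begin

lemma module_axioms: "Module.module real_field M"
  using real_space_axioms by (simp add: real_space_iff_module)

lemma smult_zero_left [simp]:
  assumes "x \<in> carrier M" shows "0 \<odot> x = \<zero>"
proof -
  have "0 \<odot> x \<oplus> 0 \<odot> x = 0 \<odot> x"
    using smult_l_distr[OF assms, of 0 0] by simp
  then show ?thesis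
    by (simp add: assms)
qed

lemma smult_zero_right [simp]: "c \<odot> \<zero> = \<zero>"
  using smult_assoc[of \<zero> c 0] by simp

text \<open>
  Sets closed under scalar multiplication are therefore closed under negation.
\<close>

lemma minus_eq_smult: "x \<in> carrier M \<Longrightarrow> \<ominus> x = (-1) \<odot> x"
proof -
  assume x: "x \<in> carrier M"
  have "(-1) \<odot> x \<oplus> x = \<zero>"
    using smult_l_distr[OF x, of "-1" 1] x by simp
  then show ?thesis
    using x by (metis minus_equality smult_closed)
qed

lemma real_subspaceI:
  assumes "H \<subseteq> carrier M" "\<zero> \<in> H" "\<And>x y. \<lbrakk>x \<in> H; y \<in> H\<rbrakk> \<Longrightarrow> x \<oplus> y \<in> H"
    and "\<And>c x. x \<in> H \<Longrightarrow> c \<odot> x \<in> H"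
  shows "real_subspace H M"
  using assms by (auto intro!: submodule.intro simp: module_axioms)

lemma real_subspace_UNIV: "real_subspace (carrier M) M"
  by (rule real_subspaceI) auto

lemma span_is_real_subspace: "B \<subseteq> carrier M \<Longrightarrow> real_subspace (real_span M B) M"
  by (rule LinearCombinations.module.span_is_submodule[OF module_axioms])

lemma span_superset: "B \<subseteq> carrier M \<Longrightarrow> b \<in> B \<Longrightarrow> b \<in> real_span M B"
  using LinearCombinations.module.in_own_span[OF module_axioms] by blast

lemma span_subset: "\<lbrakk>B \<subseteq> H; real_subspace H M\<rbrakk> \<Longrightarrow> real_span M B \<subseteq> H"
  by (rule LinearCombinations.module.span_is_subset[OF module_axioms])

text \<open>
  The vectors with a property closed under the linear operations form a subspace.
\<close>

lemma span_induct [consumes 2, case_names base zero add smult]: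
  assumes "x \<in> real_span M B" "B \<subseteq> carrier M"
    and base: "\<And>b. b \<in> B \<Longrightarrow> P b" and zero: "P \<zero>"
    and add: "\<And>x y. \<lbrakk>x \<in> carrier M; y \<in> carrier M; P x; P y\<rbrakk> \<Longrightarrow> P (x \<oplus> y)"
    and smult: "\<And>c x. \<lbrakk>x \<in> carrier M; P x\<rbrakk> \<Longrightarrow> P (c \<odot> x)"
  shows "P x"
proof -
  have "real_subspace {x \<in> carrier M. P x} M"
    by (rule real_subspaceI) (auto intro: assms)
  with span_subset[of B "{x \<in> carrier M. P x}"] assms show ?thesis
    by blast
qed

end

context
  fixes M :: "(real, 'a, 'm) module_scheme" and H
  assumes M: "real_space M" and H: "real_subspace H M"
begin

interpretation real_space M by (rule M)

lemma real_subspaceD: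
  shows "x \<in> H \<Longrightarrow> x \<in> carrier M" and "\<zero>\<^bsub>M\<^esub> \<in> H"
    and "\<lbrakk>x \<in> H; y \<in> H\<rbrakk> \<Longrightarrow> x \<oplus>\<^bsub>M\<^esub> y \<in> H" and "x \<in> H \<Longrightarrow> c \<odot>\<^bsub>M\<^esub> x \<in> H"
    and "x \<in> H \<Longrightarrow> \<ominus>\<^bsub>M\<^esub> x \<in> H"
proof -
  interpret submodule real_field H M by (rule H)
  show "x \<in> H \<Longrightarrow> x \<in> carrier M" "\<zero>\<^bsub>M\<^esub> \<in> H"
    "\<lbrakk>x \<in> H; y \<in> H\<rbrakk> \<Longrightarrow> x \<oplus>\<^bsub>M\<^esub> y \<in> H" "x \<in> H \<Longrightarrow> c \<odot>\<^bsub>M\<^esub> x \<in> H"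
    using subset smult_closed by auto
  then show "x \<in> H \<Longrightarrow> \<ominus>\<^bsub>M\<^esub> x \<in> H"
    using smult_closed by (auto simp: minus_eq_smult)
qed

lemma real_subspace_is_real_space: "real_space (M\<lparr>carrier := H\<rparr>)"
  using LinearCombinations.module.submodule_is_module[OF module_axioms H]
  by (simp add: real_space_iff_module)

lemma real_subspace_additive_subgroup: "abelian_subgroup H M"
proof -
  have sub: "H \<subseteq> carrier M"
    by (rule subsetI) (rule real_subspaceD(1))
  have ne: "H \<noteq> {}"
    by (rule ex_in_conv[THEN iffD1], rule exI, rule real_subspaceD(2))
  have "subgroup H (add_monoid M)"
    by (rule add.subgroupI[OF sub ne real_subspaceD(5) real_subspaceD(3)])
  then have "additive_subgroup H M"
    by (rule additive_subgroup.intro)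
  then show ?thesis
    by (rule abelian_subgroupI3) (rule abelian_group_axioms)
qed

end

lemma linear_map_zero:
  assumes "real_space M" "real_space N" "h \<in> linear_maps M N" shows "h \<zero>\<^bsub>M\<^esub> = \<zero>\<^bsub>N\<^esub>"
proof -
  interpret M: real_space M by fact
  interpret N: real_space N by fact
  have "h (0 \<odot>\<^bsub>M\<^esub> \<zero>\<^bsub>M\<^esub>) = 0 \<odot>\<^bsub>N\<^esub> h \<zero>\<^bsub>M\<^esub>"
    by (rule linear_mapsD(3)[OF assms(3)]) auto
  then show ?thesis
    using linear_mapsD(1)[OF assms(3), of "\<zero>\<^bsub>M\<^esub>"] by simp
qed

lemma linear_map_minus:
  assumes "real_space M" "real_space N" "h \<in> linear_maps M N" "x \<in> carrier M"
  shows "h (\<ominus>\<^bsub>M\<^esub> x) = \<ominus>\<^bsub>N\<^esub> h x"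
proof -
  interpret M: real_space M by fact
  interpret N: real_space N by fact
  show ?thesis
    using linear_mapsD[OF assms(3)] assms(4)
    by (simp add: M.minus_eq_smult N.minus_eq_smult)
qed

text \<open>
  Partial sums stay in the subspace, so linearity there is enough. This applies to functionals that
  are linear on two-forms but not on the whole exterior algebra.
\<close>

lemma linear_map_finsum_subspace:
  assumes M: "real_space M" and H: "real_subspace H M" and N: "real_space N"
    and h: "h \<in> linear_maps (M\<lparr>carrier := H\<rparr>) N"
    and I: "finite I" and f: "\<And>i. i \<in> I \<Longrightarrow> f i \<in> H"
  shows "(\<Oplus>\<^bsub>M\<^esub>i\<in>I. f i) \<in> H \<and> h (\<Oplus>\<^bsub>M\<^esub>i\<in>I. f i) = (\<Oplus>\<^bsub>N\<^esub>i\<in>I. h (f i))"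
proof -
  interpret M: real_space M by (rule M)
  interpret N: real_space N by (rule N)
  note HD = real_subspaceD[OF M H]
  note hD = linear_mapsD[OF h, simplified]
  have zero: "h \<zero>\<^bsub>M\<^esub> = \<zero>\<^bsub>N\<^esub>"
    using linear_map_zero[OF real_subspace_is_real_space[OF M H] N h] by simp
  show ?thesis
    using I f
  proof (induction I rule: finite_induct)
    case (insert i I)
    then have "f \<in> I \<rightarrow> carrier M" "f i \<in> carrier M" "(\<lambda>i. h (f i)) \<in> I \<rightarrow> carrier N" "h (f i) \<in> carrier N"
      using HD(1) hD(1) by auto
    then show ?case
      using insert HD(3) hD(2) by simp
  qed (simp add: HD(2) zero)
qed

lemma linear_map_finsum:
  assumes "real_space M" "real_space N" "h \<in> linear_maps M N"
    and "finite I" "f \<in> I \<rightarrow> carrier M"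
  shows "h (\<Oplus>\<^bsub>M\<^esub>i\<in>I. f i) = (\<Oplus>\<^bsub>N\<^esub>i\<in>I. h (f i))"
  using linear_map_finsum_subspace[OF assms(1) real_space.real_subspace_UNIV[OF assms(1)] assms(2)]
    assms(3-) by auto

lemma linear_image_subspace:
  assumes M: "real_space M" and N: "real_space N" and h: "h \<in> linear_maps M N"
    and H: "real_subspace H M"
  shows "real_subspace (h ` H) N"
proof -
  note HD = real_subspaceD[OF M H] and hD = linear_mapsD[OF h]
  show ?thesis
  proof (rule real_space.real_subspaceI[OF N])
    show "\<zero>\<^bsub>N\<^esub> \<in> h ` H"
      using linear_map_zero[OF M N h] HD(2) by (metis image_eqI)
    show "x \<oplus>\<^bsub>N\<^esub> y \<in> h ` H" if xy: "x \<in> h ` H" "y \<in> h ` H" for x y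
    proof -
      obtain a b where ab: "a \<in> H" "x = h a" "b \<in> H" "y = h b"
        using xy by blast
      then have "x \<oplus>\<^bsub>N\<^esub> y = h (a \<oplus>\<^bsub>M\<^esub> b)"
        by (simp add: hD(2) HD(1))
      then show ?thesis
        using HD(3)[OF ab(1,3)] by blast
    qed
    show "c \<odot>\<^bsub>N\<^esub> x \<in> h ` H" if x: "x \<in> h ` H" for c x
    proof -
      obtain a where a: "a \<in> H" "x = h a"
        using x by blast
      then have "c \<odot>\<^bsub>N\<^esub> x = h (c \<odot>\<^bsub>M\<^esub> a)"
        by (simp add: hD(3) HD(1))
      then show ?thesis
        using HD(4)[OF a(1)] by blast
    qed
    show "h ` H \<subseteq> carrier N"
      by (rule image_subsetI) (rule hD(1)[OF HD(1)])
  qed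
qed

text \<open>The field of scalars as a vector space, so that linear functionals are linear maps.\<close>

definition real_line :: "(real, real) module" where
  "real_line = \<lparr>carrier = UNIV, mult = (*), one = 1, zero = 0, add = (+), smult = (*)\<rparr>"

lemma real_line_simps [simp]:
  "carrier real_line = UNIV" "zero real_line = 0" "add real_line = (+)" "smult real_line = (*)"
  by (auto simp: real_line_def)

lemma real_line_space: "real_space real_line"
proof -
  have "abelian_group real_line"
    by (rule abelian_groupI) (auto intro: exI[of _ "- x" for x :: real] simp: real_line_def)
  then show ?thesis
    by (rule real_space.intro) (auto intro!: real_space_axioms.intro simp: algebra_simps)
qed

lemma finsum_real_line [simp]: "finsum real_line f I = sum f I"
proof -
  interpret real_space real_line by (rule real_line_space)
  show ?thesis
    by (induction I rule: infinite_finite_induct) auto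
qed

lemma linear_functional_finsum:
  assumes "real_space M" "h \<in> linear_maps M real_line" "finite I" "f \<in> I \<rightarrow> carrier M"
  shows "h (\<Oplus>\<^bsub>M\<^esub>i\<in>I. f i) = (\<Sum>i\<in>I. h (f i))"
  using linear_map_finsum[OF assms(1) real_line_space assms(2-4)] by simp


subsection \<open>Quotients\<close>

lemma quot_module_simps:
  "carrier (quot_module M N) = (\<lambda>x. N +>\<^bsub>M\<^esub> x) ` carrier M"
  "zero (quot_module M N) = N"
  "add (quot_module M N) = set_add M"
  "mult (quot_module M N) = rcoset_mult M N"
  "one (quot_module M N) = N +>\<^bsub>M\<^esub> \<one>\<^bsub>M\<^esub>"
  "smult (quot_module M N) = (\<lambda>c X. \<Union>x\<in>X. N +>\<^bsub>M\<^esub> (c \<odot>\<^bsub>M\<^esub> x))"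
  by (auto simp: quot_module_def FactRing_def A_RCOSETS_def RCOSETS_def a_r_coset_def)

locale real_quotient = real_space M for M :: "(real, 'a, 'm) module_scheme" (structure) +
  fixes N assumes N: "real_subspace N M"
begin

sublocale N: abelian_subgroup N M
  by (rule real_subspace_additive_subgroup[OF real_space_axioms N])

abbreviation proj :: "'a \<Rightarrow> 'a set" where "proj x \<equiv> N +>\<^bsub>M\<^esub> x"

lemma mem_proj_iff: "y \<in> proj x \<longleftrightarrow> (\<exists>n\<in>N. y = n \<oplus> x)"
  by (auto simp: a_r_coset_def r_coset_def)

lemma proj_self: "x \<in> carrier M \<Longrightarrow> x \<in> proj x"
  using N.a_rcos_self by blast

lemma proj_eqI: "n \<in> N \<Longrightarrow> x \<in> carrier M \<Longrightarrow> proj (n \<oplus> x) = proj x"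
  using N.a_repr_independence'[of "n \<oplus> x" x] by (auto simp: mem_proj_iff)

lemma proj_eq_zero_iff: "x \<in> carrier M \<Longrightarrow> proj x = N \<longleftrightarrow> x \<in> N"
  using N.a_rcos_const N.a_rcos_self by blast

lemma proj_add: 
  "\<lbrakk>x \<in> carrier M; y \<in> carrier M\<rbrakk> \<Longrightarrow> proj x \<oplus>\<^bsub>quot_module M N\<^esub> proj y = proj (x \<oplus> y)"
  by (simp add: quot_module_simps N.a_rcos_sum)

text \<open>
  The scalar multiple of a coset is a union over its representatives; all of them contribute the
  same coset.
\<close>

lemma proj_smult:
  assumes "x \<in> carrier M" shows "c \<odot>\<^bsub>quot_module M N\<^esub> proj x = proj (c \<odot> x)"
proof -
  have "proj (c \<odot> y) = proj (c \<odot> x)" if y: "y \<in> proj x" for y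
  proof -
    obtain n where n: "n \<in> N" "y = n \<oplus> x"
      using y by (auto simp: mem_proj_iff)
    then show ?thesis
      using assms real_subspaceD[OF real_space_axioms N]
      by (simp add: smult_r_distr proj_eqI)
  qed
  then have "(\<Union>y\<in>proj x. proj (c \<odot> y)) = (\<Union>y\<in>proj x. proj (c \<odot> x))"
    by (rule SUP_cong[OF refl])
  then show ?thesis
    using proj_self[OF assms] by (auto simp: quot_module_simps)
qed

lemma quotient_real_space: "real_space (quot_module M N)"
proof -
  let ?Q = "quot_module M N"
  note [simp] = proj_add proj_smult
  have zero: "\<zero>\<^bsub>?Q\<^esub> = proj \<zero>"
    using proj_eq_zero_iff[of "\<zero>"] real_subspaceD(2)[OF real_space_axioms N]
    by (simp add: quot_module_simps)
  have carr: "\<exists>x\<in>carrier M. X = proj x" if "X \<in> carrier ?Q" for X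
    using that by (auto simp: quot_module_simps)
  have [simp]: "proj x \<in> carrier ?Q" if "x \<in> carrier M" for x
    using that by (auto simp: quot_module_simps)
  have "abelian_group ?Q"
  proof (rule abelian_groupI)
    fix X assume "X \<in> carrier ?Q"
    then obtain x where "x \<in> carrier M" "X = proj x" using carr by blast
    then show "\<exists>Y\<in>carrier ?Q. Y \<oplus>\<^bsub>?Q\<^esub> X = \<zero>\<^bsub>?Q\<^esub>"
      unfolding zero by (intro bexI[of _ "proj (\<ominus> x)"]) (auto simp: l_neg)
  qed (auto simp: zero a_ac dest!: carr)
  then show ?thesis
    by (rule real_space.intro)
      (auto intro!: real_space_axioms.intro dest!: carr
        simp: smult_l_distr smult_r_distr smult_assoc)
qed

lemma proj_linear: "proj \<in> linear_maps M (quot_module M N)"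
  by (rule linear_mapsI) (simp_all add: proj_add proj_smult, simp add: quot_module_simps)

text \<open>
  Taking the unique element of an image describes functions on cosets without choosing
  representatives.
\<close>

lemma the_elem_image_proj:
  assumes "\<And>n x. \<lbrakk>n \<in> N; x \<in> carrier M\<rbrakk> \<Longrightarrow> h (n \<oplus> x) = h x" "x \<in> carrier M"
  shows "the_elem (h ` proj x) = h x"
proof -
  have "h ` proj x = {h x}"
    using assms proj_self[of x] by (auto simp: mem_proj_iff)
  then show ?thesis by simp
qed

lemma quotient_linear_map:
  assumes P: "real_space P" and h: "h \<in> linear_maps M P" and N0: "\<And>n. n \<in> N \<Longrightarrow> h n = \<zero>\<^bsub>P\<^esub>"
  shows "(\<lambda>X. the_elem (h ` X)) \<in> linear_maps (quot_module M N) P"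
    and "x \<in> carrier M \<Longrightarrow> the_elem (h ` proj x) = h x"
proof -
  interpret P: real_space P by fact
  note hD = linear_mapsD[OF h]
  have eq: "the_elem (h ` proj x) = h x" if "x \<in> carrier M" for x
    by (rule the_elem_image_proj)
      (use that in \<open>auto simp: hD N0 real_subspaceD(1)[OF real_space_axioms N]\<close>)
  then show "x \<in> carrier M \<Longrightarrow> the_elem (h ` proj x) = h x" .
  have carr: "\<exists>x\<in>carrier M. X = proj x" if "X \<in> carrier (quot_module M N)" for X
    using that by (auto simp: quot_module_simps)
  show "(\<lambda>X. the_elem (h ` X)) \<in> linear_maps (quot_module M N) P"
    by (rule linear_mapsI) (auto dest!: carr simp: eq hD proj_add proj_smult)
qed

end


subsection \<open>Dimension from a dual family of functionals\<close>

text \<open>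
  Evaluating the \<open>i\<close>-th functional on a linear relation among the \<open>b j\<close> isolates the \<open>i\<close>-th
  coefficient. So the \<open>b j\<close> are independent and distinct, hence a basis.
\<close>

lemma dim_eq_card_dual_family:
  assumes M: "real_space M" and I: "finite I" and b: "\<And>i. i \<in> I \<Longrightarrow> b i \<in> carrier M"
    and k: "\<And>i. i \<in> I \<Longrightarrow> \<kappa> i \<in> linear_maps M real_line"
    and dual: "\<And>i j. \<lbrakk>i \<in> I; j \<in> I\<rbrakk> \<Longrightarrow> \<kappa> i (b j) \<noteq> 0 \<longleftrightarrow> i = j"
    and gen: "carrier M \<subseteq> real_span M (b ` I)"
  shows "vectorspace.dim real_field M = card I"
proof -
  interpret real_space M by fact
  interpret V: vectorspace real_field M
    using M by (simp add: real_space_iff_vectorspace)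
  have inj: "inj_on b I"
    by (rule inj_onI) (metis dual)
  have bI: "b ` I \<subseteq> carrier M"
    using b by auto
  have "V.lin_indpt (b ` I)"
  proof (rule V.finite_lin_indpt2)
    fix a assume a: "V.lincomb a (b ` I) = \<zero>\<^bsub>M\<^esub>"
    show "\<forall>v\<in>b ` I. a v = \<zero>\<^bsub>real_field\<^esub>"
    proof
      fix v assume "v \<in> b ` I"
      then obtain i where i: "i \<in> I" "v = b i" by auto
      note ki = linear_mapsD[OF k[OF i(1)]]
      have "0 = \<kappa> i (V.lincomb a (b ` I))"
        using linear_map_zero[OF M real_line_space k[OF i(1)]] a by simp
      also have "\<dots> = (\<Sum>w\<in>b ` I. \<kappa> i (a w \<odot>\<^bsub>M\<^esub> w))"
        unfolding V.lincomb_def using I bI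
        by (intro linear_functional_finsum[OF M k[OF i(1)]]) auto
      also have "\<dots> = (\<Sum>w\<in>b ` I. a w * \<kappa> i w)"
        using bI ki(3) by (intro sum.cong) auto
      also have "\<dots> = (\<Sum>j\<in>I. a (b j) * \<kappa> i (b j))"
        by (simp add: sum.reindex[OF inj])
      also have "\<dots> = (\<Sum>j\<in>I. if j = i then a (b i) * \<kappa> i (b i) else 0)"
        by (rule sum.cong) (use dual i in auto)
      also have "\<dots> = a (b i) * \<kappa> i (b i)"
        using I i by simp
      finally show "a v = \<zero>\<^bsub>real_field\<^esub>"
        using dual[OF i(1) i(1)] i by simp
    qed
  qed (use I bI in auto)
  moreover have "V.gen_set (b ` I)"
    using gen span_subset[OF bI real_subspace_UNIV] by auto
  ultimately have "V.dim = card (b ` I)"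
    using I bI by (intro V.dim_basis) (auto simp: V.basis_def)
  then show ?thesis
    by (simp add: card_image[OF inj])
qed


section \<open>Real algebras and the free algebra\<close>

locale real_algebra = ring A + real_space A for A :: "(real, 'a, 'm) module_scheme" (structure) +
  assumes smult_mult_left: "\<lbrakk>x \<in> carrier A; y \<in> carrier A\<rbrakk> \<Longrightarrow> (c \<odot> x) \<otimes> y = c \<odot> (x \<otimes> y)"
    and smult_mult_right: "\<lbrakk>x \<in> carrier A; y \<in> carrier A\<rbrakk> \<Longrightarrow> x \<otimes> (c \<odot> y) = c \<odot> (x \<otimes> y)"

abbreviation algebra_homs ::
  "(real, 'a, 'm) module_scheme \<Rightarrow> (real, 'b, 'n) module_scheme \<Rightarrow> ('a \<Rightarrow> 'b) set" where
  "algebra_homs A B \<equiv> linear_maps A B \<inter> Ring.ring_hom A B"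

lemma real_algebraI:
  fixes A :: "(real, 'a, 'm) module_scheme" (structure)
  assumes "real_space A"
    and "\<And>x y. \<lbrakk>x \<in> carrier A; y \<in> carrier A\<rbrakk> \<Longrightarrow> x \<otimes> y \<in> carrier A" "\<one> \<in> carrier A"
    and "\<And>x y z. \<lbrakk>x \<in> carrier A; y \<in> carrier A; z \<in> carrier A\<rbrakk> \<Longrightarrow> (x \<otimes> y) \<otimes> z = x \<otimes> (y \<otimes> z)"
    and "\<And>x. x \<in> carrier A \<Longrightarrow> \<one> \<otimes> x = x" "\<And>x. x \<in> carrier A \<Longrightarrow> x \<otimes> \<one> = x"
    and "\<And>x y z. \<lbrakk>x \<in> carrier A; y \<in> carrier A; z \<in> carrier A\<rbrakk> \<Longrightarrow> (x \<oplus> y) \<otimes> z = x \<otimes> z \<oplus> y \<otimes> z"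
    and "\<And>x y z. \<lbrakk>x \<in> carrier A; y \<in> carrier A; z \<in> carrier A\<rbrakk> \<Longrightarrow> z \<otimes> (x \<oplus> y) = z \<otimes> x \<oplus> z \<otimes> y"
    and "\<And>c x y. \<lbrakk>x \<in> carrier A; y \<in> carrier A\<rbrakk> \<Longrightarrow> (c \<odot> x) \<otimes> y = c \<odot> (x \<otimes> y)"
    and "\<And>c x y. \<lbrakk>x \<in> carrier A; y \<in> carrier A\<rbrakk> \<Longrightarrow> x \<otimes> (c \<odot> y) = c \<odot> (x \<otimes> y)"
  shows "real_algebra A"
proof -
  interpret real_space A by fact
  have "ring A"
    by (intro ringI monoidI abelian_group_axioms) (use assms in auto)
  then show ?thesis
    using assms(1,9,10) by (auto intro!: real_algebra.intro real_algebra_axioms.intro)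
qed

text \<open>
  Scaling is multiplication by a multiple of the unit.
\<close>

lemma (in real_algebra) ideal_is_real_subspace:
  assumes "ideal I A" shows "real_subspace I A"
proof -
  interpret I: ideal I A by fact
  have "c \<odot> x \<in> I" if "x \<in> I" for c x
    using I.I_l_closed[OF that, of "c \<odot> \<one>"] I.a_Hcarr[OF that] by (simp add: smult_mult_left)
  then show ?thesis
    by (intro real_subspaceI) (auto simp: I.a_Hcarr)
qed

lemma algebra_homD:
  assumes "h \<in> algebra_homs A B"
  shows "x \<in> carrier A \<Longrightarrow> h x \<in> carrier B"
    and "\<lbrakk>x \<in> carrier A; y \<in> carrier A\<rbrakk> \<Longrightarrow> h (x \<oplus>\<^bsub>A\<^esub> y) = h x \<oplus>\<^bsub>B\<^esub> h y"
    and "x \<in> carrier A \<Longrightarrow> h (c \<odot>\<^bsub>A\<^esub> x) = c \<odot>\<^bsub>B\<^esub> h x"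
    and "\<lbrakk>x \<in> carrier A; y \<in> carrier A\<rbrakk> \<Longrightarrow> h (x \<otimes>\<^bsub>A\<^esub> y) = h x \<otimes>\<^bsub>B\<^esub> h y"
    and "h \<one>\<^bsub>A\<^esub> = \<one>\<^bsub>B\<^esub>"
  using assms by (auto simp: linear_maps_iff Ring.ring_hom_def)

lemma algebra_homI:
  assumes "h \<in> linear_maps A B"
    and "\<And>x y. \<lbrakk>x \<in> carrier A; y \<in> carrier A\<rbrakk> \<Longrightarrow> h (x \<otimes>\<^bsub>A\<^esub> y) = h x \<otimes>\<^bsub>B\<^esub> h y"
    and "h \<one>\<^bsub>A\<^esub> = \<one>\<^bsub>B\<^esub>"
  shows "h \<in> algebra_homs A B"
  using assms by (auto simp: linear_maps_iff Ring.ring_hom_def)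

lemma algebra_hom_kernel_ideal:
  assumes "real_algebra A" "real_algebra B" "h \<in> algebra_homs A B"
  shows "ideal {x \<in> carrier A. h x = \<zero>\<^bsub>B\<^esub>} A"
proof -
  interpret A: real_algebra A by fact
  interpret B: real_algebra B by fact
  interpret ring_hom_ring A B h
    by (rule ring_hom_ringI2[OF A.ring_axioms B.ring_axioms IntD2[OF assms(3)]])
  show ?thesis
    using kernel_is_ideal unfolding a_kernel_def' .
qed


subsection \<open>Convolution of families indexed by words\<close>

definition conv :: "('a list \<Rightarrow> real) \<Rightarrow> ('a list \<Rightarrow> real) \<Rightarrow> 'a list \<Rightarrow> real" where
  "conv f g w = (\<Sum>i\<le>length w. f (take i w) * g (drop i w))"

definition free_word :: "'a list \<Rightarrow> 'a list \<Rightarrow> real" where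
  "free_word w = (\<lambda>v. if v = w then 1 else 0)"

lemma conv_Nil [simp]: "conv f g [] = f [] * g []"
  by (simp add: conv_def)

text \<open>
  Splitting off the first letter turns identities of convolutions into inductions over words.
\<close>

lemma conv_Cons [simp]: "conv f g (x # w) = f [] * g (x # w) + conv (\<lambda>v. f (x # v)) g w"
  unfolding conv_def length_Cons sum.atMost_Suc_shift by simp

lemma conv_linear_left: "conv (\<lambda>v. c * f v + f' v) g w = c * conv f g w + conv f' g w"
  by (simp add: conv_def sum.distrib sum_distrib_left algebra_simps)

lemma conv_zero_left [simp]: "conv (\<lambda>v. 0) g w = 0"
  by (simp add: conv_def)

lemma conv_assoc: "conv (conv f g) h w = conv f (conv g h) w"
proof (induction w arbitrary: f)
  case (Cons x w)
  have "conv (\<lambda>v. conv f g (x # v)) h w = f [] * conv (\<lambda>v. g (x # v)) h w + conv (\<lambda>v. f (x # v)) (conv g h) w"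
    by (simp add: conv_linear_left Cons.IH)
  then show ?case
    by (simp add: algebra_simps)
qed simp

lemma conv_free_word_Nil_left: "conv (free_word []) f w = f w"
  by (cases w) (simp_all add: free_word_def)

lemma conv_free_word_Nil_right: "conv f (free_word []) w = f w"
  by (induction w arbitrary: f) (simp_all add: free_word_def)

text \<open>
  Words multiply by concatenation, so the convolution is the product of the monoid algebra of words.
\<close>

lemma conv_free_word: "conv (free_word u) (free_word v) w = free_word (u @ v) w"
proof (induction w arbitrary: u)
  case Nil
  then show ?case by (cases u) (auto simp: free_word_def)
next
  case (Cons x w)
  show ?case
  proof (cases u)
    case Nil
    then show ?thesis by (simp only: append_Nil conv_free_word_Nil_left)
  next
    case (Cons a u')
    have "(\<lambda>v. free_word u (x # v)) = (if x = a then free_word u' else (\<lambda>v. 0))"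
      using Cons by (auto simp: free_word_def fun_eq_iff)
    then show ?thesis
      using Cons.IH[of u'] Cons by (auto simp: free_word_def)
  qed
qed


subsection \<open>The free algebra\<close>

lemma free_algebra_simps:
  "carrier (free_algebra S) = {f. finite {w. f w \<noteq> 0} \<and> {w. f w \<noteq> 0} \<subseteq> lists S}"
  "mult (free_algebra S) = conv" "one (free_algebra S) = free_word []"
  "zero (free_algebra S) = (\<lambda>w. 0)" "add (free_algebra S) = (\<lambda>f g w. f w + g w)"
  "smult (free_algebra S) = (\<lambda>c f w. c * f w)"
  by (auto simp: free_algebra_def conv_def free_word_def fun_eq_iff)

lemma free_gen_eq_free_word: "free_gen u = free_word [u]"
  by (simp add: free_gen_def free_word_def)

lemma free_word_closed: "w \<in> lists S \<Longrightarrow> free_word w \<in> carrier (free_algebra S)"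
  by (auto simp: free_algebra_simps free_word_def)

lemma free_algebra_real_algebra: "real_algebra (free_algebra S)"
proof -
  let ?F = "free_algebra S"
  have add_closed: "(\<lambda>w. f w + g w) \<in> carrier ?F" if "f \<in> carrier ?F" "g \<in> carrier ?F" for f g
  proof -
    have "{w. f w + g w \<noteq> 0} \<subseteq> {w. f w \<noteq> 0} \<union> {w. g w \<noteq> 0}"
      by auto
    then show ?thesis
      using that unfolding free_algebra_simps by (auto intro: finite_subset)
  qed
  have smult_closed: "(\<lambda>w. c * f w) \<in> carrier ?F" if "f \<in> carrier ?F" for f c
  proof -
    have "{w. c * f w \<noteq> 0} \<subseteq> {w. f w \<noteq> 0}"
      by auto
    then show ?thesis
      using that unfolding free_algebra_simps by (auto intro: finite_subset)
  qed
  have mult_closed: "conv f g \<in> carrier ?F" if "f \<in> carrier ?F" "g \<in> carrier ?F" for f g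
  proof -
    have sub: "{w. conv f g w \<noteq> 0} \<subseteq> (\<lambda>(u, v). u @ v) ` ({w. f w \<noteq> 0} \<times> {w. g w \<noteq> 0})" (is "_ \<subseteq> ?R")
    proof
      fix w assume "w \<in> {w. conv f g w \<noteq> 0}"
      then obtain i where "f (take i w) * g (drop i w) \<noteq> 0"
        unfolding conv_def by (auto elim: sum.not_neutral_contains_not_neutral)
      then show "w \<in> ?R"
        by (intro image_eqI[of _ _ "(take i w, drop i w)"]) auto
    qed
    have "?R \<subseteq> (\<lambda>(u, v). u @ v) ` (lists S \<times> lists S)"
      using that unfolding free_algebra_simps by (intro image_mono Sigma_mono) auto
    also have "\<dots> \<subseteq> lists S"
      by auto
    finally have "finite ?R" "?R \<subseteq> lists S"
      using that unfolding free_algebra_simps by auto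
    with sub show ?thesis
      unfolding free_algebra_simps by (auto intro: finite_subset)
  qed
  have "abelian_group ?F"
  proof (rule abelian_groupI)
    fix f assume "f \<in> carrier ?F"
    then show "\<exists>g\<in>carrier ?F. g \<oplus>\<^bsub>?F\<^esub> f = \<zero>\<^bsub>?F\<^esub>"
      using smult_closed[of f "-1"]
      by (intro bexI[of _ "\<lambda>w. -1 * f w"]) (auto simp: free_algebra_simps(2-))
  qed (auto simp: free_algebra_simps(2-) add_closed, simp add: free_algebra_simps)
  then have "real_space ?F"
    by (rule real_space.intro)
      (auto intro!: real_space_axioms.intro simp: free_algebra_simps(2-) smult_closed algebra_simps)
  moreover have "conv (\<lambda>w. c * f w) g = (\<lambda>w. c * conv f g w)"
    "conv f (\<lambda>w. c * g w) = (\<lambda>w. c * conv f g w)"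
    "conv (\<lambda>w. f w + f' w) g = (\<lambda>w. conv f g w + conv f' g w)"
    "conv f (\<lambda>w. g w + g' w) = (\<lambda>w. conv f g w + conv f g' w)"
    for c and f f' g g' :: "'a list \<Rightarrow> real"
    by (auto simp: conv_def sum_distrib_left sum.distrib algebra_simps fun_eq_iff)
  ultimately show ?thesis
    by (intro real_algebraI)
      (auto simp: free_algebra_simps(2-) mult_closed conv_assoc fun_eq_iff
        conv_free_word_Nil_left conv_free_word_Nil_right intro!: free_word_closed)
qed

text \<open>
  A finitely supported family is a sum of multiples of words: remove one point of the support at a
  time.
\<close>

lemma free_algebra_induct [consumes 1, case_names zero add smult_word]:
  assumes "f \<in> carrier (free_algebra S)"
    and zero: "P \<zero>\<^bsub>free_algebra S\<^esub>"
    and add: "\<And>f g. \<lbrakk>f \<in> carrier (free_algebra S); g \<in> carrier (free_algebra S); P f; P g\<rbrakk>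
      \<Longrightarrow> P (f \<oplus>\<^bsub>free_algebra S\<^esub> g)"
    and word: "\<And>c w. w \<in> lists S \<Longrightarrow> P (c \<odot>\<^bsub>free_algebra S\<^esub> free_word w)"
  shows "P f"
proof -
  have "P f" if "finite T" "T \<subseteq> lists S" "{w. f w \<noteq> 0} \<subseteq> T" for T f
    using that
  proof (induction T arbitrary: f rule: finite_induct)
    case empty
    then have "f = (\<lambda>w. 0)" by auto
    then show ?case
      using zero by (simp add: free_algebra_simps)
  next
    case (insert u T)
    let ?g = "f(u := 0)"
    have g: "{w. ?g w \<noteq> 0} \<subseteq> T"
      using insert.prems by auto
    then have "?g \<in> carrier (free_algebra S)"
      using insert.hyps insert.prems by (auto simp: free_algebra_simps intro: finite_subset)
    moreover have "f u \<odot>\<^bsub>free_algebra S\<^esub> free_word u \<in> carrier (free_algebra S)"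
      using insert.prems by (auto simp: free_algebra_simps free_word_def)
    moreover have "f = (f u \<odot>\<^bsub>free_algebra S\<^esub> free_word u) \<oplus>\<^bsub>free_algebra S\<^esub> ?g"
      by (auto simp: free_algebra_simps free_word_def)
    ultimately show ?case
      using add word insert.IH[OF _ g] insert.prems by (metis insert_subset)
  qed
  then show ?thesis
    using assms(1) by (auto simp: free_algebra_simps)
qed

text \<open>
  The words form a basis of the free algebra, so their images under a linear map are arbitrary. The
  sum over the support is finite, but the support of a sum may be smaller than expected; linearity
  is therefore read off from sums over a common finite superset.
\<close>

definition free_lift ::
  "(real, 'b, 'n) module_scheme \<Rightarrow> ('a list \<Rightarrow> 'b) \<Rightarrow> ('a list \<Rightarrow> real) \<Rightarrow> 'b" where
  "free_lift M \<beta> f = (\<Oplus>\<^bsub>M\<^esub>w\<in>{w. f w \<noteq> 0}. f w \<odot>\<^bsub>M\<^esub> \<beta> w)"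

context
  fixes M :: "(real, 'b, 'n) module_scheme" and S :: "'a set" and \<beta> :: "'a list \<Rightarrow> 'b"
  assumes M: "real_space M" and \<beta>: "\<And>w. w \<in> lists S \<Longrightarrow> \<beta> w \<in> carrier M"
begin

interpretation real_space M by (rule M)

lemma free_lift_superset:
  assumes "finite T" "{w. f w \<noteq> 0} \<subseteq> T" "T \<subseteq> lists S"
  shows "free_lift M \<beta> f = (\<Oplus>\<^bsub>M\<^esub>w\<in>T. f w \<odot>\<^bsub>M\<^esub> \<beta> w)"
proof -
  have "\<beta> w \<in> carrier M" if "w \<in> T" for w
    using assms(3) that by (blast intro: \<beta>)
  then show ?thesis
    unfolding free_lift_def using assms(1,2)
    by (intro add.finprod_mono_neutral_cong_left) auto
qed

lemma free_lift_linear: "free_lift M \<beta> \<in> linear_maps (free_algebra S) M"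
proof (rule linear_mapsI)
  fix f assume f: "f \<in> carrier (free_algebra S)"
  then show "free_lift M \<beta> f \<in> carrier M"
    unfolding free_lift_def using \<beta> by (intro finsum_closed) (auto simp: free_algebra_simps)
  fix c
  let ?T = "{w. f w \<noteq> 0}"
  have T: "finite ?T" "?T \<subseteq> lists S"
    using f by (auto simp: free_algebra_simps)
  then have \<beta>T: "\<beta> w \<in> carrier M" if "w \<in> ?T" for w
    using that by (blast intro: \<beta>)
  have "free_lift M \<beta> (c \<odot>\<^bsub>free_algebra S\<^esub> f) = (\<Oplus>\<^bsub>M\<^esub>w\<in>?T. (c * f w) \<odot>\<^bsub>M\<^esub> \<beta> w)"
    using T by (subst free_lift_superset[where T = ?T]) (auto simp: free_algebra_simps)
  also have "\<dots> = (\<Oplus>\<^bsub>M\<^esub>w\<in>?T. c \<odot>\<^bsub>M\<^esub> (f w \<odot>\<^bsub>M\<^esub> \<beta> w))"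
    using \<beta>T by (intro finsum_cong') (auto simp: smult_assoc)
  also have "\<dots> = c \<odot>\<^bsub>M\<^esub> free_lift M \<beta> f"
    unfolding free_lift_def using T(1) \<beta>T
    by (intro linear_map_finsum[OF M M, symmetric]) (auto intro!: linear_mapsI simp: smult_r_distr smult_assoc[symmetric] mult.commute)
  finally show "free_lift M \<beta> (c \<odot>\<^bsub>free_algebra S\<^esub> f) = c \<odot>\<^bsub>M\<^esub> free_lift M \<beta> f" .
next
  fix f g assume fg: "f \<in> carrier (free_algebra S)" "g \<in> carrier (free_algebra S)"
  let ?T = "{w. f w \<noteq> 0} \<union> {w. g w \<noteq> 0}"
  have T: "finite ?T" "?T \<subseteq> lists S"
    using fg by (auto simp: free_algebra_simps)
  then have \<beta>T: "\<beta> w \<in> carrier M" if "w \<in> ?T" for w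
    using that by (blast intro: \<beta>)
  have "free_lift M \<beta> (f \<oplus>\<^bsub>free_algebra S\<^esub> g) = (\<Oplus>\<^bsub>M\<^esub>w\<in>?T. (f w + g w) \<odot>\<^bsub>M\<^esub> \<beta> w)"
    using T by (subst free_lift_superset[where T = ?T]) (auto simp: free_algebra_simps)
  also have "\<dots> = (\<Oplus>\<^bsub>M\<^esub>w\<in>?T. f w \<odot>\<^bsub>M\<^esub> \<beta> w \<oplus>\<^bsub>M\<^esub> g w \<odot>\<^bsub>M\<^esub> \<beta> w)"
    using \<beta>T by (intro finsum_cong') (auto simp: smult_l_distr)
  also have "\<dots> = (\<Oplus>\<^bsub>M\<^esub>w\<in>?T. f w \<odot>\<^bsub>M\<^esub> \<beta> w) \<oplus>\<^bsub>M\<^esub> (\<Oplus>\<^bsub>M\<^esub>w\<in>?T. g w \<odot>\<^bsub>M\<^esub> \<beta> w)"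
    using \<beta>T by (intro finsum_addf) auto
  also have "\<dots> = free_lift M \<beta> f \<oplus>\<^bsub>M\<^esub> free_lift M \<beta> g"
    using T by (subst (1 2) free_lift_superset[where T = ?T]) auto
  finally show "free_lift M \<beta> (f \<oplus>\<^bsub>free_algebra S\<^esub> g) = free_lift M \<beta> f \<oplus>\<^bsub>M\<^esub> free_lift M \<beta> g" .
qed

lemma free_lift_word: "w \<in> lists S \<Longrightarrow> free_lift M \<beta> (free_word w) = \<beta> w"
  using \<beta>[of w] by (subst free_lift_superset[where T = "{w}"]) (auto simp: free_word_def)

end

lemma free_algebra_linear_maps_eqI:
  assumes M: "real_space M" and h: "h \<in> linear_maps (free_algebra S) M"
    and h': "h' \<in> linear_maps (free_algebra S) M"
    and eq: "\<And>w. w \<in> lists S \<Longrightarrow> h (free_word w) = h' (free_word w)"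
    and f: "f \<in> carrier (free_algebra S)"
  shows "h f = h' f"
proof -
  interpret F: real_algebra "free_algebra S" by (rule free_algebra_real_algebra)
  note 0 = linear_map_zero[OF F.real_space_axioms M]
  show ?thesis using f
    by (induction rule: free_algebra_induct)
      (simp_all add: 0[OF h] 0[OF h'] linear_mapsD[OF h] linear_mapsD[OF h'] eq free_word_closed)
qed

definition word_prod :: "('b, 'n) ring_scheme \<Rightarrow> ('a \<Rightarrow> 'b) \<Rightarrow> 'a list \<Rightarrow> 'b" where
  "word_prod A l w = foldr (\<lambda>u a. l u \<otimes>\<^bsub>A\<^esub> a) w \<one>\<^bsub>A\<^esub>"

lemma word_prod_simps [simp]:
  "word_prod A l [] = \<one>\<^bsub>A\<^esub>" "word_prod A l (u # w) = l u \<otimes>\<^bsub>A\<^esub> word_prod A l w"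
  by (simp_all add: word_prod_def)

lemma word_prod_closed:
  assumes "ring A" "\<And>u. u \<in> S \<Longrightarrow> l u \<in> carrier A" "w \<in> lists S"
  shows "word_prod A l w \<in> carrier A"
proof -
  interpret ring A by fact
  show ?thesis using assms(3) by induction (auto simp: assms(2))
qed

lemma word_prod_append:
  assumes "ring A" "\<And>u. u \<in> S \<Longrightarrow> l u \<in> carrier A" "v \<in> lists S" "w \<in> lists S"
  shows "word_prod A l (v @ w) = word_prod A l v \<otimes>\<^bsub>A\<^esub> word_prod A l w"
proof -
  interpret ring A by fact
  note [simp] = word_prod_closed[OF assms(1,2)] assms(2)
  show ?thesis using assms(3) by induction (use assms(4) in \<open>auto simp: m_assoc\<close>)
qed

text \<open>
  By bilinearity it suffices to compare products of words, where both sides concatenate.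
\<close>

lemma free_lift_algebra_hom:
  assumes A: "real_algebra A" and l: "\<And>u. u \<in> S \<Longrightarrow> l u \<in> carrier A"
  shows "free_lift A (word_prod A l) \<in> algebra_homs (free_algebra S) A"
    and "w \<in> lists S \<Longrightarrow> free_lift A (word_prod A l) (free_word w) = word_prod A l w"
proof -
  interpret A: real_algebra A by fact
  interpret F: real_algebra "free_algebra S" by (rule free_algebra_real_algebra)
  let ?h = "free_lift A (word_prod A l)"
  note closed = word_prod_closed[OF A.ring_axioms l]
  have lin: "?h \<in> linear_maps (free_algebra S) A"
    by (rule free_lift_linear[OF A.real_space_axioms closed])
  note hD [simp] = linear_mapsD[OF lin] linear_map_zero[OF F.real_space_axioms A.real_space_axioms lin]
  show word: "?h (free_word w) = word_prod A l w" if "w \<in> lists S" for w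
    using free_lift_word[OF A.real_space_axioms closed that] .
  show "?h \<in> algebra_homs (free_algebra S) A"
  proof (rule algebra_homI[OF lin])
    have words: "?h (free_word v \<otimes>\<^bsub>free_algebra S\<^esub> free_word w) = ?h (free_word v) \<otimes>\<^bsub>A\<^esub> ?h (free_word w)"
      if "v \<in> lists S" "w \<in> lists S" for v w
    proof -
      have "free_word v \<otimes>\<^bsub>free_algebra S\<^esub> free_word w = free_word (v @ w)"
        by (simp add: free_algebra_simps conv_free_word fun_eq_iff)
      then show ?thesis
        using word_prod_append[OF A.ring_axioms l that] that by (simp add: word)
    qed
    have left: "?h (f \<otimes>\<^bsub>free_algebra S\<^esub> free_word w) = ?h f \<otimes>\<^bsub>A\<^esub> ?h (free_word w)"
      if "f \<in> carrier (free_algebra S)" and w: "w \<in> lists S" for f w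
      using that(1)
      by (induction rule: free_algebra_induct)
        (simp_all add: w words free_word_closed F.l_distr A.l_distr F.smult_mult_left A.smult_mult_left)
    fix f g assume f: "f \<in> carrier (free_algebra S)" and "g \<in> carrier (free_algebra S)"
    from this(2) show "?h (f \<otimes>\<^bsub>free_algebra S\<^esub> g) = ?h f \<otimes>\<^bsub>A\<^esub> ?h g"
      by (induction rule: free_algebra_induct)
        (simp_all add: f left free_word_closed F.r_distr A.r_distr F.smult_mult_right A.smult_mult_right)
  next
    show "?h \<one>\<^bsub>free_algebra S\<^esub> = \<one>\<^bsub>A\<^esub>"
      using word[of "[]"] by (simp add: free_algebra_simps)
  qed
qed


section \<open>The exterior algebra\<close>

locale exterior = real_space U for U :: "(real, 'a, 'm) module_scheme" (structure)
begin

abbreviation "F \<equiv> free_algebra (carrier U)"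
abbreviation "I \<equiv> exterior_ideal U"
abbreviation "\<Lambda> \<equiv> exterior_algebra U"
abbreviation "\<iota> \<equiv> ext_incl U"

sublocale F: real_algebra F by (rule free_algebra_real_algebra)

lemma free_gen_closed: "u \<in> carrier U \<Longrightarrow> free_gen u \<in> carrier F"
  by (simp add: free_gen_eq_free_word free_word_closed)

lemma relations_closed: "exterior_relations U \<subseteq> carrier F"
  by (auto simp: exterior_relations_def Let_def free_gen_closed)

sublocale I: ideal I F
  unfolding exterior_ideal_def by (rule F.genideal_ideal[OF relations_closed])

sublocale Q: real_quotient F I
  by (intro real_quotient.intro real_quotient_axioms.intro F.real_space_axioms
    F.ideal_is_real_subspace[OF I.ideal_axioms])

lemma exterior_algebra_simps:
  "carrier \<Lambda> = Q.proj ` carrier F" "one \<Lambda> = Q.proj \<one>\<^bsub>F\<^esub>" "mult \<Lambda> = rcoset_mult F I"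
  "zero \<Lambda> = I"
  by (simp_all add: exterior_algebra_def quot_module_simps)

lemma proj_mult:
  "\<lbrakk>f \<in> carrier F; g \<in> carrier F\<rbrakk> \<Longrightarrow> Q.proj f \<otimes>\<^bsub>\<Lambda>\<^esub> Q.proj g = Q.proj (f \<otimes>\<^bsub>F\<^esub> g)"
  by (simp add: exterior_algebra_simps I.rcoset_mult_add)

lemma proj_add:
  "\<lbrakk>f \<in> carrier F; g \<in> carrier F\<rbrakk> \<Longrightarrow> Q.proj f \<oplus>\<^bsub>\<Lambda>\<^esub> Q.proj g = Q.proj (f \<oplus>\<^bsub>F\<^esub> g)"
  unfolding exterior_algebra_def by (rule Q.proj_add)

lemma proj_smult: "f \<in> carrier F \<Longrightarrow> c \<odot>\<^bsub>\<Lambda>\<^esub> Q.proj f = Q.proj (c \<odot>\<^bsub>F\<^esub> f)"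
  unfolding exterior_algebra_def by (rule Q.proj_smult)

lemma proj_closed: "f \<in> carrier F \<Longrightarrow> Q.proj f \<in> carrier \<Lambda>"
  by (simp add: exterior_algebra_simps)

lemma exterior_carrierE:
  assumes "a \<in> carrier \<Lambda>" obtains f where "f \<in> carrier F" "a = Q.proj f"
  using assms by (auto simp: exterior_algebra_simps)

lemma exterior_real_algebra: "real_algebra \<Lambda>"
proof (rule real_algebraI)
  show "real_space \<Lambda>"
    unfolding exterior_algebra_def by (rule Q.quotient_real_space)
  have one: "\<one>\<^bsub>\<Lambda>\<^esub> = Q.proj \<one>\<^bsub>F\<^esub>"
    by (simp add: exterior_algebra_simps)
  note simps = one proj_mult proj_add proj_smult proj_closed F.m_assoc F.l_distr F.r_distr
    F.smult_mult_left F.smult_mult_right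
  show "\<one>\<^bsub>\<Lambda>\<^esub> \<in> carrier \<Lambda>" by (simp add: simps)
  fix x y c assume "x \<in> carrier \<Lambda>" "y \<in> carrier \<Lambda>"
  then obtain f g where fg: "f \<in> carrier F" "x = Q.proj f" "g \<in> carrier F" "y = Q.proj g"
    by (metis exterior_carrierE)
  then show "x \<otimes>\<^bsub>\<Lambda>\<^esub> y \<in> carrier \<Lambda>" "\<one>\<^bsub>\<Lambda>\<^esub> \<otimes>\<^bsub>\<Lambda>\<^esub> x = x" "x \<otimes>\<^bsub>\<Lambda>\<^esub> \<one>\<^bsub>\<Lambda>\<^esub> = x"
    "(c \<odot>\<^bsub>\<Lambda>\<^esub> x) \<otimes>\<^bsub>\<Lambda>\<^esub> y = c \<odot>\<^bsub>\<Lambda>\<^esub> (x \<otimes>\<^bsub>\<Lambda>\<^esub> y)" "x \<otimes>\<^bsub>\<Lambda>\<^esub> (c \<odot>\<^bsub>\<Lambda>\<^esub> y) = c \<odot>\<^bsub>\<Lambda>\<^esub> (x \<otimes>\<^bsub>\<Lambda>\<^esub> y)"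
    by (simp_all add: simps)
  fix z assume "z \<in> carrier \<Lambda>"
  then obtain h where "h \<in> carrier F" "z = Q.proj h"
    by (metis exterior_carrierE)
  with fg show "x \<otimes>\<^bsub>\<Lambda>\<^esub> y \<otimes>\<^bsub>\<Lambda>\<^esub> z = x \<otimes>\<^bsub>\<Lambda>\<^esub> (y \<otimes>\<^bsub>\<Lambda>\<^esub> z)"
    "(x \<oplus>\<^bsub>\<Lambda>\<^esub> y) \<otimes>\<^bsub>\<Lambda>\<^esub> z = x \<otimes>\<^bsub>\<Lambda>\<^esub> z \<oplus>\<^bsub>\<Lambda>\<^esub> y \<otimes>\<^bsub>\<Lambda>\<^esub> z"
    "z \<otimes>\<^bsub>\<Lambda>\<^esub> (x \<oplus>\<^bsub>\<Lambda>\<^esub> y) = z \<otimes>\<^bsub>\<Lambda>\<^esub> x \<oplus>\<^bsub>\<Lambda>\<^esub> z \<otimes>\<^bsub>\<Lambda>\<^esub> y"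
    by (simp_all add: simps)
qed

sublocale \<Lambda>: real_algebra \<Lambda> by (rule exterior_real_algebra)

lemma incl_closed [simp, intro]: "u \<in> carrier U \<Longrightarrow> \<iota> u \<in> carrier \<Lambda>"
  by (simp add: ext_incl_def proj_closed free_gen_closed)

lemma relation_in_ideal: "r \<in> exterior_relations U \<Longrightarrow> r \<in> I"
  unfolding exterior_ideal_def using F.genideal_self[OF relations_closed] by blast

lemma proj_eq_of_minus:
  assumes "f \<in> carrier F" "g \<in> carrier F" "f \<ominus>\<^bsub>F\<^esub> g \<in> I" shows "Q.proj f = Q.proj g"
proof -
  have "f = (f \<ominus>\<^bsub>F\<^esub> g) \<oplus>\<^bsub>F\<^esub> g"
    using assms by (simp add: a_minus_def F.a_assoc F.l_neg)
  then show ?thesis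
    using Q.proj_eqI[OF assms(3,2)] by simp
qed

lemma incl_linear: "\<iota> \<in> linear_maps U \<Lambda>"
proof (rule linear_mapsI)
  fix u v c assume uv: "u \<in> carrier U" "v \<in> carrier U"
  have "free_gen (u \<oplus> v) \<ominus>\<^bsub>F\<^esub> (free_gen u \<oplus>\<^bsub>F\<^esub> free_gen v) \<in> I"
    by (rule relation_in_ideal) (use uv in \<open>auto simp: exterior_relations_def Let_def\<close>)
  then show "\<iota> (u \<oplus> v) = \<iota> u \<oplus>\<^bsub>\<Lambda>\<^esub> \<iota> v"
    using uv by (simp add: ext_incl_def proj_add free_gen_closed proj_eq_of_minus)
next
  fix u c assume u: "u \<in> carrier U"
  have "free_gen (c \<odot> u) \<ominus>\<^bsub>F\<^esub> (c \<odot>\<^bsub>F\<^esub> free_gen u) \<in> I"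
    by (rule relation_in_ideal) (use u in \<open>auto simp: exterior_relations_def Let_def\<close>)
  then show "\<iota> (c \<odot> u) = c \<odot>\<^bsub>\<Lambda>\<^esub> \<iota> u"
    using u by (simp add: ext_incl_def proj_smult free_gen_closed proj_eq_of_minus)
qed simp

lemmas incl_add = linear_mapsD(2)[OF incl_linear]
lemmas incl_smult = linear_mapsD(3)[OF incl_linear]

lemma incl_square: assumes "u \<in> carrier U" shows "\<iota> u \<otimes>\<^bsub>\<Lambda>\<^esub> \<iota> u = \<zero>\<^bsub>\<Lambda>\<^esub>"
proof -
  have "free_gen u \<otimes>\<^bsub>F\<^esub> free_gen u \<in> I"
    by (rule relation_in_ideal) (use assms in \<open>auto simp: exterior_relations_def Let_def\<close>)
  then show ?thesis
    using assms free_gen_closed[OF assms] Q.proj_eq_zero_iff[of "free_gen u \<otimes>\<^bsub>F\<^esub> free_gen u"]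
    by (simp add: ext_incl_def proj_mult exterior_algebra_simps(4))
qed

text \<open>
  Polarization of the relation that squares of vectors vanish.
\<close>

lemma incl_anticommute:
  assumes u: "u \<in> carrier U" and v: "v \<in> carrier U"
  shows "\<iota> u \<otimes>\<^bsub>\<Lambda>\<^esub> \<iota> v = (-1) \<odot>\<^bsub>\<Lambda>\<^esub> (\<iota> v \<otimes>\<^bsub>\<Lambda>\<^esub> \<iota> u)"
proof -
  have "\<zero>\<^bsub>\<Lambda>\<^esub> = (\<iota> u \<oplus>\<^bsub>\<Lambda>\<^esub> \<iota> v) \<otimes>\<^bsub>\<Lambda>\<^esub> (\<iota> u \<oplus>\<^bsub>\<Lambda>\<^esub> \<iota> v)"
    using incl_square[of "u \<oplus> v"] u v by (simp add: incl_add)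
  also have "\<dots> = \<iota> u \<otimes>\<^bsub>\<Lambda>\<^esub> \<iota> v \<oplus>\<^bsub>\<Lambda>\<^esub> \<iota> v \<otimes>\<^bsub>\<Lambda>\<^esub> \<iota> u"
    using u v by (simp add: \<Lambda>.l_distr \<Lambda>.r_distr incl_square \<Lambda>.a_comm)
  finally show ?thesis
    using u v by (simp add: \<Lambda>.minus_eq_smult[symmetric] \<Lambda>.minus_equality)
qed

lemma ext_wedge_eq_word_prod: "ext_wedge U w = word_prod \<Lambda> \<iota> w"
  by (simp add: ext_wedge_def word_prod_def)

lemma ext_wedge_Nil [simp]: "ext_wedge U [] = \<one>\<^bsub>\<Lambda>\<^esub>"
  by (simp add: ext_wedge_def)

lemma ext_wedge_Cons [simp]: "ext_wedge U (u # w) = \<iota> u \<otimes>\<^bsub>\<Lambda>\<^esub> ext_wedge U w"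
  by (simp add: ext_wedge_def)

lemma ext_wedge_closed [simp, intro]: "w \<in> lists (carrier U) \<Longrightarrow> ext_wedge U w \<in> carrier \<Lambda>"
  unfolding ext_wedge_eq_word_prod by (rule word_prod_closed[OF \<Lambda>.ring_axioms]) auto

lemma proj_free_word: "w \<in> lists (carrier U) \<Longrightarrow> Q.proj (free_word w) = ext_wedge U w"
proof (induction w)
  case Nil
  then show ?case by (simp add: exterior_algebra_simps free_algebra_simps)
next
  case (Cons u w)
  have "free_word (u # w) = free_gen u \<otimes>\<^bsub>F\<^esub> free_word w"
    by (simp add: free_gen_eq_free_word free_algebra_simps conv_free_word fun_eq_iff)
  then show ?case
    using Cons by (simp add: ext_incl_def free_gen_closed free_word_closed flip: proj_mult)
qed

text \<open>
  The exterior algebra is spanned by wedges of vectors, and these are built from the unit by left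
  multiplication with vectors.
\<close>

lemma exterior_induct [consumes 1, case_names one mult add smult]:
  assumes "a \<in> carrier \<Lambda>"
    and one: "P \<one>\<^bsub>\<Lambda>\<^esub>"
    and mult: "\<And>u a. \<lbrakk>u \<in> carrier U; a \<in> carrier \<Lambda>; P a\<rbrakk> \<Longrightarrow> P (\<iota> u \<otimes>\<^bsub>\<Lambda>\<^esub> a)"
    and add: "\<And>a b. \<lbrakk>a \<in> carrier \<Lambda>; b \<in> carrier \<Lambda>; P a; P b\<rbrakk> \<Longrightarrow> P (a \<oplus>\<^bsub>\<Lambda>\<^esub> b)"
    and smult: "\<And>c a. \<lbrakk>a \<in> carrier \<Lambda>; P a\<rbrakk> \<Longrightarrow> P (c \<odot>\<^bsub>\<Lambda>\<^esub> a)"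
  shows "P a"
proof -
  have wedge: "P (ext_wedge U w)" if "w \<in> lists (carrier U)" for w
    using that by induction (auto intro: one mult)
  have "P (Q.proj f)" if "f \<in> carrier F" for f
    using that
  proof (induction rule: free_algebra_induct)
    case zero
    have "P (0 \<odot>\<^bsub>\<Lambda>\<^esub> \<one>\<^bsub>\<Lambda>\<^esub>)"
      by (intro smult one) simp
    then show ?case
      using Q.proj_eq_zero_iff[of "\<zero>\<^bsub>F\<^esub>"] by (simp add: exterior_algebra_simps(4))
  next
    case (add f g)
    then show ?case
      using assms(4)[of "Q.proj f" "Q.proj g"] by (simp add: proj_add proj_closed)
  next
    case (smult_word c w)
    then show ?case
      using smult[OF _ wedge[of w]] by (simp add: proj_smult free_word_closed proj_free_word flip: proj_smult)
  qed
  then show ?thesis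
    using assms(1) by (metis exterior_carrierE)
qed

lemma exterior_linear_maps_eqI:
  assumes M: "real_space M" and h: "h \<in> linear_maps \<Lambda> M" and h': "h' \<in> linear_maps \<Lambda> M"
    and eq: "\<And>w. w \<in> lists (carrier U) \<Longrightarrow> h (ext_wedge U w) = h' (ext_wedge U w)"
    and a: "a \<in> carrier \<Lambda>"
  shows "h a = h' a"
proof -
  have "(\<lambda>f. k (Q.proj f)) \<in> linear_maps F M" if "k \<in> linear_maps \<Lambda> M" for k
    by (rule linear_mapsI)
      (simp_all add: linear_mapsD[OF that] proj_closed flip: proj_add proj_smult)
  note lin = this[OF h] this[OF h']
  obtain f where "f \<in> carrier F" "a = Q.proj f"
    using a by (rule exterior_carrierE)
  then show ?thesis
    using free_algebra_linear_maps_eqI[OF M lin] eq by (simp add: proj_free_word)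
qed


end


subsection \<open>The universal property\<close>

text \<open>
  A linear map to an algebra whose values have square zero extends to the exterior algebra. All
  homomorphisms below arise in this way: functoriality, the grading involution, the differential and
  the comparison with operators on functions of vertex sets.
\<close>

definition ext_lift ::
  "(real, 'b, 'n) module_scheme \<Rightarrow> ('a \<Rightarrow> 'b) \<Rightarrow> ('a list \<Rightarrow> real) set \<Rightarrow> 'b" where
  "ext_lift A l X = the_elem (free_lift A (word_prod A l) ` X)"

context exterior
begin

context
  fixes A :: "(real, 'b, 'n) module_scheme" and l :: "'a \<Rightarrow> 'b"
  assumes A: "real_algebra A" and l: "l \<in> linear_maps U A"
    and square: "\<And>u. u \<in> carrier U \<Longrightarrow> l u \<otimes>\<^bsub>A\<^esub> l u = \<zero>\<^bsub>A\<^esub>"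
begin

interpretation A: real_algebra A by (rule A)

private abbreviation (input) "h \<equiv> free_lift A (word_prod A l)"

private lemma hom: "h \<in> algebra_homs F A"
  by (rule free_lift_algebra_hom(1)[OF A linear_mapsD(1)[OF l]])

private lemma word: "w \<in> lists (carrier U) \<Longrightarrow> h (free_word w) = word_prod A l w"
  by (rule free_lift_algebra_hom(2)[OF A linear_mapsD(1)[OF l]])

text \<open>
  The kernel is an ideal, so it is enough that it contains the defining relations.
\<close>

private lemma kills_ideal:
  assumes "f \<in> I" shows "h f = \<zero>\<^bsub>A\<^esub>"
proof -
  note hD = algebra_homD[OF hom]
  have lin: "h \<in> linear_maps F A"
    using hom by blast
  have gen: "h (free_gen u) = l u" if "u \<in> carrier U" for u
    using that word[of "[u]"] linear_mapsD(1)[OF l] by (simp add: free_gen_eq_free_word)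
  have minus: "h (f \<ominus>\<^bsub>F\<^esub> g) = \<zero>\<^bsub>A\<^esub>" if "f \<in> carrier F" "g \<in> carrier F" "h f = h g" for f g
    using that linear_map_minus[OF F.real_space_axioms A.real_space_axioms lin] hD(1)
    by (simp add: a_minus_def hD(2) A.r_neg)
  have "exterior_relations U \<subseteq> {f \<in> carrier F. h f = \<zero>\<^bsub>A\<^esub>}"
    unfolding exterior_relations_def Let_def
    by (auto simp: free_gen_closed gen hD(2,3,4) linear_mapsD(2,3)[OF l] square intro!: minus)
  then have "I \<subseteq> {f \<in> carrier F. h f = \<zero>\<^bsub>A\<^esub>}"
    unfolding exterior_ideal_def
    using algebra_hom_kernel_ideal[OF F.real_algebra_axioms A hom] by (intro F.genideal_minimal)
  then show ?thesis
    using assms by blast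
qed

lemma ext_lift_proj: "f \<in> carrier F \<Longrightarrow> ext_lift A l (Q.proj f) = free_lift A (word_prod A l) f"
  unfolding ext_lift_def using hom
  by (intro Q.quotient_linear_map(2)[OF A.real_space_axioms _ kills_ideal]) auto

lemma ext_lift_wedge: "w \<in> lists (carrier U) \<Longrightarrow> ext_lift A l (ext_wedge U w) = word_prod A l w"
  using ext_lift_proj[OF free_word_closed] word by (simp add: proj_free_word)

lemma ext_lift_incl: "u \<in> carrier U \<Longrightarrow> ext_lift A l (\<iota> u) = l u"
  using ext_lift_wedge[of "[u]"] linear_mapsD(1)[OF l] by simp

lemma ext_lift_hom: "ext_lift A l \<in> algebra_homs \<Lambda> A"
proof (rule algebra_homI)
  note hD = algebra_homD[OF hom]
  show "ext_lift A l \<in> linear_maps \<Lambda> A"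
    unfolding exterior_algebra_def ext_lift_def using hom
    by (intro Q.quotient_linear_map(1)[OF A.real_space_axioms _ kills_ideal]) auto
  show "ext_lift A l \<one>\<^bsub>\<Lambda>\<^esub> = \<one>\<^bsub>A\<^esub>"
    using ext_lift_wedge[of "[]"] by simp
  fix a b assume "a \<in> carrier \<Lambda>" "b \<in> carrier \<Lambda>"
  then show "ext_lift A l (a \<otimes>\<^bsub>\<Lambda>\<^esub> b) = ext_lift A l a \<otimes>\<^bsub>A\<^esub> ext_lift A l b"
    by (elim exterior_carrierE) (simp add: proj_mult ext_lift_proj hD(4))
qed

end

text \<open>
  Vectors generate the exterior algebra.
\<close>

lemma algebra_homs_eqI:
  assumes "real_algebra A" "h \<in> algebra_homs \<Lambda> A" "h' \<in> algebra_homs \<Lambda> A"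
    and eq: "\<And>u. u \<in> carrier U \<Longrightarrow> h (\<iota> u) = h' (\<iota> u)" and "a \<in> carrier \<Lambda>"
  shows "h a = h' a"
proof (rule exterior_linear_maps_eqI[of A h h'])
  show "real_space A"
    using assms(1) by (simp add: real_algebra_def)
  show "h (ext_wedge U w) = h' (ext_wedge U w)" if "w \<in> lists (carrier U)" for w
    using that by induction (auto simp: algebra_homD[OF assms(2)] algebra_homD[OF assms(3)] eq)
qed (use assms in auto)

end

lemma ext_map_properties:
  fixes U :: "(real, 'a, 'm) module_scheme" and U' :: "(real, 'b, 'n) module_scheme"
  assumes U: "real_space U" and U': "real_space U'" and T: "T \<in> linear_maps U U'"
  shows "ext_map U U' T \<in> algebra_homs (exterior_algebra U) (exterior_algebra U')"
    and "u \<in> carrier U \<Longrightarrow> ext_map U U' T (ext_incl U u) = ext_incl U' (T u)"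
    and "w \<in> lists (carrier U) \<Longrightarrow> ext_map U U' T (ext_wedge U w) = ext_wedge U' (map T w)"
proof -
  interpret U: exterior U using U by (rule exterior.intro)
  interpret U': exterior U' using U' by (rule exterior.intro)
  let ?l = "\<lambda>u. ext_incl U' (T u)"
  let ?L = "exterior_algebra U" and ?L' = "exterior_algebra U'"
  have l: "?l \<in> linear_maps U ?L'"
    by (rule linear_mapsI) (simp_all add: linear_mapsD[OF T] U'.incl_add U'.incl_smult)
  have sq: "?l u \<otimes>\<^bsub>?L'\<^esub> ?l u = \<zero>\<^bsub>?L'\<^esub>" if "u \<in> carrier U" for u
    by (rule U'.incl_square[OF linear_mapsD(1)[OF T that]])
  note lift = U.ext_lift_hom[OF U'.exterior_real_algebra l sq]
    U.ext_lift_incl[OF U'.exterior_real_algebra l sq]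
  let ?P = "\<lambda>H. H \<in> extensional (carrier ?L) \<and> H \<in> linear_maps ?L ?L' \<and>
     H \<in> Ring.ring_hom ?L ?L' \<and> (\<forall>u\<in>carrier U. H (ext_incl U u) = ext_incl U' (T u))"
  let ?H = "restrict (ext_lift ?L' ?l) (carrier ?L)"
  have hom: "?H \<in> algebra_homs ?L ?L'"
    by (rule algebra_homI[OF linear_mapsI]) (simp_all add: algebra_homD[OF lift(1)])
  have "?P (ext_map U U' T)"
    unfolding ext_map_def
  proof (rule theI[of ?P ?H])
    show "?P ?H"
      using hom by (auto simp: lift(2))
    show "H = ?H" if "?P H" for H
    proof (rule extensionalityI[of _ "carrier ?L"])
      show "H a = ?H a" if "a \<in> carrier ?L" for a
        by (rule U.algebra_homs_eqI[OF U'.exterior_real_algebra _ hom _ that])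
          (use \<open>?P H\<close> in \<open>auto simp: lift(2)\<close>)
    qed (use that in auto)
  qed
  then show hom: "ext_map U U' T \<in> algebra_homs ?L ?L'"
    and incl: "\<And>u. u \<in> carrier U \<Longrightarrow> ext_map U U' T (ext_incl U u) = ext_incl U' (T u)"
    by auto
  show "ext_map U U' T (ext_wedge U w) = ext_wedge U' (map T w)" if "w \<in> lists (carrier U)"
    using that by induction (auto simp: algebra_homD[OF hom] incl)
qed


subsection \<open>Degrees\<close>

context exterior
begin

abbreviation "forms k \<equiv> carrier (ext_power U k)"

lemma ext_power_simps:
  "forms k = real_span \<Lambda> {ext_wedge U w | w. w \<in> lists (carrier U) \<and> length w = k}"
  "zero (ext_power U k) = zero \<Lambda>" "add (ext_power U k) = add \<Lambda>"
  "smult (ext_power U k) = smult \<Lambda>"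
  by (simp_all add: ext_power_def)

lemma wedges_closed: "{ext_wedge U w | w. w \<in> lists (carrier U) \<and> length w = k} \<subseteq> carrier \<Lambda>"
  by auto

lemma power_subspace: "real_subspace (forms k) \<Lambda>"
  unfolding ext_power_simps by (rule \<Lambda>.span_is_real_subspace[OF wedges_closed])

lemmas power_subspaceD = real_subspaceD[OF \<Lambda>.real_space_axioms power_subspace]

lemma wedge_in_power:
  assumes "w \<in> lists (carrier U)" "length w = k" shows "ext_wedge U w \<in> forms k"
  unfolding ext_power_simps by (rule \<Lambda>.span_superset[OF wedges_closed]) (use assms in auto)

lemma power_induct [consumes 1, case_names wedge zero add smult]:
  assumes "a \<in> forms k"
    and "\<And>w. \<lbrakk>w \<in> lists (carrier U); length w = k\<rbrakk> \<Longrightarrow> P (ext_wedge U w)" and "P \<zero>\<^bsub>\<Lambda>\<^esub>"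
    and "\<And>a b. \<lbrakk>a \<in> forms k; b \<in> forms k; P a; P b\<rbrakk> \<Longrightarrow> P (a \<oplus>\<^bsub>\<Lambda>\<^esub> b)"
    and "\<And>c a. \<lbrakk>a \<in> forms k; P a\<rbrakk> \<Longrightarrow> P (c \<odot>\<^bsub>\<Lambda>\<^esub> a)"
  shows "P a"
proof -
  have "a \<in> forms k \<and> P a"
    using assms(1) unfolding ext_power_simps(1)
    by (rule \<Lambda>.span_induct[OF _ wedges_closed])
      (use assms(2-5) in \<open>auto simp flip: ext_power_simps(1) intro: wedge_in_power power_subspaceD\<close>)
  then show ?thesis by blast
qed

lemma ext_power_real_space: "real_space (ext_power U k)"
  using real_subspace_is_real_space[OF \<Lambda>.real_space_axioms power_subspace]
  unfolding ext_power_def by simp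

lemma one_in_power: "\<one>\<^bsub>\<Lambda>\<^esub> \<in> forms 0"
  using wedge_in_power[of "[]"] by simp

lemma incl_in_power: "u \<in> carrier U \<Longrightarrow> \<iota> u \<in> forms (Suc 0)"
  using wedge_in_power[of "[u]"] by simp

lemma incl_mult_in_power:
  assumes u: "u \<in> carrier U" and a: "a \<in> forms k"
  shows "\<iota> u \<otimes>\<^bsub>\<Lambda>\<^esub> a \<in> forms (Suc k)"
  using a
proof (induction rule: power_induct)
  case (wedge w)
  then show ?case
    using wedge_in_power[of "u # w"] u by simp
qed (use u in \<open>auto simp: \<Lambda>.r_distr \<Lambda>.smult_mult_right power_subspaceD(1) intro: power_subspaceD(2-4)\<close>)

lemma incl_incl_in_power: "\<lbrakk>u \<in> carrier U; v \<in> carrier U\<rbrakk> \<Longrightarrow> \<iota> u \<otimes>\<^bsub>\<Lambda>\<^esub> \<iota> v \<in> forms 2"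
  using incl_mult_in_power[OF _ incl_in_power] by (simp add: numeral_2_eq_2)

lemma power_two_induct [consumes 1, case_names wedge zero add smult]:
  assumes "a \<in> forms 2"
    and wedge: "\<And>u v. \<lbrakk>u \<in> carrier U; v \<in> carrier U\<rbrakk> \<Longrightarrow> P (\<iota> u \<otimes>\<^bsub>\<Lambda>\<^esub> \<iota> v)" and "P \<zero>\<^bsub>\<Lambda>\<^esub>"
    and "\<And>a b. \<lbrakk>a \<in> forms 2; b \<in> forms 2; P a; P b\<rbrakk> \<Longrightarrow> P (a \<oplus>\<^bsub>\<Lambda>\<^esub> b)"
    and "\<And>c a. \<lbrakk>a \<in> forms 2; P a\<rbrakk> \<Longrightarrow> P (c \<odot>\<^bsub>\<Lambda>\<^esub> a)"
  shows "P a"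
  using assms(1)
proof (induction rule: power_induct)
  case (wedge w)
  then obtain u v where "w = [u, v]" "u \<in> carrier U" "v \<in> carrier U"
    by (auto simp: numeral_2_eq_2 length_Suc_conv)
  then show ?case
    using assms(2) by simp
qed (use assms in auto)

text \<open>
  Moving a vector past the two factors of a wedge changes the sign twice.
\<close>

lemma power_two_commute:
  assumes a: "a \<in> forms 2" and u: "u \<in> carrier U"
  shows "a \<otimes>\<^bsub>\<Lambda>\<^esub> \<iota> u = \<iota> u \<otimes>\<^bsub>\<Lambda>\<^esub> a"
  using a
proof (induction rule: power_two_induct)
  case (wedge v w)
  have "(\<iota> v \<otimes>\<^bsub>\<Lambda>\<^esub> \<iota> w) \<otimes>\<^bsub>\<Lambda>\<^esub> \<iota> u = \<iota> v \<otimes>\<^bsub>\<Lambda>\<^esub> ((-1) \<odot>\<^bsub>\<Lambda>\<^esub> (\<iota> u \<otimes>\<^bsub>\<Lambda>\<^esub> \<iota> w))"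
    using wedge u incl_anticommute[of w u] by (simp add: \<Lambda>.m_assoc)
  also have "\<dots> = (-1) \<odot>\<^bsub>\<Lambda>\<^esub> ((\<iota> v \<otimes>\<^bsub>\<Lambda>\<^esub> \<iota> u) \<otimes>\<^bsub>\<Lambda>\<^esub> \<iota> w)"
    using wedge u by (simp add: \<Lambda>.m_assoc \<Lambda>.smult_mult_right)
  also have "\<dots> = \<iota> u \<otimes>\<^bsub>\<Lambda>\<^esub> (\<iota> v \<otimes>\<^bsub>\<Lambda>\<^esub> \<iota> w)"
    using wedge u incl_anticommute[of v u]
    by (simp add: \<Lambda>.m_assoc \<Lambda>.smult_mult_left \<Lambda>.smult_assoc[symmetric])
  finally show ?case .
qed (use u in \<open>auto simp: \<Lambda>.l_distr \<Lambda>.r_distr \<Lambda>.smult_mult_left \<Lambda>.smult_mult_right power_subspaceD(1)\<close>)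


subsection \<open>Reordering of wedge products\<close>

lemma ext_wedge_move_front:
  assumes "xs \<in> lists (carrier U)" "x \<in> carrier U" "ys \<in> lists (carrier U)"
  shows "ext_wedge U (xs @ x # ys) = (-1) ^ length xs \<odot>\<^bsub>\<Lambda>\<^esub> ext_wedge U (x # xs @ ys)"
  using assms(1)
proof (induction xs)
  case (Cons y xs)
  let ?r = "ext_wedge U (xs @ ys)" and ?c = "(-1) ^ length xs"
  have y: "y \<in> carrier U" and r: "?r \<in> carrier \<Lambda>"
    using Cons assms by auto
  have "ext_wedge U ((y # xs) @ x # ys) = \<iota> y \<otimes>\<^bsub>\<Lambda>\<^esub> (?c \<odot>\<^bsub>\<Lambda>\<^esub> (\<iota> x \<otimes>\<^bsub>\<Lambda>\<^esub> ?r))"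
    using Cons by simp
  also have "\<dots> = ?c \<odot>\<^bsub>\<Lambda>\<^esub> ((\<iota> y \<otimes>\<^bsub>\<Lambda>\<^esub> \<iota> x) \<otimes>\<^bsub>\<Lambda>\<^esub> ?r)"
    using y r assms(2) by (simp add: \<Lambda>.smult_mult_right \<Lambda>.m_assoc)
  also have "\<iota> y \<otimes>\<^bsub>\<Lambda>\<^esub> \<iota> x = (-1) \<odot>\<^bsub>\<Lambda>\<^esub> (\<iota> x \<otimes>\<^bsub>\<Lambda>\<^esub> \<iota> y)"
    by (rule incl_anticommute[OF y assms(2)])
  also have "?c \<odot>\<^bsub>\<Lambda>\<^esub> (((-1) \<odot>\<^bsub>\<Lambda>\<^esub> (\<iota> x \<otimes>\<^bsub>\<Lambda>\<^esub> \<iota> y)) \<otimes>\<^bsub>\<Lambda>\<^esub> ?r) =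
      (-1) ^ length (y # xs) \<odot>\<^bsub>\<Lambda>\<^esub> (\<iota> x \<otimes>\<^bsub>\<Lambda>\<^esub> (\<iota> y \<otimes>\<^bsub>\<Lambda>\<^esub> ?r))"
    using y r assms(2) by (simp add: \<Lambda>.smult_mult_left \<Lambda>.m_assoc flip: \<Lambda>.smult_assoc)
  finally show ?case
    by simp
qed (use assms in simp)

text \<open>
  The scalar is the sign of a permutation that takes one word to the other.
\<close>

lemma ext_wedge_permute:
  assumes "mset w = mset w'" "w \<in> lists (carrier U)"
  shows "\<exists>c. ext_wedge U w = c \<odot>\<^bsub>\<Lambda>\<^esub> ext_wedge U w'"
  using assms
proof (induction w arbitrary: w')
  case Nil
  then show ?case
    by (intro exI[of _ 1]) simp
next
  case (Cons x w)
  then have "x \<in> set w'"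
    by (metis list.set_intros(1) set_mset_mset)
  then obtain xs ys where w': "w' = xs @ x # ys"
    by (meson split_list)
  then have "mset w = mset (xs @ ys)"
    using Cons.prems(1) by simp
  moreover have w: "w \<in> lists (carrier U)" "x \<in> carrier U"
    using Cons.prems by auto
  ultimately obtain c where c: "ext_wedge U w = c \<odot>\<^bsub>\<Lambda>\<^esub> ext_wedge U (xs @ ys)"
    using Cons.IH by blast
  have "set w' = set (x # w)"
    using Cons.prems(1) by (metis mset_eq_setD)
  then have xy: "xs \<in> lists (carrier U)" "ys \<in> lists (carrier U)"
    using Cons.prems(2) unfolding w' by (auto simp: in_lists_conv_set)
  have "ext_wedge U (x # w) = c \<odot>\<^bsub>\<Lambda>\<^esub> ext_wedge U (x # xs @ ys)"
    using c w xy by (simp add: \<Lambda>.smult_mult_right)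
  also have "\<dots> = (c * (-1) ^ length xs) \<odot>\<^bsub>\<Lambda>\<^esub> ext_wedge U w'"
    using xy w ext_wedge_closed[of "x # xs @ ys"]
    unfolding w' ext_wedge_move_front[OF xy(1) w(2) xy(2)]
    by (simp add: mult.assoc flip: \<Lambda>.smult_assoc power_add)
  finally show ?case ..
qed

end


subsection \<open>Parity and odd derivations\<close>

text \<open>
  The grading involution, which is \<open>(-1)^k\<close> in degree \<open>k\<close>. As an algebra homomorphism it
  encodes the sign of the Leibniz rule on inhomogeneous elements.
\<close>

definition parity :: "(real, 'a, 'm) module_scheme \<Rightarrow> ('a list \<Rightarrow> real) set \<Rightarrow> ('a list \<Rightarrow> real) set" where
  "parity U = ext_lift (exterior_algebra U) (\<lambda>u. (-1) \<odot>\<^bsub>exterior_algebra U\<^esub> ext_incl U u)"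

context exterior
begin

lemma parity_hom: "parity U \<in> algebra_homs \<Lambda> \<Lambda>"
  and parity_wedge:
    "w \<in> lists (carrier U) \<Longrightarrow> parity U (ext_wedge U w) = (-1) ^ length w \<odot>\<^bsub>\<Lambda>\<^esub> ext_wedge U w"
proof -
  let ?l = "\<lambda>u. (-1) \<odot>\<^bsub>\<Lambda>\<^esub> \<iota> u"
  have l: "?l \<in> linear_maps U \<Lambda>"
    by (rule linear_mapsI)
      (simp_all add: incl_add incl_smult \<Lambda>.smult_r_distr flip: \<Lambda>.smult_assoc)
  have sq: "?l u \<otimes>\<^bsub>\<Lambda>\<^esub> ?l u = \<zero>\<^bsub>\<Lambda>\<^esub>" if "u \<in> carrier U" for u
    using that by (simp add: \<Lambda>.smult_mult_left \<Lambda>.smult_mult_right incl_square)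
  show "parity U \<in> algebra_homs \<Lambda> \<Lambda>"
    unfolding parity_def by (rule ext_lift_hom[OF exterior_real_algebra l sq])
  assume "w \<in> lists (carrier U)"
  then have "parity U (ext_wedge U w) = word_prod \<Lambda> ?l w"
    unfolding parity_def by (intro ext_lift_wedge[OF exterior_real_algebra l sq])
  also have "\<dots> = (-1) ^ length w \<odot>\<^bsub>\<Lambda>\<^esub> ext_wedge U w"
    using \<open>w \<in> lists (carrier U)\<close>
    by induction (auto simp: \<Lambda>.smult_mult_left \<Lambda>.smult_mult_right simp flip: \<Lambda>.smult_assoc)
  finally show "parity U (ext_wedge U w) = (-1) ^ length w \<odot>\<^bsub>\<Lambda>\<^esub> ext_wedge U w" .
qed

lemma parity_power: "a \<in> forms k \<Longrightarrow> parity U a = (-1) ^ k \<odot>\<^bsub>\<Lambda>\<^esub> a"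
proof (induction rule: power_induct)
  case zero
  then show ?case
    using linear_map_zero[OF \<Lambda>.real_space_axioms \<Lambda>.real_space_axioms] parity_hom by auto
qed (auto simp: parity_wedge algebra_homD[OF parity_hom] power_subspaceD(1) \<Lambda>.smult_r_distr
    \<Lambda>.smult_assoc[symmetric] mult.commute)


definition odd_derivation :: "(('a list \<Rightarrow> real) set \<Rightarrow> ('a list \<Rightarrow> real) set) \<Rightarrow> bool" where
  "odd_derivation d \<longleftrightarrow> d \<in> linear_maps \<Lambda> \<Lambda> \<and>
     (\<forall>k. \<forall>a\<in>forms k. \<forall>b\<in>carrier \<Lambda>.
        d (a \<otimes>\<^bsub>\<Lambda>\<^esub> b) = d a \<otimes>\<^bsub>\<Lambda>\<^esub> b \<oplus>\<^bsub>\<Lambda>\<^esub> (-1) ^ k \<odot>\<^bsub>\<Lambda>\<^esub> (a \<otimes>\<^bsub>\<Lambda>\<^esub> d b))"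

lemma odd_derivation_linear: "odd_derivation d \<Longrightarrow> d \<in> linear_maps \<Lambda> \<Lambda>"
  by (simp add: odd_derivation_def)

lemma odd_derivation_one:
  assumes "odd_derivation d" shows "d \<one>\<^bsub>\<Lambda>\<^esub> = \<zero>\<^bsub>\<Lambda>\<^esub>"
proof -
  have 1: "d \<one>\<^bsub>\<Lambda>\<^esub> \<in> carrier \<Lambda>"
    using linear_mapsD(1)[OF odd_derivation_linear[OF assms]] by simp
  have "d (\<one>\<^bsub>\<Lambda>\<^esub> \<otimes>\<^bsub>\<Lambda>\<^esub> \<one>\<^bsub>\<Lambda>\<^esub>) = d \<one>\<^bsub>\<Lambda>\<^esub> \<otimes>\<^bsub>\<Lambda>\<^esub> \<one>\<^bsub>\<Lambda>\<^esub> \<oplus>\<^bsub>\<Lambda>\<^esub> (-1) ^ 0 \<odot>\<^bsub>\<Lambda>\<^esub> (\<one>\<^bsub>\<Lambda>\<^esub> \<otimes>\<^bsub>\<Lambda>\<^esub> d \<one>\<^bsub>\<Lambda>\<^esub>)"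
    using assms one_in_power unfolding odd_derivation_def by blast
  then have "d \<one>\<^bsub>\<Lambda>\<^esub> \<oplus>\<^bsub>\<Lambda>\<^esub> d \<one>\<^bsub>\<Lambda>\<^esub> = d \<one>\<^bsub>\<Lambda>\<^esub>"
    using 1 by simp
  then show ?thesis
    using 1 by simp
qed

lemma odd_derivation_incl_mult:
  assumes "odd_derivation d" "u \<in> carrier U" "a \<in> carrier \<Lambda>"
  shows "d (\<iota> u \<otimes>\<^bsub>\<Lambda>\<^esub> a) = d (\<iota> u) \<otimes>\<^bsub>\<Lambda>\<^esub> a \<oplus>\<^bsub>\<Lambda>\<^esub> (-1) \<odot>\<^bsub>\<Lambda>\<^esub> (\<iota> u \<otimes>\<^bsub>\<Lambda>\<^esub> d a)"
  using assms incl_in_power[of u] unfolding odd_derivation_def by force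

text \<open>
  By the Leibniz rule a derivation vanishes on the unit and is determined by its values on vectors.
\<close>

lemma odd_derivation_eqI:
  assumes d: "odd_derivation d" and d': "odd_derivation d'"
    and eq: "\<And>u. u \<in> carrier U \<Longrightarrow> d (\<iota> u) = d' (\<iota> u)" and a: "a \<in> carrier \<Lambda>"
  shows "d a = d' a"
  using a
  by (induction rule: exterior_induct)
    (simp_all add: odd_derivation_one[OF d] odd_derivation_one[OF d'] odd_derivation_incl_mult[OF d]
      odd_derivation_incl_mult[OF d'] eq linear_mapsD[OF odd_derivation_linear[OF d]]
      linear_mapsD[OF odd_derivation_linear[OF d']])

end

text \<open>
  The square-zero extension of \<open>A\<close> by itself in which \<open>A\<close> acts on the left through \<open>\<sigma>\<close>.
  Its homomorphic sections \<open>a \<mapsto> (a, d a)\<close> are exactly the \<open>\<sigma>\<close>-derivations \<open>d\<close> of \<open>A\<close>.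
\<close>

definition twisted_extension ::
  "(real, 'a, 'm) module_scheme \<Rightarrow> ('a \<Rightarrow> 'a) \<Rightarrow> (real, 'a \<times> 'a) module" where
  "twisted_extension A \<sigma> =
    \<lparr>carrier = carrier A \<times> carrier A,
     mult = (\<lambda>a b. (fst a \<otimes>\<^bsub>A\<^esub> fst b, snd a \<otimes>\<^bsub>A\<^esub> fst b \<oplus>\<^bsub>A\<^esub> \<sigma> (fst a) \<otimes>\<^bsub>A\<^esub> snd b)),
     one = (\<one>\<^bsub>A\<^esub>, \<zero>\<^bsub>A\<^esub>), zero = (\<zero>\<^bsub>A\<^esub>, \<zero>\<^bsub>A\<^esub>),
     add = (\<lambda>a b. (fst a \<oplus>\<^bsub>A\<^esub> fst b, snd a \<oplus>\<^bsub>A\<^esub> snd b)),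
     smult = (\<lambda>c a. (c \<odot>\<^bsub>A\<^esub> fst a, c \<odot>\<^bsub>A\<^esub> snd a))\<rparr>"

lemma twisted_extension_simps [simp]:
  "carrier (twisted_extension A \<sigma>) = carrier A \<times> carrier A"
  "mult (twisted_extension A \<sigma>) =
    (\<lambda>a b. (fst a \<otimes>\<^bsub>A\<^esub> fst b, snd a \<otimes>\<^bsub>A\<^esub> fst b \<oplus>\<^bsub>A\<^esub> \<sigma> (fst a) \<otimes>\<^bsub>A\<^esub> snd b))"
  "one (twisted_extension A \<sigma>) = (\<one>\<^bsub>A\<^esub>, \<zero>\<^bsub>A\<^esub>)"
  "zero (twisted_extension A \<sigma>) = (\<zero>\<^bsub>A\<^esub>, \<zero>\<^bsub>A\<^esub>)"
  "add (twisted_extension A \<sigma>) = (\<lambda>a b. (fst a \<oplus>\<^bsub>A\<^esub> fst b, snd a \<oplus>\<^bsub>A\<^esub> snd b))"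
  "smult (twisted_extension A \<sigma>) = (\<lambda>c a. (c \<odot>\<^bsub>A\<^esub> fst a, c \<odot>\<^bsub>A\<^esub> snd a))"
  by (simp_all add: twisted_extension_def)

lemma twisted_extension_real_algebra:
  assumes A: "real_algebra A" and \<sigma>: "\<sigma> \<in> algebra_homs A A"
  shows "real_algebra (twisted_extension A \<sigma>)"
proof -
  interpret A: real_algebra A by (rule A)
  note [simp] = algebra_homD[OF \<sigma>]
  let ?B = "twisted_extension A \<sigma>"
  have "abelian_group ?B"
  proof (rule abelian_groupI)
    fix x assume "x \<in> carrier ?B"
    then show "\<exists>y\<in>carrier ?B. y \<oplus>\<^bsub>?B\<^esub> x = \<zero>\<^bsub>?B\<^esub>"
      by (intro bexI[of _ "(\<ominus>\<^bsub>A\<^esub> fst x, \<ominus>\<^bsub>A\<^esub> snd x)"]) (auto simp: A.l_neg)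
  qed (auto simp: A.a_ac)
  then have "real_space ?B"
    by (rule real_space.intro)
      (auto intro!: real_space_axioms.intro simp: A.smult_l_distr A.smult_r_distr A.smult_assoc)
  then show ?thesis
    by (rule real_algebraI)
      (auto simp: A.m_assoc A.l_distr A.r_distr A.a_ac A.smult_r_distr
        A.smult_mult_left A.smult_mult_right)
qed

context exterior
begin

text \<open>
  Extend \<open>u \<mapsto> (u, \<delta> u)\<close> to a homomorphism into the twisted extension and take its second
  component. The first component of the square of \<open>(u, \<delta> u)\<close> is \<open>u \<and> u\<close>, and the second is
  \<open>\<delta> u \<and> u - u \<and> \<delta> u\<close>; it vanishes since two-forms commute with vectors.
\<close>

lemma odd_derivation_exists:
  assumes \<delta>: "\<delta> \<in> linear_maps U \<Lambda>" and two: "\<And>u. u \<in> carrier U \<Longrightarrow> \<delta> u \<in> forms 2"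
  shows "\<exists>d. odd_derivation d \<and> d \<in> extensional (carrier \<Lambda>) \<and> (\<forall>u\<in>carrier U. d (\<iota> u) = \<delta> u)"
proof -
  let ?B = "twisted_extension \<Lambda> (parity U)"
  let ?l = "\<lambda>u. (\<iota> u, \<delta> u)"
  have B: "real_algebra ?B"
    by (rule twisted_extension_real_algebra[OF exterior_real_algebra parity_hom])
  have l: "?l \<in> linear_maps U ?B"
    by (rule linear_mapsI) (simp_all add: linear_mapsD[OF \<delta>] incl_add incl_smult)
  have sq: "?l u \<otimes>\<^bsub>?B\<^esub> ?l u = \<zero>\<^bsub>?B\<^esub>" if u: "u \<in> carrier U" for u
  proof -
    have "parity U (\<iota> u) = (-1) \<odot>\<^bsub>\<Lambda>\<^esub> \<iota> u"
      using parity_power[OF incl_in_power[OF u]] by simp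
    moreover have "\<delta> u \<in> carrier \<Lambda>"
      by (rule linear_mapsD(1)[OF \<delta> u])
    ultimately show ?thesis
      using power_two_commute[OF two[OF u] u] u
      by (simp add: incl_square \<Lambda>.l_minus \<Lambda>.r_neg flip: \<Lambda>.minus_eq_smult)
  qed
  let ?H = "ext_lift ?B ?l"
  note H = ext_lift_hom[OF B l sq] and H_incl = ext_lift_incl[OF B l sq]
  note HD = algebra_homD[OF H]
  have "(\<lambda>a. fst (?H a)) \<in> algebra_homs \<Lambda> \<Lambda>"
    by (rule algebra_homI[OF linear_mapsI]) (use HD in \<open>auto simp: mem_Times_iff\<close>)
  moreover have "(\<lambda>a. a) \<in> algebra_homs \<Lambda> \<Lambda>"
    by (rule algebra_homI[OF linear_mapsI]) auto
  ultimately have fst_H: "fst (?H a) = a" if "a \<in> carrier \<Lambda>" for a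
    by (rule algebra_homs_eqI[OF exterior_real_algebra]) (use that in \<open>auto simp: H_incl\<close>)
  define d where "d = restrict (\<lambda>a. snd (?H a)) (carrier \<Lambda>)"
  have "d \<in> linear_maps \<Lambda> \<Lambda>"
    unfolding d_def by (rule linear_mapsI) (use HD(1-3) in \<open>auto simp: mem_Times_iff\<close>)
  moreover have "d (a \<otimes>\<^bsub>\<Lambda>\<^esub> b) = d a \<otimes>\<^bsub>\<Lambda>\<^esub> b \<oplus>\<^bsub>\<Lambda>\<^esub> (-1) ^ k \<odot>\<^bsub>\<Lambda>\<^esub> (a \<otimes>\<^bsub>\<Lambda>\<^esub> d b)"
    if "a \<in> forms k" "b \<in> carrier \<Lambda>" for a b k
    using that HD(1)[of b] power_subspaceD(1)[OF that(1)]
    by (simp add: d_def HD(4) fst_H parity_power \<Lambda>.smult_mult_left mem_Times_iff)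
  moreover have "\<forall>u\<in>carrier U. d (\<iota> u) = \<delta> u"
    by (simp add: d_def H_incl)
  ultimately show ?thesis
    unfolding odd_derivation_def by (intro exI[of _ d]) (auto simp: d_def)
qed

end


section \<open>Creation operators\<close>

text \<open>
  Operators serve as a target for the exterior algebra whose associativity is free; only the
  anticommutation of a few operators has to be checked by hand.
\<close>

definition operators :: "(real, ('s \<Rightarrow> real) \<Rightarrow> 's \<Rightarrow> real) module" where
  "operators =
    \<lparr>carrier = {T. (\<forall>f g. T (\<lambda>s. f s + g s) = (\<lambda>s. T f s + T g s)) \<and>
                   (\<forall>c f. T (\<lambda>s. c * f s) = (\<lambda>s. c * T f s))},
     mult = (\<lambda>T T' f. T (T' f)), one = (\<lambda>f. f), zero = (\<lambda>f s. 0),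
     add = (\<lambda>T T' f s. T f s + T' f s), smult = (\<lambda>c T f s. c * T f s)\<rparr>"

lemma operators_simps:
  "carrier operators = {T. (\<forall>f g. T (\<lambda>s. f s + g s) = (\<lambda>s. T f s + T g s)) \<and>
                   (\<forall>c f. T (\<lambda>s. c * f s) = (\<lambda>s. c * T f s))}"
  "mult operators = (\<lambda>T T' f. T (T' f))" "one operators = (\<lambda>f. f)"
  "zero operators = (\<lambda>f s. 0)" "add operators = (\<lambda>T T' f s. T f s + T' f s)"
  "smult operators = (\<lambda>c T f s. c * T f s)"
  by (simp_all add: operators_def)

lemma operators_real_algebra: "real_algebra operators"
proof -
  have "abelian_group operators"
  proof (rule abelian_groupI)
    fix T :: "('s \<Rightarrow> real) \<Rightarrow> 's \<Rightarrow> real" assume "T \<in> carrier operators"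
    then show "\<exists>T'\<in>carrier operators. T' \<oplus>\<^bsub>operators\<^esub> T = \<zero>\<^bsub>operators\<^esub>"
      by (intro bexI[of _ "\<lambda>f s. - T f s"]) (simp_all add: operators_simps)
  qed (simp_all add: operators_simps algebra_simps)
  then have "real_space (operators :: (real, ('s \<Rightarrow> real) \<Rightarrow> 's \<Rightarrow> real) module)"
    by (rule real_space.intro)
      (auto intro!: real_space_axioms.intro simp: operators_simps algebra_simps)
  then show ?thesis
    by (rule real_algebraI) (simp_all add: operators_simps)
qed

lemma eval_operator_linear: "(\<lambda>T. T f s) \<in> linear_maps operators real_line"
  by (rule linear_mapsI) (simp_all add: operators_simps)

text \<open>
  \<open>creation P r i\<close> is left multiplication by the generator \<open>x\<^sub>i\<close> in the exterior algebra on the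
  indices, modulo the monomials of sets without the property \<open>P\<close>. A function on sets is the family
  of coefficients of the monomials, whose factors are ordered by \<open>r\<close>; the sign counts the factors
  that \<open>x\<^sub>i\<close> passes.
\<close>

definition creation ::
  "('i set \<Rightarrow> bool) \<Rightarrow> ('i \<Rightarrow> nat) \<Rightarrow> 'i \<Rightarrow> ('i set \<Rightarrow> real) \<Rightarrow> 'i set \<Rightarrow> real" where
  "creation P r i f S =
     (if i \<in> S \<and> P S then (-1) ^ card {j \<in> S. r j < r i} * f (S - {i}) else 0)"

definition field_operator ::
  "('i set \<Rightarrow> bool) \<Rightarrow> ('i \<Rightarrow> nat) \<Rightarrow> 'i set \<Rightarrow> ('i \<Rightarrow> real) \<Rightarrow> ('i set \<Rightarrow> real) \<Rightarrow> 'i set \<Rightarrow> real" where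
  "field_operator P r I a f S = (\<Sum>i\<in>I. a i * creation P r i f S)"

definition vacuum :: "'i set \<Rightarrow> real" where
  "vacuum S = (if S = {} then 1 else 0)"

lemma creation_in_operators: "creation P r i \<in> carrier operators"
  by (auto simp: operators_simps creation_def fun_eq_iff algebra_simps)

lemma field_operator_in_operators: "field_operator P r I a \<in> carrier operators"
  using creation_in_operators[of P r]
  by (auto simp: operators_simps field_operator_def fun_eq_iff sum.distrib sum_distrib_left
      algebra_simps)

lemma field_operator_add:
  "field_operator P r I (\<lambda>i. a i + b i) =
    field_operator P r I a \<oplus>\<^bsub>operators\<^esub> field_operator P r I b"
  by (auto simp: operators_simps field_operator_def fun_eq_iff sum.distrib algebra_simps)

lemma field_operator_smult:
  "field_operator P r I (\<lambda>i. c * a i) = c \<odot>\<^bsub>operators\<^esub> field_operator P r I a"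
  by (auto simp: operators_simps field_operator_def fun_eq_iff sum_distrib_left algebra_simps)

lemma field_operator_single:
  assumes "finite I" "i \<in> I"
  shows "field_operator P r I (\<lambda>j. if j = i then 1 else 0) = creation P r i"
  using assms by (simp add: field_operator_def fun_eq_iff if_distrib[of "\<lambda>c. c * _"] cong: if_cong)

locale creation_operators =
  fixes P :: "'i set \<Rightarrow> bool" and r :: "'i \<Rightarrow> nat"
  assumes P_finite: "P S \<Longrightarrow> finite S"
    and P_subset: "\<lbrakk>P S; T \<subseteq> S\<rbrakk> \<Longrightarrow> P T"
    and P_inj: "P S \<Longrightarrow> inj_on r S"
begin

lemma creation_creation:
  "creation P r i (creation P r j f) S =
    (if P S \<and> i \<in> S \<and> j \<in> S \<and> i \<noteq> j then
       (-1) ^ card {k \<in> S. r k < r i} * (-1) ^ card {k \<in> S - {i}. r k < r j} * f (S - {i, j})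
     else 0)"
  using P_subset[of S "S - {i}"]
  by (auto simp: creation_def Diff_insert2[symmetric] insert_commute)

text \<open>
  Of two distinct indices, removing the smaller one lowers the count of the larger one by one, and
  removing the larger one does not affect the smaller one.
\<close>

lemma creation_anticommute:
  "creation P r i (creation P r j f) S = - creation P r j (creation P r i f) S"
proof -
  have sign: "(-1) ^ card {k \<in> S. r k < r i} * (-1) ^ card {k \<in> S - {i}. r k < r j} =
      - ((-1) ^ card {k \<in> S. r k < r j} * (-1) ^ card {k \<in> S - {j}. r k < r i} :: real)"
    if S: "P S" "i \<in> S" "j \<in> S" "r i < r j" for i j
  proof -
    have "{k \<in> S. r k < r j} = insert i {k \<in> S - {i}. r k < r j}"
      using S by auto
    then have "card {k \<in> S. r k < r j} = Suc (card {k \<in> S - {i}. r k < r j})"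
      using P_finite[OF S(1)] by simp
    moreover have "{k \<in> S - {j}. r k < r i} = {k \<in> S. r k < r i}"
      using S by auto
    ultimately show ?thesis
      by simp
  qed
  show ?thesis
  proof (cases "P S \<and> i \<in> S \<and> j \<in> S \<and> i \<noteq> j")
    case True
    then have ij: "P S" "i \<in> S" "j \<in> S" "i \<noteq> j" "j \<noteq> i"
      by auto
    then have "r i \<noteq> r j"
      using P_inj[of S] by (auto dest: inj_onD)
    then have "(-1) ^ card {k \<in> S. r k < r i} * (-1) ^ card {k \<in> S - {i}. r k < r j} =
      - ((-1) ^ card {k \<in> S. r k < r j} * (-1) ^ card {k \<in> S - {j}. r k < r i} :: real)" (is "?a = - ?b")
      using sign[OF ij(1,2,3)] sign[OF ij(1,3,2)] by linarith
    then have "?a * f (S - {i, j}) = - (?b * f (S - {j, i}))"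
      by (simp add: insert_commute)
    then show ?thesis
      using ij unfolding creation_creation by simp
  qed (auto simp: creation_creation)
qed

lemma creation_creation_eq_zero: "\<not> P {i, j} \<Longrightarrow> creation P r i (creation P r j f) = (\<lambda>S. 0)"
  using P_subset[of _ "{i, j}"] by (auto simp: creation_creation fun_eq_iff)

text \<open>
  In the double sum over pairs of indices, transposing the pair changes the sign.
\<close>

lemma field_operator_square:
  assumes "finite I"
  shows "field_operator P r I a \<otimes>\<^bsub>operators\<^esub> field_operator P r I a = \<zero>\<^bsub>operators\<^esub>"
proof -
  have "field_operator P r I a (field_operator P r I a f) S = 0" for f S
  proof -
    have cr: "creation P r i (field_operator P r I a f) S =
        (\<Sum>j\<in>I. a j * creation P r i (creation P r j f) S)" for i
      by (cases "i \<in> S \<and> P S")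
        (auto simp: creation_def[of P r i] field_operator_def sum_distrib_left algebra_simps)
    let ?x = "\<Sum>i\<in>I. \<Sum>j\<in>I. a i * a j * creation P r i (creation P r j f) S"
    have "field_operator P r I a (field_operator P r I a f) S = ?x"
      unfolding field_operator_def[of P r I a _ S] cr
      by (simp add: sum_distrib_left algebra_simps)
    moreover have "?x = - ?x"
    proof -
      have "?x = (\<Sum>j\<in>I. \<Sum>i\<in>I. a i * a j * creation P r i (creation P r j f) S)"
        by (rule sum.swap)
      also have "\<dots> = - ?x"
        unfolding sum_negf[symmetric]
        by (intro sum.cong refl) (subst creation_anticommute, simp)
      finally show ?thesis .
    qed
    ultimately show ?thesis
      by linarith
  qed
  then show ?thesis
    by (simp add: operators_simps fun_eq_iff)
qed

text \<open>
  The monomial of a word without repetitions is plus or minus the monomial of its set of letters.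
\<close>

lemma creation_word_vacuum:
  assumes "distinct w" "P (set w)"
  shows "\<exists>\<epsilon>. \<epsilon> \<noteq> 0 \<and> foldr (creation P r) w vacuum = (\<lambda>S. if S = set w then \<epsilon> else 0)"
  using assms
proof (induction w)
  case Nil
  then show ?case
    by (intro exI[of _ 1]) (simp add: vacuum_def)
next
  case (Cons i w)
  then obtain \<epsilon> where \<epsilon>: "\<epsilon> \<noteq> 0" "foldr (creation P r) w vacuum = (\<lambda>S. if S = set w then \<epsilon> else 0)"
    using P_subset[of "set (i # w)" "set w"] by auto
  have "S - {i} = set w \<longleftrightarrow> S = set (i # w)" if "i \<in> S" for S
    using that Cons.prems by auto
  then have "creation P r i (\<lambda>S. if S = set w then \<epsilon> else 0) =
      (\<lambda>S. if S = set (i # w) then (-1) ^ card {j \<in> set (i # w). r j < r i} * \<epsilon> else 0)"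
    using Cons.prems by (auto simp: creation_def fun_eq_iff)
  then show ?case
    using \<epsilon> by (intro exI[of _ "(-1) ^ card {j \<in> set (i # w). r j < r i} * \<epsilon>"]) simp
qed

lemma field_operator_degree:
  assumes "\<And>S. f S \<noteq> 0 \<Longrightarrow> card S = n" "field_operator P r I a f S \<noteq> 0"
  shows "card S = Suc n"
proof -
  obtain i where "creation P r i f S \<noteq> 0"
    using assms(2) unfolding field_operator_def
    by (metis (no_types, lifting) mult_zero_right sum.neutral)
  then have "i \<in> S" "finite S" "card (S - {i}) = n"
    using P_finite assms(1) by (auto simp: creation_def split: if_splits)
  then show ?thesis
    by (metis card.remove)
qed

end


section \<open>Two-forms as alternating bilinear forms\<close>

text \<open>
  A vector space whose vectors are functions, with pointwise operations on \<open>X\<close>. Both a dual space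
  (functions on the original space) and the vertex space (functions on the vertices) are of this
  kind, so evaluation of two-forms applies to either.
\<close>

locale form_space = exterior U for U :: "(real, 'a \<Rightarrow> real, 'm) module_scheme" (structure) +
  fixes X :: "'a set"
  assumes eval_add: "\<lbrakk>x \<in> X; u \<in> carrier U; v \<in> carrier U\<rbrakk> \<Longrightarrow> (u \<oplus> v) x = u x + v x"
    and eval_smult: "\<lbrakk>x \<in> X; u \<in> carrier U\<rbrakk> \<Longrightarrow> (c \<odot> u) x = c * u x"
begin

text \<open>
  Evaluation at two points maps the exterior algebra to that of the plane, and the value of a
  two-form is the coefficient of the area form. In particular it depends only on the coset: the sum
  over a representative is the image of the coset under a linear map.
\<close>

context
  fixes x y assumes x: "x \<in> X" and y: "y \<in> X"
begin

private definition "P2 = (\<lambda>S. S \<subseteq> {0, 1 :: nat})"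

interpretation creation_operators P2 "\<lambda>i. i"
  by unfold_locales (auto simp: P2_def finite_subset)

private definition "plane u = field_operator P2 (\<lambda>i. i) {0, 1} (\<lambda>i. if i = 0 then u x else u y)"

private definition "area T = T vacuum {0, 1 :: nat}"

private lemma plane_linear: "plane \<in> linear_maps U operators"
proof (rule linear_mapsI)
  fix u v c assume u: "u \<in> carrier U" and v: "v \<in> carrier U"
  have "(\<lambda>i. if i = (0 :: nat) then (u \<oplus> v) x else (u \<oplus> v) y) =
      (\<lambda>i. (if i = 0 then u x else u y) + (if i = 0 then v x else v y))"
    using u v x y by (simp add: eval_add fun_eq_iff)
  then show "plane (u \<oplus> v) = plane u \<oplus>\<^bsub>operators\<^esub> plane v"
    by (simp only: plane_def field_operator_add)
next
  fix u c assume u: "u \<in> carrier U"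
  have "(\<lambda>i. if i = (0 :: nat) then (c \<odot> u) x else (c \<odot> u) y) =
      (\<lambda>i. c * (if i = 0 then u x else u y))"
    using u x y by (simp add: eval_smult fun_eq_iff)
  then show "plane (c \<odot> u) = c \<odot>\<^bsub>operators\<^esub> plane u"
    by (simp only: plane_def field_operator_smult)
qed (simp add: plane_def field_operator_in_operators)

private lemma plane_square: "plane u \<otimes>\<^bsub>operators\<^esub> plane u = \<zero>\<^bsub>operators\<^esub>"
  unfolding plane_def by (rule field_operator_square) simp

private lemma area_two: "area (word_prod operators plane [u, v]) = u x * v y - u y * v x"
proof -
  have sets: "{0, Suc 0} - {0} = {Suc 0}" "{0, Suc 0} - {Suc 0} = {0}"
    "{j. j = Suc 0 \<and> j = 0} = {}" "{j. j = 0 \<and> (j = 0 \<or> j = Suc 0)} = {0}"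
    by auto
  show ?thesis
    by (simp add: area_def operators_simps plane_def field_operator_def creation_def P2_def
        vacuum_def sets)
qed

text \<open>
  A word of length \<open>n\<close> produces functions supported on sets with \<open>n\<close> elements.
\<close>

private lemma area_other:
  assumes "length w \<noteq> 2" shows "area (word_prod operators plane w) = 0"
proof -
  have "card S = length w" if "word_prod operators plane w vacuum S \<noteq> 0" for S
    using that
  proof (induction w arbitrary: S)
    case Nil
    then show ?case by (simp add: operators_simps vacuum_def split: if_splits)
  next
    case (Cons u w)
    have "field_operator P2 (\<lambda>i. i) {0, 1} (\<lambda>i. if i = 0 then u x else u y)
        (word_prod operators plane w vacuum) S \<noteq> 0"
      using Cons.prems by (simp add: operators_simps plane_def[of u])
    then show ?case
      using field_operator_degree[OF Cons.IH] by simp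
  qed
  from this[of "{0, 1}"] show ?thesis
    using assms unfolding area_def by force
qed

private abbreviation (input) "value2 f \<equiv>
  \<Sum>w | f w \<noteq> 0 \<and> length w = 2. f w * ((w ! 0) x * (w ! 1) y - (w ! 0) y * (w ! 1) x)"

private abbreviation (input) "\<kappa> a \<equiv> area (ext_lift operators plane a)"

private lemma \<kappa>_linear: "\<kappa> \<in> linear_maps \<Lambda> real_line"
proof -
  note hom = algebra_homD[OF ext_lift_hom[OF operators_real_algebra plane_linear plane_square]]
  show ?thesis
    using linear_mapsD[OF eval_operator_linear[of vacuum "{0, 1 :: nat}"]]
    by (intro linear_mapsI) (simp_all add: hom area_def)
qed

private lemma \<kappa>_wedge: "w \<in> lists (carrier U) \<Longrightarrow> \<kappa> (ext_wedge U w) =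
    (if length w = 2 then (w ! 0) x * (w ! 1) y - (w ! 0) y * (w ! 1) x else 0)"
  using area_two[of "w ! 0" "w ! 1"] area_other[of w]
  by (auto simp: ext_lift_wedge[OF operators_real_algebra plane_linear plane_square]
      numeral_2_eq_2 length_Suc_conv)

private lemma value2_eq:
  assumes f: "f \<in> carrier F" shows "value2 f = \<kappa> (Q.proj f)"
proof -
  define \<beta> where "\<beta> w = (if length w = 2 then (w ! 0) x * (w ! 1) y - (w ! 0) y * (w ! 1) x else 0)"
    for w :: "('a \<Rightarrow> real) list"
  have "value2 f = (\<Sum>w | f w \<noteq> 0. f w * \<beta> w)"
    using f by (intro sum.mono_neutral_cong_left) (auto simp: free_algebra_simps \<beta>_def)
  also have "\<dots> = free_lift real_line \<beta> f"
    by (simp add: free_lift_def)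
  also have "\<dots> = \<kappa> (Q.proj f)"
  proof (rule free_algebra_linear_maps_eqI[OF real_line_space _ _ _ f])
    show "free_lift real_line \<beta> \<in> linear_maps F real_line"
      by (rule free_lift_linear[OF real_line_space]) simp
    show "(\<lambda>f. \<kappa> (Q.proj f)) \<in> linear_maps F real_line"
      by (rule linear_mapsI)
        (simp_all add: linear_mapsD[OF \<kappa>_linear, simplified] proj_closed flip: proj_add proj_smult)
    show "free_lift real_line \<beta> (free_word w) = \<kappa> (Q.proj (free_word w))"
      if "w \<in> lists (carrier U)" for w
      using free_lift_word[OF real_line_space _ that, of \<beta>] that
      by (simp add: proj_free_word \<kappa>_wedge \<beta>_def)
  qed
  finally show ?thesis .
qed

private lemma two_form_eval_eq:
  assumes "a \<in> carrier \<Lambda>" shows "two_form_eval a x y = \<kappa> a"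
proof -
  obtain f where f: "f \<in> carrier F" "a = Q.proj f"
    using assms by (rule exterior_carrierE)
  have "value2 g = \<kappa> a" if "g \<in> a" for g
  proof -
    obtain n where "n \<in> I" "g = n \<oplus>\<^bsub>F\<^esub> f"
      using \<open>g \<in> a\<close> f by (auto simp: Q.mem_proj_iff)
    then have "g \<in> carrier F" "Q.proj g = a"
      using f by (auto simp: Q.proj_eqI)
    then show ?thesis
      using value2_eq by auto
  qed
  moreover have "f \<in> a"
    using f Q.proj_self by blast
  ultimately have "value2 ` a = {\<kappa> a}"
    by (auto simp: image_iff)
  then show ?thesis
    by (simp add: two_form_eval_def)
qed

lemma two_form_eval_linear: "(\<lambda>a. two_form_eval a x y) \<in> linear_maps \<Lambda> real_line"
  using linear_mapsD[OF \<kappa>_linear] by (intro linear_mapsI) (simp_all add: two_form_eval_eq)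

lemma two_form_eval_wedge:
  "\<lbrakk>u \<in> carrier U; v \<in> carrier U\<rbrakk> \<Longrightarrow>
    two_form_eval (\<iota> u \<otimes>\<^bsub>\<Lambda>\<^esub> \<iota> v) x y = u x * v y - u y * v x"
  using \<kappa>_wedge[of "[u, v]"] by (simp add: two_form_eval_eq)

end

end


subsection \<open>Expansion of two-forms in a frame\<close>

context exterior
begin

definition wedge_sum :: "'k set \<Rightarrow> ('k \<Rightarrow> 'a) \<Rightarrow> ('k \<Rightarrow> 'k \<Rightarrow> real) \<Rightarrow> ('a list \<Rightarrow> real) set" where
  "wedge_sum K \<phi> c = (\<Oplus>\<^bsub>\<Lambda>\<^esub>k\<in>K. \<Oplus>\<^bsub>\<Lambda>\<^esub>l\<in>K. c k l \<odot>\<^bsub>\<Lambda>\<^esub> (\<iota> (\<phi> k) \<otimes>\<^bsub>\<Lambda>\<^esub> \<iota> (\<phi> l)))"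

context
  fixes K :: "'k set" and \<phi> :: "'k \<Rightarrow> 'a"
  assumes K: "finite K" and \<phi>: "\<And>k. k \<in> K \<Longrightarrow> \<phi> k \<in> carrier U"
begin

text \<open>
  The sum is formed in the exterior algebra but has summands of degree two, so a map that is linear
  on two-forms only can be applied to it.
\<close>

lemma linear_map_forms_wedge_sum:
  assumes N: "real_space N" and h: "h \<in> linear_maps (ext_power U 2) N"
  shows "h (wedge_sum K \<phi> c) = (\<Oplus>\<^bsub>N\<^esub>k\<in>K. \<Oplus>\<^bsub>N\<^esub>l\<in>K. c k l \<odot>\<^bsub>N\<^esub> h (\<iota> (\<phi> k) \<otimes>\<^bsub>\<Lambda>\<^esub> \<iota> (\<phi> l)))"
proof -
  interpret N: real_space N by (rule N)
  have h': "h \<in> linear_maps (\<Lambda>\<lparr>carrier := forms 2\<rparr>) N"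
    using h by (simp add: ext_power_def)
  note hD = linear_mapsD[OF h]
  note sum = linear_map_finsum_subspace[OF \<Lambda>.real_space_axioms power_subspace N h' K]
  have summand: "c k l \<odot>\<^bsub>\<Lambda>\<^esub> (\<iota> (\<phi> k) \<otimes>\<^bsub>\<Lambda>\<^esub> \<iota> (\<phi> l)) \<in> forms 2" if "k \<in> K" "l \<in> K" for k l
    using that by (intro power_subspaceD(4) incl_incl_in_power \<phi>)
  have val: "h (c k l \<odot>\<^bsub>\<Lambda>\<^esub> (\<iota> (\<phi> k) \<otimes>\<^bsub>\<Lambda>\<^esub> \<iota> (\<phi> l))) = c k l \<odot>\<^bsub>N\<^esub> h (\<iota> (\<phi> k) \<otimes>\<^bsub>\<Lambda>\<^esub> \<iota> (\<phi> l))"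
    if "k \<in> K" "l \<in> K" for k l
    using hD(3)[OF incl_incl_in_power[OF \<phi> \<phi>], OF that] by (simp add: ext_power_simps)
  have closed: "h (\<iota> (\<phi> k) \<otimes>\<^bsub>\<Lambda>\<^esub> \<iota> (\<phi> l)) \<in> carrier N" if "k \<in> K" "l \<in> K" for k l
    using that by (intro hD(1) incl_incl_in_power \<phi>)
  have inner: "h (\<Oplus>\<^bsub>\<Lambda>\<^esub>l\<in>K. c k l \<odot>\<^bsub>\<Lambda>\<^esub> (\<iota> (\<phi> k) \<otimes>\<^bsub>\<Lambda>\<^esub> \<iota> (\<phi> l))) =
      (\<Oplus>\<^bsub>N\<^esub>l\<in>K. c k l \<odot>\<^bsub>N\<^esub> h (\<iota> (\<phi> k) \<otimes>\<^bsub>\<Lambda>\<^esub> \<iota> (\<phi> l)))" if k: "k \<in> K" for k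
  proof -
    have "h (\<Oplus>\<^bsub>\<Lambda>\<^esub>l\<in>K. c k l \<odot>\<^bsub>\<Lambda>\<^esub> (\<iota> (\<phi> k) \<otimes>\<^bsub>\<Lambda>\<^esub> \<iota> (\<phi> l))) =
        (\<Oplus>\<^bsub>N\<^esub>l\<in>K. h (c k l \<odot>\<^bsub>\<Lambda>\<^esub> (\<iota> (\<phi> k) \<otimes>\<^bsub>\<Lambda>\<^esub> \<iota> (\<phi> l))))"
      by (rule sum[THEN conjunct2]) (rule summand[OF k])
    also have "\<dots> = (\<Oplus>\<^bsub>N\<^esub>l\<in>K. c k l \<odot>\<^bsub>N\<^esub> h (\<iota> (\<phi> k) \<otimes>\<^bsub>\<Lambda>\<^esub> \<iota> (\<phi> l)))"
      by (intro N.finsum_cong' refl Pi_I) (simp_all add: closed k val)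
    finally show ?thesis .
  qed
  have "h (wedge_sum K \<phi> c) = (\<Oplus>\<^bsub>N\<^esub>k\<in>K. h (\<Oplus>\<^bsub>\<Lambda>\<^esub>l\<in>K. c k l \<odot>\<^bsub>\<Lambda>\<^esub> (\<iota> (\<phi> k) \<otimes>\<^bsub>\<Lambda>\<^esub> \<iota> (\<phi> l))))"
    unfolding wedge_sum_def
    by (rule sum[THEN conjunct2], rule sum[THEN conjunct1], rule summand)
  also have "\<dots> = (\<Oplus>\<^bsub>N\<^esub>k\<in>K. \<Oplus>\<^bsub>N\<^esub>l\<in>K. c k l \<odot>\<^bsub>N\<^esub> h (\<iota> (\<phi> k) \<otimes>\<^bsub>\<Lambda>\<^esub> \<iota> (\<phi> l)))"
    by (rule N.finsum_cong'[OF refl _ inner]) (auto intro!: N.finsum_closed simp: closed)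
  finally show ?thesis .
qed

lemma linear_map_wedge_sum:
  assumes "real_space N" "h \<in> linear_maps \<Lambda> N"
  shows "h (wedge_sum K \<phi> c) = (\<Oplus>\<^bsub>N\<^esub>k\<in>K. \<Oplus>\<^bsub>N\<^esub>l\<in>K. c k l \<odot>\<^bsub>N\<^esub> h (\<iota> (\<phi> k) \<otimes>\<^bsub>\<Lambda>\<^esub> \<iota> (\<phi> l)))"
proof (rule linear_map_forms_wedge_sum[OF assms(1)])
  show "h \<in> linear_maps (ext_power U 2) N"
    using linear_mapsD[OF assms(2)] power_subspaceD(1)
    by (intro linear_mapsI) (simp_all add: ext_power_simps(2-))
qed

lemma wedge_sum_in_forms: "wedge_sum K \<phi> c \<in> forms 2"
proof -
  have "(\<Oplus>\<^bsub>\<Lambda>\<^esub>i\<in>L. f i) \<in> forms 2" if "finite L" "\<And>i. i \<in> L \<Longrightarrow> f i \<in> forms 2"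
    for L :: "'k set" and f
    using that
  proof (induction L rule: finite_induct)
    case (insert i L)
    then show ?case
      using power_subspaceD by (subst \<Lambda>.finsum_insert) auto
  qed (simp add: power_subspaceD(2))
  then show ?thesis
    unfolding wedge_sum_def using K \<phi> by (simp add: power_subspaceD(4) incl_incl_in_power)
qed

lemma wedge_sum_closed: "wedge_sum K \<phi> c \<in> carrier \<Lambda>"
  by (rule power_subspaceD(1)[OF wedge_sum_in_forms])

lemma wedge_sum_add:
  "wedge_sum K \<phi> (\<lambda>k l. c k l + c' k l) = wedge_sum K \<phi> c \<oplus>\<^bsub>\<Lambda>\<^esub> wedge_sum K \<phi> c'"
proof -
  let ?w = "\<lambda>k l. \<iota> (\<phi> k) \<otimes>\<^bsub>\<Lambda>\<^esub> \<iota> (\<phi> l)"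
  have inner: "(\<Oplus>\<^bsub>\<Lambda>\<^esub>l\<in>K. (c k l + c' k l) \<odot>\<^bsub>\<Lambda>\<^esub> ?w k l) =
      (\<Oplus>\<^bsub>\<Lambda>\<^esub>l\<in>K. c k l \<odot>\<^bsub>\<Lambda>\<^esub> ?w k l) \<oplus>\<^bsub>\<Lambda>\<^esub> (\<Oplus>\<^bsub>\<Lambda>\<^esub>l\<in>K. c' k l \<odot>\<^bsub>\<Lambda>\<^esub> ?w k l)" if "k \<in> K" for k
  proof -
    have "(\<Oplus>\<^bsub>\<Lambda>\<^esub>l\<in>K. (c k l + c' k l) \<odot>\<^bsub>\<Lambda>\<^esub> ?w k l) =
        (\<Oplus>\<^bsub>\<Lambda>\<^esub>l\<in>K. c k l \<odot>\<^bsub>\<Lambda>\<^esub> ?w k l \<oplus>\<^bsub>\<Lambda>\<^esub> c' k l \<odot>\<^bsub>\<Lambda>\<^esub> ?w k l)"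
      by (intro \<Lambda>.finsum_cong' refl Pi_I) (simp_all add: \<phi> that \<Lambda>.smult_l_distr)
    also have "\<dots> = (\<Oplus>\<^bsub>\<Lambda>\<^esub>l\<in>K. c k l \<odot>\<^bsub>\<Lambda>\<^esub> ?w k l) \<oplus>\<^bsub>\<Lambda>\<^esub> (\<Oplus>\<^bsub>\<Lambda>\<^esub>l\<in>K. c' k l \<odot>\<^bsub>\<Lambda>\<^esub> ?w k l)"
      by (intro \<Lambda>.finsum_addf Pi_I) (simp_all add: \<phi> that)
    finally show ?thesis .
  qed
  have "wedge_sum K \<phi> (\<lambda>k l. c k l + c' k l) = (\<Oplus>\<^bsub>\<Lambda>\<^esub>k\<in>K.
      (\<Oplus>\<^bsub>\<Lambda>\<^esub>l\<in>K. c k l \<odot>\<^bsub>\<Lambda>\<^esub> ?w k l) \<oplus>\<^bsub>\<Lambda>\<^esub> (\<Oplus>\<^bsub>\<Lambda>\<^esub>l\<in>K. c' k l \<odot>\<^bsub>\<Lambda>\<^esub> ?w k l))"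
    unfolding wedge_sum_def
    by (rule \<Lambda>.finsum_cong'[OF refl _ inner]) (auto intro!: \<Lambda>.finsum_closed simp: \<phi>)
  also have "\<dots> = wedge_sum K \<phi> c \<oplus>\<^bsub>\<Lambda>\<^esub> wedge_sum K \<phi> c'"
    unfolding wedge_sum_def by (intro \<Lambda>.finsum_addf Pi_I \<Lambda>.finsum_closed) (simp_all add: \<phi>)
  finally show ?thesis .
qed

lemma wedge_sum_smult: "wedge_sum K \<phi> (\<lambda>k l. a * c k l) = a \<odot>\<^bsub>\<Lambda>\<^esub> wedge_sum K \<phi> c"
proof -
  have "(\<lambda>x. a \<odot>\<^bsub>\<Lambda>\<^esub> x) \<in> linear_maps \<Lambda> \<Lambda>"
    by (rule linear_mapsI) (auto simp: \<Lambda>.smult_r_distr \<Lambda>.smult_assoc[symmetric] mult.commute)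
  from linear_map_wedge_sum[OF \<Lambda>.real_space_axioms this, of c]
  have "a \<odot>\<^bsub>\<Lambda>\<^esub> wedge_sum K \<phi> c =
      (\<Oplus>\<^bsub>\<Lambda>\<^esub>k\<in>K. \<Oplus>\<^bsub>\<Lambda>\<^esub>l\<in>K. c k l \<odot>\<^bsub>\<Lambda>\<^esub> (a \<odot>\<^bsub>\<Lambda>\<^esub> (\<iota> (\<phi> k) \<otimes>\<^bsub>\<Lambda>\<^esub> \<iota> (\<phi> l))))" .
  also have "\<dots> = wedge_sum K \<phi> (\<lambda>k l. a * c k l)"
    unfolding wedge_sum_def
    by (intro \<Lambda>.finsum_cong' refl Pi_I \<Lambda>.finsum_closed)
      (simp_all add: \<phi> mult.commute flip: \<Lambda>.smult_assoc)
  finally show ?thesis ..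
qed

lemma wedge_sum_zero: "wedge_sum K \<phi> (\<lambda>k l. 0) = \<zero>\<^bsub>\<Lambda>\<^esub>"
  using wedge_sum_smult[of 0 "\<lambda>k l. 0"] wedge_sum_closed[of "\<lambda>k l. 0"] by simp

lemma wedge_sum_cong:
  "(\<And>k l. \<lbrakk>k \<in> K; l \<in> K\<rbrakk> \<Longrightarrow> c k l = c' k l) \<Longrightarrow> wedge_sum K \<phi> c = wedge_sum K \<phi> c'"
  unfolding wedge_sum_def
  by (intro \<Lambda>.finsum_cong' refl Pi_I \<Lambda>.finsum_closed) (simp_all add: \<phi>)

lemma wedge_of_sums:
  assumes u: "u \<in> carrier U" "u = (\<Oplus>k\<in>K. a k \<odot> \<phi> k)"
    and v: "v \<in> carrier U" "v = (\<Oplus>k\<in>K. b k \<odot> \<phi> k)"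
  shows "\<iota> u \<otimes>\<^bsub>\<Lambda>\<^esub> \<iota> v = wedge_sum K \<phi> (\<lambda>k l. a k * b l)"
proof -
  have expand: "\<iota> (\<Oplus>k\<in>K. a k \<odot> \<phi> k) = (\<Oplus>\<^bsub>\<Lambda>\<^esub>k\<in>K. a k \<odot>\<^bsub>\<Lambda>\<^esub> \<iota> (\<phi> k))" for a
  proof -
    have "\<iota> (\<Oplus>k\<in>K. a k \<odot> \<phi> k) = (\<Oplus>\<^bsub>\<Lambda>\<^esub>k\<in>K. \<iota> (a k \<odot> \<phi> k))"
      using \<phi> by (intro linear_map_finsum[OF real_space_axioms \<Lambda>.real_space_axioms incl_linear K]) auto
    also have "\<dots> = (\<Oplus>\<^bsub>\<Lambda>\<^esub>k\<in>K. a k \<odot>\<^bsub>\<Lambda>\<^esub> \<iota> (\<phi> k))"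
      by (intro \<Lambda>.finsum_cong' refl Pi_I) (simp_all add: \<phi> incl_smult)
    finally show ?thesis .
  qed
  have "\<iota> u \<otimes>\<^bsub>\<Lambda>\<^esub> \<iota> v = (\<Oplus>\<^bsub>\<Lambda>\<^esub>k\<in>K. (a k \<odot>\<^bsub>\<Lambda>\<^esub> \<iota> (\<phi> k)) \<otimes>\<^bsub>\<Lambda>\<^esub> \<iota> v)"
    unfolding u(2) expand using K \<phi> v(1) by (intro \<Lambda>.finsum_ldistr) auto
  also have "\<dots> = (\<Oplus>\<^bsub>\<Lambda>\<^esub>k\<in>K. \<Oplus>\<^bsub>\<Lambda>\<^esub>l\<in>K. (a k \<odot>\<^bsub>\<Lambda>\<^esub> \<iota> (\<phi> k)) \<otimes>\<^bsub>\<Lambda>\<^esub> (b l \<odot>\<^bsub>\<Lambda>\<^esub> \<iota> (\<phi> l)))"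
    unfolding v(2) expand using K \<phi>
    by (intro \<Lambda>.finsum_cong' refl \<Lambda>.finsum_rdistr) (auto intro!: \<Lambda>.finsum_closed)
  also have "\<dots> = wedge_sum K \<phi> (\<lambda>k l. a k * b l)"
    unfolding wedge_sum_def using \<phi>
    by (intro \<Lambda>.finsum_cong' refl Pi_I \<Lambda>.finsum_closed)
      (simp_all add: \<phi> \<Lambda>.smult_mult_left \<Lambda>.smult_mult_right mult.commute flip: \<Lambda>.smult_assoc)
  finally show ?thesis .
qed

end

end

text \<open>
  A frame is a finite family of points and vectors by which each vector is recovered from its values
  at the points. Recovery of vectors entails recovery of two-forms from their values at pairs.
\<close>

locale framed_form_space = form_space U X
  for U :: "(real, 'a \<Rightarrow> real, 'm) module_scheme" (structure) and X +
  fixes K :: "'k set" and p :: "'k \<Rightarrow> 'a" and \<phi> :: "'k \<Rightarrow> 'a \<Rightarrow> real"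
  assumes K: "finite K" and p: "\<And>k. k \<in> K \<Longrightarrow> p k \<in> X" and \<phi>: "\<And>k. k \<in> K \<Longrightarrow> \<phi> k \<in> carrier U"
    and frame: "u \<in> carrier U \<Longrightarrow> u = (\<Oplus>k\<in>K. u (p k) \<odot> \<phi> k)"
begin

text \<open>
  On \<open>u \<and> v\<close> the right-hand side is the expansion of \<open>u \<and> v\<close> minus that of \<open>v \<and> u\<close>,
  which is twice \<open>u \<and> v\<close>.
\<close>

lemma two_form_expansion:
  assumes "\<theta> \<in> forms 2"
  shows "2 \<odot>\<^bsub>\<Lambda>\<^esub> \<theta> = wedge_sum K \<phi> (\<lambda>k l. two_form_eval \<theta> (p k) (p l))"
  using assms
proof (induction rule: power_two_induct)
  case (wedge u v)
  have "wedge_sum K \<phi> (\<lambda>k l. two_form_eval (\<iota> u \<otimes>\<^bsub>\<Lambda>\<^esub> \<iota> v) (p k) (p l)) =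
      wedge_sum K \<phi> (\<lambda>k l. u (p k) * v (p l) + (-1) * (v (p k) * u (p l)))"
    by (intro wedge_sum_cong K \<phi>) (simp_all add: two_form_eval_wedge p wedge)
  also have "\<dots> = wedge_sum K \<phi> (\<lambda>k l. u (p k) * v (p l)) \<oplus>\<^bsub>\<Lambda>\<^esub>
      (-1) \<odot>\<^bsub>\<Lambda>\<^esub> wedge_sum K \<phi> (\<lambda>k l. v (p k) * u (p l))"
    by (simp only: wedge_sum_add[OF K \<phi>] wedge_sum_smult[OF K \<phi>])
  also have "\<dots> = \<iota> u \<otimes>\<^bsub>\<Lambda>\<^esub> \<iota> v \<oplus>\<^bsub>\<Lambda>\<^esub> (-1) \<odot>\<^bsub>\<Lambda>\<^esub> (\<iota> v \<otimes>\<^bsub>\<Lambda>\<^esub> \<iota> u)"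
    using wedge_of_sums[OF K \<phi> wedge(1) frame[OF wedge(1)] wedge(2) frame[OF wedge(2)]]
      wedge_of_sums[OF K \<phi> wedge(2) frame[OF wedge(2)] wedge(1) frame[OF wedge(1)]] by simp
  also have "(-1) \<odot>\<^bsub>\<Lambda>\<^esub> (\<iota> v \<otimes>\<^bsub>\<Lambda>\<^esub> \<iota> u) = \<iota> u \<otimes>\<^bsub>\<Lambda>\<^esub> \<iota> v"
    using incl_anticommute[of u v] wedge by simp
  also have "\<iota> u \<otimes>\<^bsub>\<Lambda>\<^esub> \<iota> v \<oplus>\<^bsub>\<Lambda>\<^esub> \<iota> u \<otimes>\<^bsub>\<Lambda>\<^esub> \<iota> v = 2 \<odot>\<^bsub>\<Lambda>\<^esub> (\<iota> u \<otimes>\<^bsub>\<Lambda>\<^esub> \<iota> v)"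
    using \<Lambda>.smult_l_distr[of "\<iota> u \<otimes>\<^bsub>\<Lambda>\<^esub> \<iota> v" 1 1] wedge by simp
  finally show ?case ..
next
  case zero
  have "two_form_eval \<zero>\<^bsub>\<Lambda>\<^esub> x y = 0" if "x \<in> X" "y \<in> X" for x y
    using linear_map_zero[OF \<Lambda>.real_space_axioms real_line_space two_form_eval_linear[OF that]] by simp
  then have "wedge_sum K \<phi> (\<lambda>k l. two_form_eval \<zero>\<^bsub>\<Lambda>\<^esub> (p k) (p l)) = wedge_sum K \<phi> (\<lambda>k l. 0)"
    by (intro wedge_sum_cong K \<phi>) (simp_all add: p)
  then show ?case
    by (simp add: wedge_sum_zero K \<phi>)
next
  case (add a b)
  have "wedge_sum K \<phi> (\<lambda>k l. two_form_eval (a \<oplus>\<^bsub>\<Lambda>\<^esub> b) (p k) (p l)) =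
      wedge_sum K \<phi> (\<lambda>k l. two_form_eval a (p k) (p l) + two_form_eval b (p k) (p l))"
    using linear_mapsD(2)[OF two_form_eval_linear] add
    by (intro wedge_sum_cong K \<phi>) (simp_all add: p power_subspaceD(1))
  then show ?case
    using add by (simp add: wedge_sum_add[OF K \<phi>] \<Lambda>.smult_r_distr power_subspaceD(1))
next
  case (smult c a)
  have "wedge_sum K \<phi> (\<lambda>k l. two_form_eval (c \<odot>\<^bsub>\<Lambda>\<^esub> a) (p k) (p l)) =
      wedge_sum K \<phi> (\<lambda>k l. c * two_form_eval a (p k) (p l))"
    using linear_mapsD(3)[OF two_form_eval_linear] smult
    by (intro wedge_sum_cong K \<phi>) (simp_all add: p power_subspaceD(1))
  also have "\<dots> = c \<odot>\<^bsub>\<Lambda>\<^esub> (2 \<odot>\<^bsub>\<Lambda>\<^esub> a)"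
    using smult by (simp add: wedge_sum_smult[OF K \<phi>])
  also have "\<dots> = 2 \<odot>\<^bsub>\<Lambda>\<^esub> (c \<odot>\<^bsub>\<Lambda>\<^esub> a)"
    using smult(1) by (simp add: power_subspaceD(1) mult.commute flip: \<Lambda>.smult_assoc)
  finally show ?case ..
qed

lemma two_form_eqI:
  assumes "\<theta> \<in> forms 2" "\<theta>' \<in> forms 2"
    and "\<And>x y. \<lbrakk>x \<in> X; y \<in> X\<rbrakk> \<Longrightarrow> two_form_eval \<theta> x y = two_form_eval \<theta>' x y"
  shows "\<theta> = \<theta>'"
proof -
  have half: "\<theta> = (1/2) \<odot>\<^bsub>\<Lambda>\<^esub> wedge_sum K \<phi> (\<lambda>k l. two_form_eval \<theta> (p k) (p l))" if "\<theta> \<in> forms 2" for \<theta>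
  proof -
    have "(1/2) \<odot>\<^bsub>\<Lambda>\<^esub> (2 \<odot>\<^bsub>\<Lambda>\<^esub> \<theta>) = \<theta>"
      using that by (simp add: power_subspaceD(1) flip: \<Lambda>.smult_assoc)
    then show ?thesis
      using two_form_expansion[OF that] by simp
  qed
  have "wedge_sum K \<phi> (\<lambda>k l. two_form_eval \<theta> (p k) (p l)) =
      wedge_sum K \<phi> (\<lambda>k l. two_form_eval \<theta>' (p k) (p l))"
    by (intro wedge_sum_cong K \<phi>) (simp_all add: p assms)
  then show ?thesis
    using half[OF assms(1)] half[OF assms(2)] by simp
qed

end


section \<open>Dual spaces and the Chevalley-Eilenberg differential\<close>

lemma func_space_simps:
  "carrier (ring.func_space real_field S) = S \<rightarrow>\<^sub>E UNIV"
  "zero (ring.func_space real_field S) = (\<lambda>x\<in>S. 0)"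
  "add (ring.func_space real_field S) = (\<lambda>f g. \<lambda>x\<in>S. f x + g x)"
  "smult (ring.func_space real_field S) = (\<lambda>c f. \<lambda>x\<in>S. c * f x)"
  by (simp_all add: class_ring.func_space_def)

lemma func_space_real_space: "real_space (ring.func_space real_field S)"
  using class_cring.func_space_is_module by (simp add: real_space_iff_module)

lemma dual_space_simps:
  "zero (dual_space M) = (\<lambda>x\<in>carrier M. 0)"
  "add (dual_space M) = (\<lambda>f g. \<lambda>x\<in>carrier M. f x + g x)"
  "smult (dual_space M) = (\<lambda>c f. \<lambda>x\<in>carrier M. c * f x)"
  by (simp_all add: dual_space_def func_space_simps)

lemma dual_space_carrier_iff:
  "\<phi> \<in> carrier (dual_space M) \<longleftrightarrow> \<phi> \<in> extensional (carrier M) \<and> \<phi> \<in> linear_maps M real_line"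
  by (auto simp: dual_space_def linear_maps_iff PiE_def)

lemma dual_spaceD:
  assumes "\<phi> \<in> carrier (dual_space M)"
  shows "\<phi> \<in> linear_maps M real_line"
    and "\<lbrakk>x \<in> carrier M; y \<in> carrier M\<rbrakk> \<Longrightarrow> \<phi> (x \<oplus>\<^bsub>M\<^esub> y) = \<phi> x + \<phi> y"
    and "x \<in> carrier M \<Longrightarrow> \<phi> (c \<odot>\<^bsub>M\<^esub> x) = c * \<phi> x"
  using assms linear_mapsD[of \<phi> M real_line] by (auto simp: dual_space_carrier_iff)

lemma dual_space_form_space:
  assumes "real_space M" shows "form_space (dual_space M) (carrier M)"
proof -
  interpret M: real_space M by (rule assms)
  let ?F = "ring.func_space real_field (carrier M)"
  have "dual_space M = ?F\<lparr>carrier := carrier (dual_space M)\<rparr>"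
    by (simp add: dual_space_def)
  moreover have "real_subspace (carrier (dual_space M)) ?F"
    by (rule real_space.real_subspaceI[OF func_space_real_space])
      (auto simp: dual_space_carrier_iff func_space_simps linear_maps_iff PiE_def algebra_simps)
  ultimately have "real_space (dual_space M)"
    using real_subspace_is_real_space[OF func_space_real_space] by metis
  then show ?thesis
    by (intro form_space.intro exterior.intro form_space_axioms.intro)
      (auto simp: dual_space_simps)
qed

text \<open>
  The frame makes the differential unique, since a two-form on a framed space is determined by its
  values. The map \<open>\<delta>\<close> makes it exist: it is a linear choice of two-forms with the values of
  the bracket, that is, the differential on generators.
\<close>

locale ce_data =
  fixes \<gg> :: "('a, 'm) lie_algebra_scheme"
    and K :: "'k set" and p :: "'k \<Rightarrow> 'a" and \<phi> :: "'k \<Rightarrow> 'a \<Rightarrow> real"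
    and \<delta> :: "('a \<Rightarrow> real) \<Rightarrow> (('a \<Rightarrow> real) list \<Rightarrow> real) set"
  assumes frame: "framed_form_space (dual_space \<gg>) (carrier \<gg>) K p \<phi>"
    and \<delta>_linear: "\<delta> \<in> linear_maps (dual_space \<gg>) (cochains \<gg>)"
    and \<delta>_forms: "u \<in> carrier (dual_space \<gg>) \<Longrightarrow> \<delta> u \<in> carrier (ext_power (dual_space \<gg>) 2)"
    and \<delta>_eval: "\<lbrakk>u \<in> carrier (dual_space \<gg>); x \<in> carrier \<gg>; y \<in> carrier \<gg>\<rbrakk> \<Longrightarrow>
      two_form_eval (\<delta> u) x y = u (bracket \<gg> x y)"
begin

sublocale framed_form_space "dual_space \<gg>" "carrier \<gg>" K p \<phi> by (rule frame)

lemma is_ce_differential_iff: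
  "is_ce_differential \<gg> d \<longleftrightarrow>
     odd_derivation d \<and> d \<in> extensional (carrier \<Lambda>) \<and> (\<forall>u\<in>carrier (dual_space \<gg>). d (\<iota> u) = \<delta> u)"
proof
  assume "is_ce_differential \<gg> d"
  then show "odd_derivation d \<and> d \<in> extensional (carrier \<Lambda>) \<and> (\<forall>u\<in>carrier (dual_space \<gg>). d (\<iota> u) = \<delta> u)"
    unfolding is_ce_differential_def odd_derivation_def
    using two_form_eqI[OF _ \<delta>_forms] by (simp add: \<delta>_eval)
next
  assume "odd_derivation d \<and> d \<in> extensional (carrier \<Lambda>) \<and> (\<forall>u\<in>carrier (dual_space \<gg>). d (\<iota> u) = \<delta> u)"
  then show "is_ce_differential \<gg> d"
    unfolding is_ce_differential_def odd_derivation_def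
    by (auto simp: \<delta>_forms \<delta>_eval)
qed

lemma ce_differential_odd_derivation: "odd_derivation (ce_differential \<gg>)"
  and ce_differential_incl: "u \<in> carrier (dual_space \<gg>) \<Longrightarrow> ce_differential \<gg> (\<iota> u) = \<delta> u"
proof -
  obtain d where d: "is_ce_differential \<gg> d"
    using odd_derivation_exists[OF \<delta>_linear \<delta>_forms] unfolding is_ce_differential_iff by blast
  have "is_ce_differential \<gg> (ce_differential \<gg>)"
    unfolding ce_differential_def
  proof (rule theI[of _ d])
    show "d' = d" if "is_ce_differential \<gg> d'" for d'
    proof (rule extensionalityI[of _ "carrier \<Lambda>"])
      show "d' a = d a" if "a \<in> carrier \<Lambda>" for a
        by (rule odd_derivation_eqI[OF _ _ _ that])
          (use \<open>is_ce_differential \<gg> d'\<close> d in \<open>auto simp: is_ce_differential_iff\<close>)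
    qed (use that d in \<open>auto simp: is_ce_differential_iff\<close>)
  qed (rule d)
  then show "odd_derivation (ce_differential \<gg>)"
    and "u \<in> carrier (dual_space \<gg>) \<Longrightarrow> ce_differential \<gg> (\<iota> u) = \<delta> u"
    by (auto simp: is_ce_differential_iff)
qed

lemmas ce_differential_linear = odd_derivation_linear[OF ce_differential_odd_derivation]

end


section \<open>The Lie algebra of a graph\<close>

lemma vertex_space_simps:
  "carrier (vertex_space V) = V \<rightarrow>\<^sub>E UNIV" "zero (vertex_space V) = (\<lambda>x\<in>V. 0)"
  "add (vertex_space V) = (\<lambda>f g. \<lambda>x\<in>V. f x + g x)"
  "smult (vertex_space V) = (\<lambda>c f. \<lambda>x\<in>V. c * f x)"
  by (simp_all add: vertex_space_def func_space_simps)

lemma vertex_vector_closed: "vertex_vector V i \<in> carrier (vertex_space V)"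
  by (simp add: vertex_space_simps vertex_vector_def)

lemma vertex_space_form_space: "form_space (vertex_space V) V"
  using func_space_real_space[of V]
  by (intro form_space.intro exterior.intro form_space_axioms.intro)
    (auto simp: vertex_space_simps simp flip: vertex_space_def)

lemma vertex_space_framed:
  assumes "finite V"
  shows "framed_form_space (vertex_space V) V V (\<lambda>i. i) (vertex_vector V)"
proof (intro framed_form_space.intro framed_form_space_axioms.intro vertex_space_form_space assms)
  interpret form_space "vertex_space V" V by (rule vertex_space_form_space)
  fix u assume u: "u \<in> carrier (vertex_space V)"
  let ?s = "\<Oplus>\<^bsub>vertex_space V\<^esub>k\<in>V. u k \<odot>\<^bsub>vertex_space V\<^esub> vertex_vector V k"
  have "u x = ?s x" if x: "x \<in> V" for x
  proof -
    have "(\<lambda>v. v x) \<in> linear_maps (vertex_space V) real_line"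
      by (rule linear_mapsI) (simp_all add: eval_add eval_smult x)
    then have "?s x = (\<Sum>k\<in>V. (u k \<odot>\<^bsub>vertex_space V\<^esub> vertex_vector V k) x)"
      using assms by (intro linear_functional_finsum[OF real_space_axioms]) (auto simp: vertex_vector_closed)
    also have "\<dots> = (\<Sum>k\<in>V. if k = x then u x else 0)"
      using x by (intro sum.cong) (auto simp: vertex_space_simps vertex_vector_def)
    also have "\<dots> = u x"
      using x assms by simp
    finally show ?thesis ..
  qed
  moreover have "?s \<in> carrier (vertex_space V)"
    by (intro finsum_closed) (auto simp: vertex_vector_closed)
  ultimately show "u = ?s"
    using u unfolding vertex_space_simps by (intro PiE_ext)
qed (simp_all add: vertex_vector_closed)

locale graph =
  fixes V :: "'v set" and E :: "'v set set"
  assumes finite_V: "finite V" and edges: "E \<subseteq> nsets V 2"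
begin

abbreviation "VV \<equiv> vertex_space V"
abbreviation "e \<equiv> vertex_vector V"
abbreviation "\<LL> \<equiv> dani_mainkar V E"

sublocale VV: framed_form_space VV V V "\<lambda>i. i" e
  by (rule vertex_space_framed[OF finite_V])

abbreviation "W \<equiv> non_edge_space V E"
abbreviation "\<ZZ> \<equiv> quot_module (ext_power VV 2) W"

lemma edgeD: "{i, j} \<in> E \<Longrightarrow> i \<in> V \<and> j \<in> V \<and> i \<noteq> j"
  using edges by (force simp: nsets_def)

lemma W_generators: "{ext_wedge VV [e i, e j] | i j. i \<in> V \<and> j \<in> V \<and> {i, j} \<notin> E} \<subseteq> VV.forms 2"
  by (auto intro!: VV.incl_incl_in_power simp: vertex_vector_closed)

sublocale P2: real_space "ext_power VV 2" by (rule VV.ext_power_real_space)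

sublocale W: real_quotient "ext_power VV 2" W
  by (intro real_quotient.intro real_quotient_axioms.intro P2.real_space_axioms)
    (unfold non_edge_space_def, rule P2.span_is_real_subspace[OF W_generators])

sublocale Z: real_space \<ZZ> by (rule W.quotient_real_space)

lemma \<ZZ>_zero: "zero \<ZZ> = W"
  by (simp add: quot_module_simps)

lemma dani_mainkar_simps:
  "carrier \<LL> = carrier VV \<times> carrier \<ZZ>" "zero \<LL> = (\<zero>\<^bsub>VV\<^esub>, \<zero>\<^bsub>\<ZZ>\<^esub>)"
  "add \<LL> = (\<lambda>p q. (fst p \<oplus>\<^bsub>VV\<^esub> fst q, snd p \<oplus>\<^bsub>\<ZZ>\<^esub> snd q))"
  "smult \<LL> = (\<lambda>c p. (c \<odot>\<^bsub>VV\<^esub> fst p, c \<odot>\<^bsub>\<ZZ>\<^esub> snd p))"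
  "bracket \<LL> = (\<lambda>p q. (\<zero>\<^bsub>VV\<^esub>, W.proj (ext_wedge VV [fst p, fst q])))"
  by (simp_all add: dani_mainkar_def module.defs lie_algebra.defs direct_sum_def)

sublocale L: real_space \<LL>
proof -
  have "abelian_group \<LL>"
  proof (rule abelian_groupI)
    fix x assume "x \<in> carrier \<LL>"
    then show "\<exists>y\<in>carrier \<LL>. y \<oplus>\<^bsub>\<LL>\<^esub> x = \<zero>\<^bsub>\<LL>\<^esub>"
      by (intro bexI[of _ "(\<ominus>\<^bsub>VV\<^esub> fst x, \<ominus>\<^bsub>\<ZZ>\<^esub> snd x)"])
        (auto simp: dani_mainkar_simps VV.l_neg Z.l_neg)
  qed (auto simp: dani_mainkar_simps VV.a_ac Z.a_ac)
  then show "real_space \<LL>"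
    by (rule real_space.intro)
      (auto intro!: real_space_axioms.intro simp: dani_mainkar_simps VV.smult_l_distr
        VV.smult_r_distr VV.smult_assoc Z.smult_l_distr Z.smult_r_distr Z.smult_assoc)
qed

sublocale D: form_space "dual_space \<LL>" "carrier \<LL>"
  by (rule dual_space_form_space[OF L.real_space_axioms])

lemma central_inject: "z \<in> carrier \<ZZ> \<Longrightarrow> (\<zero>\<^bsub>VV\<^esub>, z) \<in> carrier \<LL>"
  by (simp add: dani_mainkar_simps)

lemma wedge_in_forms: "\<lbrakk>v \<in> carrier VV; w \<in> carrier VV\<rbrakk> \<Longrightarrow> ext_wedge VV [v, w] \<in> VV.forms 2"
  using VV.wedge_in_power[of "[v, w]" 2] by simp

lemma W_proj_closed: "\<theta> \<in> VV.forms 2 \<Longrightarrow> W.proj \<theta> \<in> carrier \<ZZ>"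
  by (simp add: quot_module_simps)

lemma bracket_closed: "\<lbrakk>p \<in> carrier \<LL>; q \<in> carrier \<LL>\<rbrakk> \<Longrightarrow> bracket \<LL> p q \<in> carrier \<LL>"
  by (auto simp: dani_mainkar_simps simp del: VV.ext_wedge_Cons intro!: W_proj_closed wedge_in_forms)

text \<open>The generator of the Lie algebra given by a vertex.\<close>

definition X where
  "X i = (e i, \<zero>\<^bsub>\<ZZ>\<^esub>)"

lemma X_closed: "X i \<in> carrier \<LL>"
  by (simp add: X_def dani_mainkar_simps vertex_vector_closed)

lemma bracket_X: "bracket \<LL> (X i) (X j) = (\<zero>\<^bsub>VV\<^esub>, W.proj (ext_wedge VV [e i, e j]))"
  by (simp add: dani_mainkar_simps X_def)

lemma bracket_X_non_edge:
  assumes "i \<in> V" "j \<in> V" "{i, j} \<notin> E" shows "bracket \<LL> (X i) (X j) = \<zero>\<^bsub>\<LL>\<^esub>"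
proof -
  have "ext_wedge VV [e i, e j] \<in> W"
    unfolding non_edge_space_def
    by (rule P2.span_superset[OF W_generators]) (use assms in blast)
  then have "W.proj (ext_wedge VV [e i, e j]) = W"
    by (rule iffD2[OF W.proj_eq_zero_iff[OF wedge_in_forms[OF vertex_vector_closed vertex_vector_closed]]])
  then show ?thesis
    by (simp only: bracket_X dani_mainkar_simps(2) \<ZZ>_zero)
qed

lemma functional_vertex_expansion:
  assumes h: "h \<in> linear_maps VV real_line" and v: "v \<in> carrier VV"
  shows "h v = (\<Sum>i\<in>V. v i * h (e i))"
proof -
  have "h (\<Oplus>\<^bsub>VV\<^esub>i\<in>V. v i \<odot>\<^bsub>VV\<^esub> e i) = (\<Sum>i\<in>V. h (v i \<odot>\<^bsub>VV\<^esub> e i))"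
    by (rule linear_functional_finsum[OF VV.real_space_axioms h finite_V]) (simp add: vertex_vector_closed)
  then show ?thesis
    using VV.frame[OF v] linear_mapsD(3)[OF h vertex_vector_closed] by simp
qed

text \<open>
  Apply the functional to the expansion of \<open>\<theta>\<close> in the frame of vertex vectors. The factor 2 is
  that of the expansion.
\<close>

lemma functional_central_expansion:
  assumes u: "u \<in> carrier (dual_space \<LL>)" and \<theta>: "\<theta> \<in> VV.forms 2"
  shows "2 * u (\<zero>\<^bsub>VV\<^esub>, W.proj \<theta>) =
    (\<Sum>i\<in>V. \<Sum>j\<in>V. two_form_eval \<theta> i j * u (bracket \<LL> (X i) (X j)))"
proof -
  define h where "h = (\<lambda>\<theta>. u (\<zero>\<^bsub>VV\<^esub>, W.proj \<theta>))"
  note uD = dual_spaceD[OF u]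
  note WD = linear_mapsD[OF W.proj_linear]
  have h: "h \<in> linear_maps (ext_power VV 2) real_line"
  proof (rule linear_mapsI)
    fix \<theta> \<theta>' assume "\<theta> \<in> VV.forms 2" "\<theta>' \<in> VV.forms 2"
    then show "h (\<theta> \<oplus>\<^bsub>ext_power VV 2\<^esub> \<theta>') = h \<theta> \<oplus>\<^bsub>real_line\<^esub> h \<theta>'"
      using uD(2)[OF central_inject central_inject, of "W.proj \<theta>" "W.proj \<theta>'"]
      by (simp add: h_def WD dani_mainkar_simps)
  next
    fix c \<theta> assume "\<theta> \<in> VV.forms 2"
    then show "h (c \<odot>\<^bsub>ext_power VV 2\<^esub> \<theta>) = c \<odot>\<^bsub>real_line\<^esub> h \<theta>"
      using uD(3)[OF central_inject, of "W.proj \<theta>" c]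
      by (simp add: h_def WD dani_mainkar_simps)
  qed simp
  have "2 * h \<theta> = h (2 \<odot>\<^bsub>VV.\<Lambda>\<^esub> \<theta>)"
    using linear_mapsD(3)[OF h \<theta>] by (simp add: VV.ext_power_simps)
  also have "\<dots> = h (VV.wedge_sum V e (two_form_eval \<theta>))"
    by (simp add: VV.two_form_expansion[OF \<theta>])
  also have "\<dots> = (\<Sum>i\<in>V. \<Sum>j\<in>V. two_form_eval \<theta> i j * h (ext_wedge VV [e i, e j]))"
    by (subst VV.linear_map_forms_wedge_sum[OF finite_V _ real_line_space h])
      (simp_all add: vertex_vector_closed)
  also have "\<dots> = (\<Sum>i\<in>V. \<Sum>j\<in>V. two_form_eval \<theta> i j * u (bracket \<LL> (X i) (X j)))"
    by (simp only: h_def bracket_X)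
  finally show ?thesis
    by (simp add: h_def)
qed


subsection \<open>Coordinates\<close>

text \<open>
  Linear coordinates on the Lie algebra: those of the vertices, and those of the oriented edges,
  which descend to the quotient since two-forms in the span of the non-edges have no value on edges.
\<close>

definition coord where
  "coord i = (\<lambda>p\<in>carrier \<LL>. fst p i)"

definition edge_coord where
  "edge_coord i j = (\<lambda>p\<in>carrier \<LL>. the_elem ((\<lambda>\<theta>. two_form_eval \<theta> i j) ` snd p))"

lemma forms_eval_linear:
  assumes "i \<in> V" "j \<in> V"
  shows "(\<lambda>\<theta>. two_form_eval \<theta> i j) \<in> linear_maps (ext_power VV 2) real_line"
  using linear_mapsD[OF VV.two_form_eval_linear[OF assms]] VV.power_subspaceD(1)
  by (intro linear_mapsI) (simp_all add: VV.ext_power_simps(2-))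

lemma two_form_eval_vertex_vectors:
  assumes "i \<in> V" "j \<in> V"
  shows "two_form_eval (ext_wedge VV [e a, e b]) i j =
    of_bool (i = a \<and> j = b) - of_bool (j = a \<and> i = b)"
proof -
  have "ext_wedge VV [e a, e b] = VV.\<iota> (e a) \<otimes>\<^bsub>VV.\<Lambda>\<^esub> VV.\<iota> (e b)"
    by (simp add: vertex_vector_closed)
  then have "two_form_eval (ext_wedge VV [e a, e b]) i j = e a i * e b j - e a j * e b i"
    using VV.two_form_eval_wedge[OF assms vertex_vector_closed vertex_vector_closed] by simp
  also have "\<dots> = of_bool (i = a \<and> j = b) - of_bool (j = a \<and> i = b)"
    unfolding vertex_vector_def restrict_apply'[OF assms(1)] restrict_apply'[OF assms(2)]
      of_bool_def[symmetric] of_bool_conj ..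
  finally show ?thesis .
qed

lemma two_form_eval_non_edge_space:
  assumes ij: "{i, j} \<in> E" and \<theta>: "\<theta> \<in> W" shows "two_form_eval \<theta> i j = 0"
proof -
  have i: "i \<in> V" "j \<in> V"
    using edgeD[OF ij] by auto
  note lin = forms_eval_linear[OF i]
  show ?thesis
    using \<theta>[unfolded non_edge_space_def] W_generators
  proof (induction rule: P2.span_induct)
    case (base \<theta>)
    then obtain a b where ab: "\<theta> = ext_wedge VV [e a, e b]" "{a, b} \<notin> E"
      by (elim CollectE exE conjE) (rule that)
    then show ?case
      using ij by (auto simp: two_form_eval_vertex_vectors[OF i] insert_commute simp del: VV.ext_wedge_Cons)
  next
    case zero
    then show ?case
      using linear_map_zero[OF P2.real_space_axioms real_line_space lin] by simp
  qed (simp_all add: linear_mapsD[OF lin])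
qed

lemma coord_closed: "i \<in> V \<Longrightarrow> coord i \<in> carrier (dual_space \<LL>)"
  by (auto simp: coord_def dual_space_carrier_iff linear_maps_iff dani_mainkar_simps(1,3,4)
      VV.eval_add VV.eval_smult split: if_splits)

lemma coord_apply: "p \<in> carrier \<LL> \<Longrightarrow> coord i p = fst p i"
  by (simp add: coord_def)

lemma edge_coord_proj:
  assumes "{i, j} \<in> E" "v \<in> carrier VV" "\<theta> \<in> VV.forms 2"
  shows "edge_coord i j (v, W.proj \<theta>) = two_form_eval \<theta> i j"
proof -
  have "the_elem ((\<lambda>\<theta>. two_form_eval \<theta> i j) ` W.proj \<theta>) = two_form_eval \<theta> i j"
    using assms edgeD[OF assms(1)]
    by (intro W.quotient_linear_map(2)[OF real_line_space forms_eval_linear])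
      (auto simp: two_form_eval_non_edge_space)
  then show ?thesis
    using assms W_proj_closed by (simp add: edge_coord_def dani_mainkar_simps)
qed

lemma edge_coord_closed:
  assumes "{i, j} \<in> E" shows "edge_coord i j \<in> carrier (dual_space \<LL>)"
proof -
  have "(\<lambda>Z. the_elem ((\<lambda>\<theta>. two_form_eval \<theta> i j) ` Z)) \<in> linear_maps \<ZZ> real_line"
    using assms edgeD[OF assms(1)]
    by (intro W.quotient_linear_map(1)[OF real_line_space forms_eval_linear])
      (auto simp: two_form_eval_non_edge_space)
  note lin = linear_mapsD[OF this]
  have "edge_coord i j \<in> linear_maps \<LL> real_line"
  proof (rule linear_mapsI)
    fix p q assume "p \<in> carrier \<LL>" "q \<in> carrier \<LL>"
    then show "edge_coord i j (p \<oplus>\<^bsub>\<LL>\<^esub> q) = edge_coord i j p \<oplus>\<^bsub>real_line\<^esub> edge_coord i j q"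
      using L.a_closed[of p q] lin(2) by (auto simp: edge_coord_def dani_mainkar_simps)
  next
    fix c p assume "p \<in> carrier \<LL>"
    then show "edge_coord i j (c \<odot>\<^bsub>\<LL>\<^esub> p) = c \<odot>\<^bsub>real_line\<^esub> edge_coord i j p"
      using L.smult_closed[of p c] lin(3) by (auto simp: edge_coord_def dani_mainkar_simps)
  qed simp
  then show ?thesis
    by (simp add: dual_space_carrier_iff edge_coord_def)
qed

lemma edge_coord_bracket:
  assumes "{i, j} \<in> E" "p \<in> carrier \<LL>" "q \<in> carrier \<LL>"
  shows "edge_coord i j (bracket \<LL> p q) = fst p i * fst q j - fst p j * fst q i"
proof -
  have pq: "fst p \<in> carrier VV" "fst q \<in> carrier VV"
    using assms by (auto simp: dani_mainkar_simps)
  have "edge_coord i j (bracket \<LL> p q) = two_form_eval (ext_wedge VV [fst p, fst q]) i j"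
    unfolding dani_mainkar_simps(5)
    by (intro edge_coord_proj assms wedge_in_forms pq VV.zero_closed)
  then show ?thesis
    using edgeD[OF assms(1)] pq by (simp add: VV.two_form_eval_wedge)
qed

definition edge_pairs :: "('v \<times> 'v) set" where "edge_pairs = {(i, j). {i, j} \<in> E}"

lemma edge_pairs_subset: "edge_pairs \<subseteq> V \<times> V"
  using edgeD by (auto simp: edge_pairs_def)

text \<open>
  Split a vector into its vertex part and its central part; on the latter, non-edges contribute
  nothing because their brackets vanish.
\<close>

lemma functional_expansion:
  assumes u: "u \<in> carrier (dual_space \<LL>)" and p: "p \<in> carrier \<LL>"
  shows "u p = (\<Sum>i\<in>V. u (X i) * coord i p) +
    (\<Sum>(i, j)\<in>edge_pairs. u (bracket \<LL> (X i) (X j)) * (edge_coord i j p / 2))"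
proof -
  obtain v z where p': "p = (v, z)" "v \<in> carrier VV" "z \<in> carrier \<ZZ>"
    using p by (auto simp: dani_mainkar_simps)
  then obtain \<theta> where \<theta>: "\<theta> \<in> VV.forms 2" "z = W.proj \<theta>"
    by (auto simp: quot_module_simps)
  note uD = dual_spaceD[OF u]
  have inj: "(v, \<zero>\<^bsub>\<ZZ>\<^esub>) \<in> carrier \<LL>" if "v \<in> carrier VV" for v
    using that by (simp add: dani_mainkar_simps)
  have "p = (v, \<zero>\<^bsub>\<ZZ>\<^esub>) \<oplus>\<^bsub>\<LL>\<^esub> (\<zero>\<^bsub>VV\<^esub>, z)"
    using p' by (simp add: dani_mainkar_simps)
  then have "u p = u (v, \<zero>\<^bsub>\<ZZ>\<^esub>) + u (\<zero>\<^bsub>VV\<^esub>, z)"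
    using uD(2)[OF inj central_inject] p' by simp
  moreover have "u (v, \<zero>\<^bsub>\<ZZ>\<^esub>) = (\<Sum>i\<in>V. u (X i) * coord i p)"
  proof -
    have "(\<lambda>v. u (v, \<zero>\<^bsub>\<ZZ>\<^esub>)) \<in> linear_maps VV real_line"
    proof (rule linear_mapsI)
      fix v w assume "v \<in> carrier VV" "w \<in> carrier VV"
      then show "u (v \<oplus>\<^bsub>VV\<^esub> w, \<zero>\<^bsub>\<ZZ>\<^esub>) = u (v, \<zero>\<^bsub>\<ZZ>\<^esub>) \<oplus>\<^bsub>real_line\<^esub> u (w, \<zero>\<^bsub>\<ZZ>\<^esub>)"
        using uD(2)[OF inj inj, of v w] by (simp add: dani_mainkar_simps)
    next
      fix c v assume "v \<in> carrier VV"
      then show "u (c \<odot>\<^bsub>VV\<^esub> v, \<zero>\<^bsub>\<ZZ>\<^esub>) = c \<odot>\<^bsub>real_line\<^esub> u (v, \<zero>\<^bsub>\<ZZ>\<^esub>)"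
        using uD(3)[OF inj, of v c] by (simp add: dani_mainkar_simps)
    qed simp
    from functional_vertex_expansion[OF this p'(2)] show ?thesis
      using p p' by (simp add: X_def coord_def mult.commute)
  qed
  moreover have "u (\<zero>\<^bsub>VV\<^esub>, z) =
      (\<Sum>(i, j)\<in>edge_pairs. u (bracket \<LL> (X i) (X j)) * (edge_coord i j p / 2))"
  proof -
    have "2 * u (\<zero>\<^bsub>VV\<^esub>, z) =
        (\<Sum>(i, j)\<in>V \<times> V. two_form_eval \<theta> i j * u (bracket \<LL> (X i) (X j)))"
      using functional_central_expansion[OF u \<theta>(1)] by (simp add: \<theta>(2) sum.cartesian_product)
    also have "\<dots> = (\<Sum>(i, j)\<in>edge_pairs. u (bracket \<LL> (X i) (X j)) * edge_coord i j p)"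
    proof (rule sum.mono_neutral_cong_right)
      have "u \<zero>\<^bsub>\<LL>\<^esub> = 0"
        using linear_map_zero[OF L.real_space_axioms real_line_space uD(1)] by simp
      moreover have "bracket \<LL> (X i) (X j) = \<zero>\<^bsub>\<LL>\<^esub>" if "(i, j) \<in> V \<times> V - edge_pairs" for i j
        using that by (intro bracket_X_non_edge) (auto simp: edge_pairs_def)
      ultimately show "\<forall>x\<in>V \<times> V - edge_pairs.
          (case x of (i, j) \<Rightarrow> two_form_eval \<theta> i j * u (bracket \<LL> (X i) (X j))) = 0"
        by fastforce
      show "(case x of (i, j) \<Rightarrow> two_form_eval \<theta> i j * u (bracket \<LL> (X i) (X j))) =
          (case x of (i, j) \<Rightarrow> u (bracket \<LL> (X i) (X j)) * edge_coord i j p)"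
        if "x \<in> edge_pairs" for x
        using that p' \<theta> by (auto simp: edge_pairs_def edge_coord_proj)
    qed (use finite_V edge_pairs_subset in auto)
    finally show ?thesis
      by (simp add: sum_divide_distrib[symmetric] case_prod_unfold)
  qed
  ultimately show ?thesis
    by simp
qed

definition frame_index :: "('v + 'v \<times> 'v) set" where
  "frame_index = Inl ` V \<union> Inr ` edge_pairs"

definition frame_point where
  "frame_point k = (case k of Inl i \<Rightarrow> X i | Inr (i, j) \<Rightarrow> bracket \<LL> (X i) (X j))"

text \<open>The factors \<open>1/2\<close> account for each edge being counted with both orientations.\<close>

definition frame_form where
  "frame_form k =
    (case k of Inl i \<Rightarrow> coord i | Inr (i, j) \<Rightarrow> (1/2) \<odot>\<^bsub>dual_space \<LL>\<^esub> edge_coord i j)"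

lemma frame_form_closed: "k \<in> frame_index \<Longrightarrow> frame_form k \<in> carrier (dual_space \<LL>)"
  by (auto simp: frame_index_def frame_form_def edge_pairs_def coord_closed edge_coord_closed)

lemma dual_space_framed:
  "framed_form_space (dual_space \<LL>) (carrier \<LL>) frame_index frame_point frame_form"
proof (intro framed_form_space.intro framed_form_space_axioms.intro D.form_space_axioms)
  have fin: "finite edge_pairs"
    using edge_pairs_subset finite_V by (auto intro: finite_subset)
  then show fin_index: "finite frame_index"
    using finite_V by (simp add: frame_index_def)
  show "frame_point k \<in> carrier \<LL>" if "k \<in> frame_index" for k
    using that by (auto simp: frame_index_def frame_point_def X_closed intro!: bracket_closed)
  show "frame_form k \<in> carrier (dual_space \<LL>)" if "k \<in> frame_index" for k
    using that by (rule frame_form_closed)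
  fix u assume u: "u \<in> carrier (dual_space \<LL>)"
  let ?s = "\<Oplus>\<^bsub>dual_space \<LL>\<^esub>k\<in>frame_index. u (frame_point k) \<odot>\<^bsub>dual_space \<LL>\<^esub> frame_form k"
  have s: "?s \<in> carrier (dual_space \<LL>)"
    by (intro D.finsum_closed) (auto simp: frame_form_closed)
  show "u = ?s"
  proof (rule extensionalityI[of _ "carrier \<LL>"])
    fix p assume p: "p \<in> carrier \<LL>"
    have "(\<lambda>v. v p) \<in> linear_maps (dual_space \<LL>) real_line"
      by (rule linear_mapsI) (simp_all add: D.eval_add D.eval_smult p)
    then have "?s p = (\<Sum>k\<in>frame_index. (u (frame_point k) \<odot>\<^bsub>dual_space \<LL>\<^esub> frame_form k) p)"
      using fin_index by (intro linear_functional_finsum[OF D.real_space_axioms]) (auto simp: frame_form_closed)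
    also have "\<dots> = (\<Sum>k\<in>frame_index. u (frame_point k) * frame_form k p)"
      using p by (intro sum.cong refl) (simp add: D.eval_smult frame_form_closed)
    also have "\<dots> = (\<Sum>i\<in>V. u (frame_point (Inl i)) * frame_form (Inl i) p) +
        (\<Sum>x\<in>edge_pairs. u (frame_point (Inr x)) * frame_form (Inr x) p)"
      unfolding frame_index_def using fin finite_V
      by (subst sum.union_disjoint) (auto simp: sum.reindex)
    also have "\<dots> = (\<Sum>i\<in>V. u (X i) * coord i p) +
        (\<Sum>(i, j)\<in>edge_pairs. u (bracket \<LL> (X i) (X j)) * (edge_coord i j p / 2))"
      using p edge_coord_closed
      by (intro arg_cong2[of _ _ _ _ "(+)"] sum.cong refl)
        (auto simp: frame_point_def frame_form_def edge_pairs_def D.eval_smult)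
    finally show "u p = ?s p"
      using functional_expansion[OF u p] by simp
  qed (use u s in \<open>auto simp: dual_space_carrier_iff\<close>)
qed


subsection \<open>The differential\<close>

text \<open>
  The differential of \<open>u\<close> has the coefficient \<open>u [X i, X j]\<close> at \<open>x\<^sub>i \<and> x\<^sub>j\<close>; the sum runs over
  all ordered pairs, whence the factor \<open>1/2\<close>.
\<close>

definition \<delta> where
  "\<delta> u = D.wedge_sum V coord (\<lambda>i j. 1/2 * u (bracket \<LL> (X i) (X j)))"

sublocale CE: ce_data \<LL> frame_index frame_point frame_form \<delta>
proof (intro ce_data.intro dual_space_framed)
  show "\<delta> \<in> linear_maps (dual_space \<LL>) (cochains \<LL>)"
  proof (rule linear_mapsI)
    fix u v assume "u \<in> carrier (dual_space \<LL>)" "v \<in> carrier (dual_space \<LL>)"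
    then show "\<delta> (u \<oplus>\<^bsub>dual_space \<LL>\<^esub> v) = \<delta> u \<oplus>\<^bsub>cochains \<LL>\<^esub> \<delta> v"
      unfolding \<delta>_def
      by (subst D.wedge_sum_add[OF finite_V coord_closed, symmetric])
        (auto intro!: D.wedge_sum_cong[OF finite_V coord_closed]
          simp: D.eval_add bracket_closed X_closed distrib_left add_divide_distrib)
  next
    fix c u assume "u \<in> carrier (dual_space \<LL>)"
    then show "\<delta> (c \<odot>\<^bsub>dual_space \<LL>\<^esub> u) = c \<odot>\<^bsub>cochains \<LL>\<^esub> \<delta> u"
      unfolding \<delta>_def
      by (subst D.wedge_sum_smult[OF finite_V coord_closed, symmetric])
        (auto intro!: D.wedge_sum_cong[OF finite_V coord_closed]
          simp: D.eval_smult bracket_closed X_closed)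
  qed (simp add: \<delta>_def D.wedge_sum_closed[OF finite_V coord_closed])
  show "\<delta> u \<in> carrier (ext_power (dual_space \<LL>) 2)" for u
    unfolding \<delta>_def by (rule D.wedge_sum_in_forms[OF finite_V coord_closed])
  fix u p q assume u: "u \<in> carrier (dual_space \<LL>)" and p: "p \<in> carrier \<LL>" and q: "q \<in> carrier \<LL>"
  have pq: "fst p \<in> carrier VV" "fst q \<in> carrier VV"
    using p q by (auto simp: dani_mainkar_simps)
  have "two_form_eval (\<delta> u) p q = (\<Sum>i\<in>V. \<Sum>j\<in>V. 1/2 * u (bracket \<LL> (X i) (X j)) *
      two_form_eval (D.\<iota> (coord i) \<otimes>\<^bsub>cochains \<LL>\<^esub> D.\<iota> (coord j)) p q)"
    unfolding \<delta>_def
    using D.linear_map_wedge_sum[OF finite_V coord_closed real_line_space D.two_form_eval_linear[OF p q]]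
    by simp
  also have "\<dots> = (\<Sum>i\<in>V. \<Sum>j\<in>V. two_form_eval (ext_wedge VV [fst p, fst q]) i j *
      u (bracket \<LL> (X i) (X j))) / 2"
    unfolding sum_divide_distrib
    by (intro sum.cong refl)
      (simp add: D.two_form_eval_wedge VV.two_form_eval_wedge coord_closed p q pq coord_apply)
  also have "\<dots> = u (bracket \<LL> p q)"
    using functional_central_expansion[OF u wedge_in_forms[OF pq]]
    by (simp only: dani_mainkar_simps(5))
  finally show "two_form_eval (\<delta> u) p q = u (bracket \<LL> p q)" .
qed

abbreviation "d \<equiv> ce_differential \<LL>"

lemma d_coord: assumes "i \<in> V" shows "d (D.\<iota> (coord i)) = \<zero>\<^bsub>cochains \<LL>\<^esub>"
proof -
  have "\<delta> (coord i) = D.wedge_sum V coord (\<lambda>i j. 0)"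
    unfolding \<delta>_def using bracket_closed[OF X_closed X_closed] assms
    by (intro D.wedge_sum_cong[OF finite_V coord_closed])
      (auto simp: coord_def dani_mainkar_simps vertex_space_simps)
  then show ?thesis
    using D.wedge_sum_zero[OF finite_V coord_closed] by (simp add: CE.ce_differential_incl coord_closed assms)
qed

text \<open>
  Both sides are two-forms with the same values on pairs of vectors. This is how the edge monomials
  become exact.
\<close>

lemma d_edge_coord:
  assumes "{i, j} \<in> E"
  shows "d (D.\<iota> (edge_coord i j)) = D.\<iota> (coord i) \<otimes>\<^bsub>cochains \<LL>\<^esub> D.\<iota> (coord j)"
  unfolding CE.ce_differential_incl[OF edge_coord_closed[OF assms]]
  using edgeD[OF assms] assms
  by (intro CE.two_form_eqI CE.\<delta>_forms edge_coord_closed D.incl_incl_in_power coord_closed)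
    (simp_all add: CE.\<delta>_eval edge_coord_closed edge_coord_bracket D.two_form_eval_wedge
      coord_closed coord_apply)


subsection \<open>The abelianization\<close>

abbreviation "C \<equiv> commutator_ideal \<LL>"
abbreviation "\<AA> \<equiv> abelianization \<LL>"

lemma brackets_closed:
  "{bracket \<LL> x y | x y. x \<in> carrier \<LL> \<and> y \<in> carrier \<LL>} \<subseteq> carrier \<LL>"
  using bracket_closed by blast

sublocale C: real_quotient \<LL> C
  by (intro real_quotient.intro real_quotient_axioms.intro L.real_space_axioms)
    (unfold commutator_ideal_def, rule L.span_is_real_subspace[OF brackets_closed])

lemmas C_subspaceD = real_subspaceD[OF L.real_space_axioms C.N]

lemma bracket_in_C: "\<lbrakk>x \<in> carrier \<LL>; y \<in> carrier \<LL>\<rbrakk> \<Longrightarrow> bracket \<LL> x y \<in> C"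
  unfolding commutator_ideal_def by (rule L.span_superset[OF brackets_closed]) blast

lemma fst_C: assumes "p \<in> C" shows "fst p = \<zero>\<^bsub>VV\<^esub>"
  using assms[unfolded commutator_ideal_def] brackets_closed
proof (induction rule: L.span_induct)
  case (base b)
  then show ?case by (auto simp: dani_mainkar_simps)
qed (simp_all add: dani_mainkar_simps)

text \<open>
  The central summand is a quotient of the exterior square of the vertex space, which is spanned by
  wedges, and the wedge of \<open>u\<close> and \<open>v\<close> represents their bracket.
\<close>

lemma central_summand_subset_C: assumes "z \<in> carrier \<ZZ>" shows "(\<zero>\<^bsub>VV\<^esub>, z) \<in> C"
proof -
  obtain \<theta> where \<theta>: "\<theta> \<in> VV.forms 2" "z = W.proj \<theta>"
    using assms by (auto simp: quot_module_simps)
  note WD = linear_mapsD[OF W.proj_linear]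
  have "(\<zero>\<^bsub>VV\<^esub>, W.proj \<theta>) \<in> C"
    using \<theta>(1)
  proof (induction rule: VV.power_induct)
    case (wedge w)
    then obtain u v where w: "w = [u, v]" "u \<in> carrier VV" "v \<in> carrier VV"
      by (auto simp: numeral_2_eq_2 length_Suc_conv)
    then have "bracket \<LL> (u, \<zero>\<^bsub>\<ZZ>\<^esub>) (v, \<zero>\<^bsub>\<ZZ>\<^esub>) \<in> C"
      by (intro bracket_in_C) (auto simp: dani_mainkar_simps)
    then show ?case
      by (simp only: dani_mainkar_simps(5) fst_conv w(1))
  next
    case zero
    have "W.proj \<zero>\<^bsub>VV.\<Lambda>\<^esub> = \<zero>\<^bsub>\<ZZ>\<^esub>"
      using linear_map_zero[OF P2.real_space_axioms Z.real_space_axioms W.proj_linear]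
      by (simp add: VV.ext_power_simps)
    then show ?case
      using C_subspaceD(2) by (simp add: dani_mainkar_simps)
  next
    case (add a b)
    then show ?case
      using C_subspaceD(3)[OF add(3,4)] WD(2)[OF add(1,2)]
      by (simp add: dani_mainkar_simps VV.ext_power_simps)
  next
    case (smult c a)
    then show ?case
      using C_subspaceD(4)[OF smult(2), of c] WD(3)[OF smult(1), of c]
      by (simp add: dani_mainkar_simps VV.ext_power_simps)
  qed
  then show ?thesis
    by (simp add: \<theta>(2))
qed

lemma abelianization_simps:
  "carrier \<AA> = C.proj ` carrier \<LL>" "zero \<AA> = C" "add \<AA> = add (quot_module \<LL> C)"
  "smult \<AA> = smult (quot_module \<LL> C)"
  by (simp_all add: abelianization_def module.defs quot_module_simps)

lemma abelianization_bracket: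
  assumes "Y \<in> carrier \<AA>" "Z \<in> carrier \<AA>" shows "bracket \<AA> Y Z = C"
proof -
  obtain y z where yz: "y \<in> carrier \<LL>" "Y = C.proj y" "z \<in> carrier \<LL>" "Z = C.proj z"
    using assms by (auto simp: abelianization_simps)
  have sub: "C.proj x \<subseteq> carrier \<LL>" if "x \<in> carrier \<LL>" for x
    using that C_subspaceD(1) by (auto simp: C.mem_proj_iff)
  have "C.proj (bracket \<LL> y' z') = C" if "y' \<in> Y" "z' \<in> Z" for y' z'
  proof -
    have "y' \<in> carrier \<LL>" "z' \<in> carrier \<LL>"
      using that yz sub by blast+
    then show ?thesis
      using C.proj_eq_zero_iff[OF bracket_closed] bracket_in_C by blast
  qed
  then have "(\<Union>y'\<in>Y. \<Union>z'\<in>Z. C.proj (bracket \<LL> y' z')) = (\<Union>y'\<in>Y. \<Union>z'\<in>Z. C)"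
    by (intro SUP_cong refl)
  also have "\<dots> = C"
    using C.proj_self[OF yz(1)] C.proj_self[OF yz(3)] yz by blast
  finally show ?thesis
    by (simp add: abelianization_def module.defs lie_algebra.defs)
qed

sublocale A: real_space \<AA>
  by (rule real_space_cong[OF C.quotient_real_space])
    (simp_all add: abelianization_simps quot_module_simps)

sublocale DA: form_space "dual_space \<AA>" "carrier \<AA>"
  by (rule dual_space_form_space[OF A.real_space_axioms])

abbreviation "\<pi> \<equiv> abelianization_map \<LL>"

lemma \<pi>_eq_proj: "\<pi> = C.proj"
  by (simp add: abelianization_map_def fun_eq_iff)

lemma \<pi>_linear: "\<pi> \<in> linear_maps \<LL> \<AA>"
  unfolding \<pi>_eq_proj using linear_mapsD[OF C.proj_linear]
  by (intro linear_mapsI) (simp_all add: abelianization_simps)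

definition ab_coord where
  "ab_coord i = (\<lambda>Y\<in>carrier \<AA>. the_elem ((\<lambda>p. fst p i) ` Y))"

lemma fst_linear: "i \<in> V \<Longrightarrow> (\<lambda>p. fst p i) \<in> linear_maps \<LL> real_line"
  by (rule linear_mapsI) (auto simp: dani_mainkar_simps VV.eval_add VV.eval_smult)

lemma ab_coord_closed: assumes "i \<in> V" shows "ab_coord i \<in> carrier (dual_space \<AA>)"
  and ab_coord_proj: "p \<in> carrier \<LL> \<Longrightarrow> ab_coord i (\<pi> p) = fst p i"
proof -
  have 0: "fst p i = \<zero>\<^bsub>real_line\<^esub>" if "p \<in> C" for p
    using fst_C[OF that] assms by (simp add: vertex_space_simps)
  note lin = linear_mapsD[OF C.quotient_linear_map(1)[OF real_line_space fst_linear[OF assms] 0]]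
  have "ab_coord i \<in> linear_maps \<AA> real_line"
    by (rule linear_mapsI)
      (use lin A.a_closed A.smult_closed in \<open>simp_all add: ab_coord_def abelianization_simps(1,3,4) quot_module_simps(1)\<close>)
  then show "ab_coord i \<in> carrier (dual_space \<AA>)"
    by (simp add: dual_space_carrier_iff ab_coord_def)
  show "ab_coord i (\<pi> p) = fst p i" if "p \<in> carrier \<LL>"
    using that C.quotient_linear_map(2)[OF real_line_space fst_linear[OF assms] 0 that]
    by (simp add: ab_coord_def \<pi>_eq_proj abelianization_simps)
qed

lemma ab_dual_space_framed:
  "framed_form_space (dual_space \<AA>) (carrier \<AA>) V (\<lambda>i. \<pi> (X i)) ab_coord"
proof (intro framed_form_space.intro framed_form_space_axioms.intro DA.form_space_axioms finite_V
    ab_coord_closed)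
  show "\<pi> (X k) \<in> carrier \<AA>" for k
    using linear_mapsD(1)[OF \<pi>_linear X_closed] .
  fix u assume u: "u \<in> carrier (dual_space \<AA>)"
  let ?s = "\<Oplus>\<^bsub>dual_space \<AA>\<^esub>k\<in>V. u (\<pi> (X k)) \<odot>\<^bsub>dual_space \<AA>\<^esub> ab_coord k"
  have s: "?s \<in> carrier (dual_space \<AA>)"
    by (intro DA.finsum_closed) (auto simp: ab_coord_closed)
  note uD = dual_spaceD[OF u] and \<pi>D = linear_mapsD[OF \<pi>_linear]
  show "u = ?s"
  proof (rule extensionalityI[of _ "carrier \<AA>"])
    fix Y assume Y: "Y \<in> carrier \<AA>"
    then obtain v z where p: "v \<in> carrier VV" "z \<in> carrier \<ZZ>" "Y = \<pi> (v, z)"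
      by (auto simp: abelianization_simps \<pi>_eq_proj dani_mainkar_simps)
    have inj: "(v, \<zero>\<^bsub>\<ZZ>\<^esub>) \<in> carrier \<LL>" if "v \<in> carrier VV" for v
      using that by (simp add: dani_mainkar_simps)
    have "(v, z) = (\<zero>\<^bsub>VV\<^esub>, z) \<oplus>\<^bsub>\<LL>\<^esub> (v, \<zero>\<^bsub>\<ZZ>\<^esub>)"
      using p by (simp add: dani_mainkar_simps)
    then have Y_eq: "Y = \<pi> (v, \<zero>\<^bsub>\<ZZ>\<^esub>)"
      using C.proj_eqI[OF central_summand_subset_C[OF p(2)] inj[OF p(1)]] p by (simp add: \<pi>_eq_proj)
    have "(\<lambda>v. u (\<pi> (v, \<zero>\<^bsub>\<ZZ>\<^esub>))) \<in> linear_maps VV real_line"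
    proof (rule linear_mapsI)
      fix v w assume "v \<in> carrier VV" "w \<in> carrier VV"
      then show "u (\<pi> (v \<oplus>\<^bsub>VV\<^esub> w, \<zero>\<^bsub>\<ZZ>\<^esub>)) = u (\<pi> (v, \<zero>\<^bsub>\<ZZ>\<^esub>)) \<oplus>\<^bsub>real_line\<^esub> u (\<pi> (w, \<zero>\<^bsub>\<ZZ>\<^esub>))"
        using \<pi>D(2)[OF inj inj, of v w] uD(2)[OF \<pi>D(1) \<pi>D(1), OF inj inj, of v w]
        by (simp add: dani_mainkar_simps)
    next
      fix c v assume "v \<in> carrier VV"
      then show "u (\<pi> (c \<odot>\<^bsub>VV\<^esub> v, \<zero>\<^bsub>\<ZZ>\<^esub>)) = c \<odot>\<^bsub>real_line\<^esub> u (\<pi> (v, \<zero>\<^bsub>\<ZZ>\<^esub>))"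
        using \<pi>D(3)[OF inj, of v c] uD(3)[OF \<pi>D(1), OF inj, of v c]
        by (simp add: dani_mainkar_simps)
    qed simp
    from functional_vertex_expansion[OF this p(1)]
    have "u Y = (\<Sum>k\<in>V. u (\<pi> (X k)) * ab_coord k Y)"
      using inj p(1) by (simp add: Y_eq X_def ab_coord_proj mult.commute)
    also have "\<dots> = (\<Sum>k\<in>V. (u (\<pi> (X k)) \<odot>\<^bsub>dual_space \<AA>\<^esub> ab_coord k) Y)"
      using Y by (intro sum.cong refl) (simp add: DA.eval_smult ab_coord_closed)
    also have "\<dots> = ?s Y"
    proof -
      have "(\<lambda>v. v Y) \<in> linear_maps (dual_space \<AA>) real_line"
        by (rule linear_mapsI) (simp_all add: DA.eval_add DA.eval_smult Y)
      then show ?thesis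
        using finite_V
        by (intro linear_functional_finsum[OF DA.real_space_axioms, symmetric]) (auto simp: ab_coord_closed)
    qed
    finally show "u Y = ?s Y" .
  qed (use u s in \<open>auto simp: dual_space_carrier_iff\<close>)
qed

sublocale CA: ce_data \<AA> V "\<lambda>i. \<pi> (X i)" ab_coord "\<lambda>u. \<zero>\<^bsub>cochains \<AA>\<^esub>"
proof (intro ce_data.intro ab_dual_space_framed)
  show "(\<lambda>u. \<zero>\<^bsub>cochains \<AA>\<^esub>) \<in> linear_maps (dual_space \<AA>) (cochains \<AA>)"
    by (rule linear_mapsI) simp_all
  show "\<zero>\<^bsub>cochains \<AA>\<^esub> \<in> DA.forms 2"
    by (rule DA.power_subspaceD(2))
  fix u Y Z assume u: "u \<in> carrier (dual_space \<AA>)" and YZ: "Y \<in> carrier \<AA>" "Z \<in> carrier \<AA>"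
  have "two_form_eval \<zero>\<^bsub>cochains \<AA>\<^esub> Y Z = 0"
    using linear_map_zero[OF DA.\<Lambda>.real_space_axioms real_line_space DA.two_form_eval_linear[OF YZ]] by simp
  moreover have "u (bracket \<AA> Y Z) = 0"
    using linear_map_zero[OF A.real_space_axioms real_line_space dual_spaceD(1)[OF u]]
    by (simp add: abelianization_bracket[OF YZ] abelianization_simps)
  ultimately show "two_form_eval \<zero>\<^bsub>cochains \<AA>\<^esub> Y Z = u (bracket \<AA> Y Z)"
    by simp
qed

text \<open>
  Brackets vanish in the abelianization, so the generators are closed, and with them everything. The
  cohomology of the abelianization is therefore its full exterior algebra.
\<close>

lemma ab_differential_eq_zero:
  assumes "\<omega> \<in> carrier (cochains \<AA>)" shows "ce_differential \<AA> \<omega> = \<zero>\<^bsub>cochains \<AA>\<^esub>"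
  using assms
proof (induction rule: DA.exterior_induct)
  case one
  then show ?case
    by (rule DA.odd_derivation_one[OF CA.ce_differential_odd_derivation])
qed (simp_all add: DA.odd_derivation_incl_mult[OF CA.ce_differential_odd_derivation]
    linear_mapsD[OF CA.ce_differential_linear] CA.ce_differential_incl)


subsection \<open>Coordinate monomials\<close>

abbreviation "\<C> \<equiv> cochains \<LL>"

definition monomial where
  "monomial w = ext_wedge (dual_space \<LL>) (map coord w)"

lemma map_coord_lists: "w \<in> lists V \<Longrightarrow> map coord w \<in> lists (carrier (dual_space \<LL>))"
  using coord_closed by auto

lemma monomial_in_forms: "\<lbrakk>w \<in> lists V; length w = k\<rbrakk> \<Longrightarrow> monomial w \<in> D.forms k"
  unfolding monomial_def by (intro D.wedge_in_power map_coord_lists) simp_all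

lemma monomial_closed: "w \<in> lists V \<Longrightarrow> monomial w \<in> carrier \<C>"
  unfolding monomial_def by (intro D.ext_wedge_closed map_coord_lists)

lemma monomial_Cons: "monomial (i # w) = D.\<iota> (coord i) \<otimes>\<^bsub>\<C>\<^esub> monomial w"
  by (simp add: monomial_def)

lemma monomial_split:
  assumes "w \<in> lists V" "j \<in> set w"
  shows "\<exists>v c. v \<in> lists V \<and> Suc (length v) = length w \<and> monomial w = c \<odot>\<^bsub>\<C>\<^esub> monomial (j # v)"
proof -
  obtain xs ys where w: "w = xs @ j # ys"
    using assms by (meson split_list)
  then have "monomial w = (-1) ^ length (map coord xs) \<odot>\<^bsub>\<C>\<^esub> monomial (j # xs @ ys)"
    using assms unfolding monomial_def w map_append list.map
    by (intro D.ext_wedge_move_front map_coord_lists coord_closed) auto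
  then show ?thesis
    using assms w by (intro exI[of _ "xs @ ys"] exI) auto
qed

lemma monomial_repeated:
  assumes "i \<in> V" "w \<in> lists V" "i \<in> set w" shows "monomial (i # w) = \<zero>\<^bsub>\<C>\<^esub>"
proof -
  obtain v c where v: "v \<in> lists V" "monomial w = c \<odot>\<^bsub>\<C>\<^esub> monomial (i # v)"
    using monomial_split[OF assms(2,3)] by blast
  have "D.\<iota> (coord i) \<otimes>\<^bsub>\<C>\<^esub> (D.\<iota> (coord i) \<otimes>\<^bsub>\<C>\<^esub> monomial v) = \<zero>\<^bsub>\<C>\<^esub>"
    using v assms by (simp add: D.incl_square coord_closed monomial_closed flip: D.\<Lambda>.m_assoc)
  then show ?thesis
    using v assms by (simp add: monomial_Cons D.\<Lambda>.smult_mult_right coord_closed monomial_closed)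
qed

lemma d_monomial: "w \<in> lists V \<Longrightarrow> d (monomial w) = \<zero>\<^bsub>\<C>\<^esub>"
proof (induction w)
  case Nil
  then show ?case
    using D.odd_derivation_one[OF CE.ce_differential_odd_derivation] by (simp add: monomial_def)
next
  case (Cons i w)
  then show ?case
    by (simp add: monomial_Cons D.odd_derivation_incl_mult[OF CE.ce_differential_odd_derivation]
        coord_closed monomial_closed d_coord)
qed

lemma coboundaries_Suc: "coboundaries \<LL> (Suc k) = d ` D.forms k"
  by (simp add: coboundaries_def)

lemma coboundaries_subspace: "real_subspace (coboundaries \<LL> k) \<C>"
proof (cases k)
  case 0
  have "real_subspace {\<zero>\<^bsub>\<C>\<^esub>} \<C>"
    by (rule D.\<Lambda>.real_subspaceI) auto
  with 0 show ?thesis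
    by (simp add: coboundaries_def)
next
  case (Suc j)
  show ?thesis
    unfolding Suc coboundaries_Suc
    by (rule linear_image_subspace[OF D.\<Lambda>.real_space_axioms D.\<Lambda>.real_space_axioms
          CE.ce_differential_linear D.power_subspace])
qed

lemmas coboundariesD = real_subspaceD[OF D.\<Lambda>.real_space_axioms coboundaries_subspace]

text \<open>
  Move \<open>x\<^sub>j\<close> to the front of the remaining factors. Then \<open>x\<^sub>i \<and> x\<^sub>j\<close> is exact and the other factors
  are closed, so their product is exact.
\<close>

lemma monomial_edge:
  assumes ij: "{i, j} \<in> E" and w: "w \<in> lists V" "j \<in> set w"
  shows "monomial (i # w) \<in> coboundaries \<LL> (Suc (length w))"
proof -
  obtain v c where v: "v \<in> lists V" "Suc (length v) = length w" "monomial w = c \<odot>\<^bsub>\<C>\<^esub> monomial (j # v)"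
    using monomial_split[OF w] by blast
  have V: "i \<in> V" "j \<in> V"
    using edgeD[OF ij] by auto
  let ?\<epsilon> = "D.\<iota> (edge_coord i j)"
  note closed = coord_closed[OF V(1)] coord_closed[OF V(2)] edge_coord_closed[OF ij] monomial_closed[OF v(1)]
  have "d (?\<epsilon> \<otimes>\<^bsub>\<C>\<^esub> monomial v) = D.\<iota> (coord i) \<otimes>\<^bsub>\<C>\<^esub> D.\<iota> (coord j) \<otimes>\<^bsub>\<C>\<^esub> monomial v"
    using closed
    by (simp add: D.odd_derivation_incl_mult[OF CE.ce_differential_odd_derivation] d_monomial[OF v(1)]
        d_edge_coord[OF ij])
  moreover have "?\<epsilon> \<otimes>\<^bsub>\<C>\<^esub> monomial v \<in> D.forms (length w)"
    using D.incl_mult_in_power[OF closed(3) monomial_in_forms[OF v(1) refl]] v(2) by simp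
  ultimately have "D.\<iota> (coord i) \<otimes>\<^bsub>\<C>\<^esub> D.\<iota> (coord j) \<otimes>\<^bsub>\<C>\<^esub> monomial v \<in> coboundaries \<LL> (Suc (length w))"
    unfolding coboundaries_Suc by (metis image_eqI)
  moreover have "monomial (i # w) = c \<odot>\<^bsub>\<C>\<^esub> (D.\<iota> (coord i) \<otimes>\<^bsub>\<C>\<^esub> D.\<iota> (coord j) \<otimes>\<^bsub>\<C>\<^esub> monomial v)"
    using closed by (simp add: monomial_Cons v(3) D.\<Lambda>.smult_mult_right D.\<Lambda>.m_assoc)
  ultimately show ?thesis
    using coboundariesD(4) by simp
qed

text \<open>
  Closed one-forms anticommute with the differential.
\<close>

lemma coord_mult_coboundary:
  assumes i: "i \<in> V" and b: "b \<in> coboundaries \<LL> k"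
  shows "D.\<iota> (coord i) \<otimes>\<^bsub>\<C>\<^esub> b \<in> coboundaries \<LL> (Suc k)"
proof (cases k)
  case 0
  then have "b = \<zero>\<^bsub>\<C>\<^esub>"
    using b by (simp add: coboundaries_def)
  then show ?thesis
    using coboundariesD(2) i by (simp add: coord_closed)
next
  case (Suc j)
  then obtain a where a: "a \<in> D.forms j" "b = d a"
    using b by (auto simp: coboundaries_Suc)
  note closed = coord_closed[OF i] D.power_subspaceD(1)[OF a(1)]
    linear_mapsD(1)[OF CE.ce_differential_linear D.power_subspaceD(1)[OF a(1)]]
  have "d (D.\<iota> (coord i) \<otimes>\<^bsub>\<C>\<^esub> a) = (-1) \<odot>\<^bsub>\<C>\<^esub> (D.\<iota> (coord i) \<otimes>\<^bsub>\<C>\<^esub> b)"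
    using closed
    by (simp add: D.odd_derivation_incl_mult[OF CE.ce_differential_odd_derivation] d_coord[OF i] a(2))
  then have "D.\<iota> (coord i) \<otimes>\<^bsub>\<C>\<^esub> b = (-1) \<odot>\<^bsub>\<C>\<^esub> d (D.\<iota> (coord i) \<otimes>\<^bsub>\<C>\<^esub> a)"
    using closed by (simp add: a(2) flip: D.\<Lambda>.smult_assoc)
  moreover have "d (D.\<iota> (coord i) \<otimes>\<^bsub>\<C>\<^esub> a) \<in> coboundaries \<LL> (Suc k)"
    unfolding coboundaries_Suc Suc by (intro imageI D.incl_mult_in_power closed a)
  ultimately show ?thesis
    using coboundariesD(4) by simp
qed


subsection \<open>Independent sets span the basic classes\<close>

definition independent_words :: "nat \<Rightarrow> 'v list set" where
  "independent_words k = {w \<in> lists V. distinct w \<and> length w = k \<and> indep (set w) E}"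

text \<open>
  The forms that are congruent, modulo coboundaries, to a combination of monomials of independent
  sets. The coboundaries are kept among the generators so that this is a span, which is amenable to
  induction.
\<close>

definition normal_span where
  "normal_span k = real_span \<C> (monomial ` independent_words k \<union> coboundaries \<LL> k)"

lemma normal_generators: "monomial ` independent_words k \<union> coboundaries \<LL> k \<subseteq> carrier \<C>"
  using monomial_closed coboundariesD(1) by (auto simp: independent_words_def)

lemma normal_span_subspace: "real_subspace (normal_span k) \<C>"
  unfolding normal_span_def by (rule D.\<Lambda>.span_is_real_subspace[OF normal_generators])

lemmas normal_spanD = real_subspaceD[OF D.\<Lambda>.real_space_axioms normal_span_subspace]

lemma normal_span_base:
  "a \<in> monomial ` independent_words k \<union> coboundaries \<LL> k \<Longrightarrow> a \<in> normal_span k"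
  unfolding normal_span_def by (rule D.\<Lambda>.span_superset[OF normal_generators])

text \<open>
  Multiplying the monomial of an independent set by a vertex gives zero if the vertex occurs already,
  a coboundary if it has a neighbour in the set, and the monomial of a larger independent set
  otherwise.
\<close>

lemma coord_mult_normal_span:
  assumes i: "i \<in> V" and a: "a \<in> normal_span k"
  shows "D.\<iota> (coord i) \<otimes>\<^bsub>\<C>\<^esub> a \<in> normal_span (Suc k)"
  using a[unfolded normal_span_def] normal_generators
proof (induction rule: D.\<Lambda>.span_induct)
  case (base b)
  have "monomial (i # w) \<in> normal_span (Suc k)" if w: "w \<in> independent_words k" for w
  proof -
    have w': "w \<in> lists V" "distinct w" "length w = k" "indep (set w) E"
      using w by (auto simp: independent_words_def)
    consider "i \<in> set w" | j where "j \<in> set w" "{i, j} \<in> E"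
      | "i \<notin> set w" "\<forall>j\<in>set w. {i, j} \<notin> E"
      by blast
    then show ?thesis
    proof cases
      case 1
      then show ?thesis
        using monomial_repeated[OF i w'(1)] normal_spanD(2) by simp
    next
      case 2
      then show ?thesis
        using monomial_edge[OF 2(2) w'(1) 2(1)] w'(3) by (intro normal_span_base) auto
    next
      case 3
      then have "i # w \<in> independent_words (Suc k)"
        using i w' by (auto simp: independent_words_def indep_def insert_commute)
      then show ?thesis
        by (intro normal_span_base) auto
    qed
  qed
  then show ?case
    using base coord_mult_coboundary[OF i] normal_span_base by (auto simp: monomial_Cons)
next
  case zero
  then show ?case
    using normal_spanD(2) by (simp add: coord_closed i)
next
  case (add x y)
  then show ?case
    using normal_spanD(3) by (simp add: coord_closed i D.\<Lambda>.r_distr)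
next
  case (smult c x)
  then show ?case
    using normal_spanD(4) by (simp add: coord_closed i D.\<Lambda>.smult_mult_right)
qed

lemma dual_map_apply: "p \<in> carrier \<LL> \<Longrightarrow> dual_map \<LL> \<pi> u p = u (\<pi> p)"
  by (simp add: dual_map_def)

lemma dual_map_linear: "dual_map \<LL> \<pi> \<in> linear_maps (dual_space \<AA>) (dual_space \<LL>)"
proof (rule linear_mapsI)
  note \<pi>D = linear_mapsD[OF \<pi>_linear]
  fix u assume u: "u \<in> carrier (dual_space \<AA>)"
  have "dual_map \<LL> \<pi> u \<in> linear_maps \<LL> real_line"
    by (rule linear_mapsI) (simp_all add: dual_map_apply \<pi>D dual_spaceD[OF u])
  then show "dual_map \<LL> \<pi> u \<in> carrier (dual_space \<LL>)"
    by (simp add: dual_space_carrier_iff dual_map_def)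
  show "dual_map \<LL> \<pi> (c \<odot>\<^bsub>dual_space \<AA>\<^esub> u) = c \<odot>\<^bsub>dual_space \<LL>\<^esub> dual_map \<LL> \<pi> u" for c
    by (auto simp: dual_map_def dual_space_simps \<pi>D fun_eq_iff)
  show "dual_map \<LL> \<pi> (u \<oplus>\<^bsub>dual_space \<AA>\<^esub> v) = dual_map \<LL> \<pi> u \<oplus>\<^bsub>dual_space \<LL>\<^esub> dual_map \<LL> \<pi> v" for v
    by (auto simp: dual_map_def dual_space_simps \<pi>D fun_eq_iff)
qed

lemma dual_map_ab_coord: "i \<in> V \<Longrightarrow> dual_map \<LL> \<pi> (ab_coord i) = coord i"
  by (auto simp: dual_map_def coord_def ab_coord_proj fun_eq_iff)

lemma dual_map_expansion:
  assumes u: "u \<in> carrier (dual_space \<AA>)"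
  shows "dual_map \<LL> \<pi> u = (\<Oplus>\<^bsub>dual_space \<LL>\<^esub>i\<in>V. u (\<pi> (X i)) \<odot>\<^bsub>dual_space \<LL>\<^esub> coord i)"
proof -
  have "dual_map \<LL> \<pi> u = dual_map \<LL> \<pi> (\<Oplus>\<^bsub>dual_space \<AA>\<^esub>i\<in>V. u (\<pi> (X i)) \<odot>\<^bsub>dual_space \<AA>\<^esub> ab_coord i)"
    using framed_form_space.frame[OF ab_dual_space_framed u] by simp
  also have "\<dots> = (\<Oplus>\<^bsub>dual_space \<LL>\<^esub>i\<in>V. dual_map \<LL> \<pi> (u (\<pi> (X i)) \<odot>\<^bsub>dual_space \<AA>\<^esub> ab_coord i))"
    by (rule linear_map_finsum[OF DA.real_space_axioms D.real_space_axioms dual_map_linear finite_V])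
      (simp add: ab_coord_closed)
  also have "\<dots> = (\<Oplus>\<^bsub>dual_space \<LL>\<^esub>i\<in>V. u (\<pi> (X i)) \<odot>\<^bsub>dual_space \<LL>\<^esub> coord i)"
    by (intro D.finsum_cong' refl Pi_I)
      (simp_all add: coord_closed linear_mapsD(3)[OF dual_map_linear] ab_coord_closed dual_map_ab_coord)
  finally show ?thesis .
qed

abbreviation "\<Phi> \<equiv> ext_map (dual_space \<AA>) (dual_space \<LL>) (dual_map \<LL> \<pi>)"

lemmas \<Phi>_properties = ext_map_properties[OF DA.real_space_axioms D.real_space_axioms dual_map_linear]

lemma pullback_mult_normal_span:
  assumes u: "u \<in> carrier (dual_space \<AA>)" and a: "a \<in> normal_span k"
  shows "D.\<iota> (dual_map \<LL> \<pi> u) \<otimes>\<^bsub>\<C>\<^esub> a \<in> normal_span (Suc k)"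
proof -
  have aC: "a \<in> carrier \<C>"
    using normal_spanD(1)[OF a] .
  let ?f = "\<lambda>i. u (\<pi> (X i)) \<odot>\<^bsub>dual_space \<LL>\<^esub> coord i"
  have "(\<lambda>v. D.\<iota> v \<otimes>\<^bsub>\<C>\<^esub> a) \<in> linear_maps (dual_space \<LL>) \<C>"
    by (rule linear_mapsI) (simp_all add: aC D.incl_add D.incl_smult D.\<Lambda>.l_distr D.\<Lambda>.smult_mult_left)
  from linear_map_finsum[OF D.real_space_axioms D.\<Lambda>.real_space_axioms this finite_V, of ?f]
  have "D.\<iota> (dual_map \<LL> \<pi> u) \<otimes>\<^bsub>\<C>\<^esub> a = (\<Oplus>\<^bsub>\<C>\<^esub>i\<in>V. D.\<iota> (?f i) \<otimes>\<^bsub>\<C>\<^esub> a)"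
    by (simp add: dual_map_expansion[OF u] coord_closed)
  moreover have "D.\<iota> (?f i) \<otimes>\<^bsub>\<C>\<^esub> a \<in> normal_span (Suc k)" if "i \<in> V" for i
    using normal_spanD(4)[OF coord_mult_normal_span[OF that a]] that
    by (simp add: D.incl_smult coord_closed D.\<Lambda>.smult_mult_left aC)
  moreover have "(\<lambda>x. x) \<in> linear_maps (\<C>\<lparr>carrier := normal_span (Suc k)\<rparr>) \<C>"
    using normal_spanD(1) by (intro linear_mapsI) auto
  ultimately show ?thesis
    using linear_map_finsum_subspace[OF D.\<Lambda>.real_space_axioms normal_span_subspace
        D.\<Lambda>.real_space_axioms _ finite_V] by simp
qed

text \<open>
  One-forms on the abelianization are combinations of the vertex coordinates, so the products of
  such forms are reached by multiplying with vertices one at a time.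
\<close>

lemma pullback_in_normal_span:
  assumes "\<omega> \<in> DA.forms k" shows "\<Phi> \<omega> \<in> normal_span k"
  using assms
proof (induction rule: DA.power_induct)
  case (wedge w)
  have "ext_wedge (dual_space \<LL>) (map (dual_map \<LL> \<pi>) w) \<in> normal_span (length w)"
    using wedge(1)
  proof (induction w)
    case Nil
    have "monomial [] \<in> normal_span 0"
      by (intro normal_span_base) (auto simp: independent_words_def indep_def)
    then show ?case
      by (simp add: monomial_def)
  next
    case (Cons u w)
    then show ?case
      by (simp add: pullback_mult_normal_span)
  qed
  then show ?case
    using wedge \<Phi>_properties(3) by simp
next
  case zero
  then show ?case
    using linear_map_zero[OF DA.\<Lambda>.real_space_axioms D.\<Lambda>.real_space_axioms] \<Phi>_properties(1)
      normal_spanD(2) by auto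
next
  case (add a b)
  then show ?case
    using algebra_homD(2)[OF \<Phi>_properties(1)] normal_spanD(3) by (simp add: DA.power_subspaceD(1))
next
  case (smult c a)
  then show ?case
    using algebra_homD(3)[OF \<Phi>_properties(1)] normal_spanD(4) by (simp add: DA.power_subspaceD(1))
qed


subsection \<open>Coefficients of independent sets vanish on coboundaries\<close>

text \<open>
  Independent sets are the faces of a simplicial complex. The exterior algebra acts on the functions
  on faces with a vertex coordinate acting as a creation operator and an edge coordinate as zero;
  this is the exterior face algebra of the complex.
\<close>

abbreviation "face S \<equiv> S \<subseteq> V \<and> indep S E"

text \<open>The signs of monomials need some order of the vertices, and any will do.\<close>

definition rank :: "'v \<Rightarrow> nat" where "rank = (SOME r. inj_on r V)"

lemma inj_rank: "inj_on rank V"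
proof -
  have "\<exists>r :: 'v \<Rightarrow> nat. inj_on r V"
    using finite_imp_inj_to_nat_seg[OF finite_V] by blast
  then show ?thesis
    unfolding rank_def by (rule someI_ex)
qed

sublocale F: creation_operators face rank
proof
  show "finite S" if "face S" for S
    using that finite_V finite_subset by blast
  show "face T" if "face S" "T \<subseteq> S" for S T
    using that by (auto simp: indep_def)
  show "inj_on rank S" if "face S" for S
    using that inj_rank inj_on_subset by blast
qed

definition face_field where
  "face_field u = field_operator face rank V (\<lambda>i. u (X i))"

lemma face_field_linear: "face_field \<in> linear_maps (dual_space \<LL>) operators"
  unfolding face_field_def
  by (rule linear_mapsI)
    (simp_all add: field_operator_in_operators D.eval_add D.eval_smult X_closed
      flip: field_operator_add field_operator_smult)

lemma face_field_square: "face_field u \<otimes>\<^bsub>operators\<^esub> face_field u = \<zero>\<^bsub>operators\<^esub>"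
  unfolding face_field_def by (rule F.field_operator_square[OF finite_V])

definition face_rep where "face_rep = ext_lift operators face_field"

lemmas face_rep_hom =
  D.ext_lift_hom[OF operators_real_algebra face_field_linear face_field_square, folded face_rep_def]
lemmas face_rep_incl =
  D.ext_lift_incl[OF operators_real_algebra face_field_linear face_field_square, folded face_rep_def]
lemmas face_rep_wedge =
  D.ext_lift_wedge[OF operators_real_algebra face_field_linear face_field_square, folded face_rep_def]

lemma face_field_coord:
  assumes "i \<in> V" shows "face_field (coord i) = creation face rank i"
proof -
  have "coord i (X j) = (if j = i then 1 else 0)" for j
    using assms by (simp add: coord_apply X_closed) (simp add: X_def vertex_vector_def)
  then show ?thesis
    unfolding face_field_def by (simp add: field_operator_single[OF finite_V assms])
qed

lemma face_rep_monomial: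
  assumes "w \<in> lists V" shows "face_rep (monomial w) vacuum = foldr (creation face rank) w vacuum"
proof -
  have "face_rep (monomial w) = word_prod operators face_field (map coord w)"
    unfolding monomial_def by (rule face_rep_wedge[OF map_coord_lists[OF assms]])
  moreover have "word_prod operators face_field (map coord w) vacuum = foldr (creation face rank) w vacuum"
    using assms by induction (simp_all add: operators_simps face_field_coord)
  ultimately show ?thesis
    by simp
qed

text \<open>
  The differential of a one-form involves only products of adjacent vertices, since brackets of
  other vertices vanish; and adjacent vertices have product zero on faces.
\<close>

lemma face_rep_d_incl:
  assumes u: "u \<in> carrier (dual_space \<LL>)" shows "face_rep (d (D.\<iota> u)) = \<zero>\<^bsub>operators\<^esub>"
proof -
  interpret O: real_algebra operators by (rule operators_real_algebra)
  note hom = algebra_homD[OF face_rep_hom]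
  have lin: "face_rep \<in> linear_maps \<C> operators"
    using face_rep_hom by blast
  have "(1/2 * u (bracket \<LL> (X i) (X j))) \<odot>\<^bsub>operators\<^esub>
      face_rep (D.\<iota> (coord i) \<otimes>\<^bsub>\<C>\<^esub> D.\<iota> (coord j)) = \<zero>\<^bsub>operators\<^esub>" if "i \<in> V" "j \<in> V" for i j
  proof (cases "{i, j} \<in> E")
    case True
    then have "\<not> face {i, j}"
      using edgeD[OF True] by (auto simp: indep_def)
    then show ?thesis
      using that F.creation_creation_eq_zero[of i j]
      by (simp add: hom coord_closed face_rep_incl face_field_coord operators_simps)
  next
    case False
    have "u \<zero>\<^bsub>\<LL>\<^esub> = 0"
      using linear_map_zero[OF L.real_space_axioms real_line_space dual_spaceD(1)[OF u]] by simp
    then show ?thesis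
      using bracket_X_non_edge[OF that False] by (simp add: operators_simps)
  qed
  then show ?thesis
    unfolding CE.ce_differential_incl[OF u] \<delta>_def
    by (subst D.linear_map_wedge_sum[OF finite_V coord_closed O.real_space_axioms lin])
      (auto intro!: O.add.finprod_one_eqI)
qed

lemma face_rep_d:
  assumes "a \<in> carrier \<C>" shows "face_rep (d a) = \<zero>\<^bsub>operators\<^esub>"
proof -
  interpret O: real_algebra operators by (rule operators_real_algebra)
  note hom = algebra_homD[OF face_rep_hom]
  have zero: "face_rep \<zero>\<^bsub>\<C>\<^esub> = \<zero>\<^bsub>operators\<^esub>"
    using linear_map_zero[OF D.\<Lambda>.real_space_axioms O.real_space_axioms] face_rep_hom by blast
  note dD = linear_mapsD[OF CE.ce_differential_linear]
  show ?thesis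
    using assms
    by (induction rule: D.exterior_induct)
      (simp_all add: D.odd_derivation_one[OF CE.ce_differential_odd_derivation] zero
        D.odd_derivation_incl_mult[OF CE.ce_differential_odd_derivation] dD hom face_rep_d_incl)
qed

text \<open>
  The coefficient of the monomial of \<open>S\<close> in the image of a form in the face algebra. It descends to
  cohomology because that image is zero for coboundaries.
\<close>

definition coefficient where "coefficient S a = face_rep a vacuum S"

lemma coefficient_linear: "coefficient S \<in> linear_maps \<C> real_line"
  using linear_mapsD[OF eval_operator_linear[of vacuum S]]
  by (intro linear_mapsI) (simp_all add: coefficient_def algebra_homD[OF face_rep_hom])

lemma coefficient_coboundary:
  assumes "b \<in> coboundaries \<LL> k" shows "coefficient S b = 0"
proof (cases k)
  case 0
  then show ?thesis
    using assms linear_map_zero[OF D.\<Lambda>.real_space_axioms real_line_space coefficient_linear]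
    by (simp add: coboundaries_def)
next
  case (Suc j)
  then show ?thesis
    using assms D.power_subspaceD(1)
    by (auto simp: coboundaries_Suc coefficient_def face_rep_d operators_simps)
qed

lemma coefficient_monomial:
  assumes "w \<in> independent_words k" shows "coefficient S (monomial w) \<noteq> 0 \<longleftrightarrow> S = set w"
proof -
  have w: "w \<in> lists V" "distinct w" "face (set w)"
    using assms by (auto simp: independent_words_def)
  obtain \<epsilon> where "\<epsilon> \<noteq> 0"
    "foldr (creation face rank) w vacuum = (\<lambda>S. if S = set w then \<epsilon> else 0)"
    using F.creation_word_vacuum[OF w(2,3)] by blast
  then show ?thesis
    by (simp add: coefficient_def face_rep_monomial[OF w(1)])
qed


subsection \<open>The basic cohomology\<close>

lemma ab_coboundaries: "coboundaries \<AA> k = {\<zero>\<^bsub>cochains \<AA>\<^esub>}"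
proof (cases k)
  case (Suc j)
  have "ce_differential \<AA> ` DA.forms j = (\<lambda>\<omega>. \<zero>\<^bsub>cochains \<AA>\<^esub>) ` DA.forms j"
    by (intro image_cong refl ab_differential_eq_zero DA.power_subspaceD(1))
  also have "\<dots> = {\<zero>\<^bsub>cochains \<AA>\<^esub>}"
    using DA.power_subspaceD(2) by blast
  finally show ?thesis
    using Suc by (simp add: coboundaries_def)
qed (simp add: coboundaries_def)

lemma ab_cocycles: "cocycles \<AA> k = DA.forms k"
  using ab_differential_eq_zero DA.power_subspaceD(1) by (auto simp: cocycles_def)

lemma ab_cohomology_carrier: "carrier (cohomology \<AA> k) = (\<lambda>\<omega>. {\<omega>}) ` DA.forms k"
proof -
  have "{\<zero>\<^bsub>cochains \<AA>\<^esub>} +>\<^bsub>(cochains \<AA>)\<lparr>carrier := DA.forms k\<rparr>\<^esub> \<omega> = {\<omega>}" if "\<omega> \<in> DA.forms k" for \<omega>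
    using DA.power_subspaceD(1)[OF that] by (simp add: a_r_coset_def r_coset_def)
  then show ?thesis
    unfolding cohomology_def quot_module_simps ab_coboundaries ab_cocycles
    by (intro image_cong) simp_all
qed

context
  fixes k :: nat
begin

interpretation B: real_quotient \<C> "coboundaries \<LL> k"
  by (intro real_quotient.intro real_quotient_axioms.intro D.\<Lambda>.real_space_axioms coboundaries_subspace)

abbreviation "\<H> \<equiv> basic_cohomology \<LL> k"

text \<open>
  The operations on cosets do not depend on the set of cocycles. Hence the basic cohomology can be
  regarded as a subspace of all cochains modulo coboundaries.
\<close>

lemma basic_cohomology_simps:
  "carrier \<H> = (\<lambda>\<omega>. B.proj (\<Phi> \<omega>)) ` DA.forms k"
  "zero \<H> = zero (quot_module \<C> (coboundaries \<LL> k))"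
  "add \<H> = add (quot_module \<C> (coboundaries \<LL> k))"
  "smult \<H> = smult (quot_module \<C> (coboundaries \<LL> k))"
proof -
  show "carrier \<H> = (\<lambda>\<omega>. B.proj (\<Phi> \<omega>)) ` DA.forms k"
    by (simp add: basic_cohomology_def ab_cohomology_carrier image_image cohomology_map_def)
  show "zero \<H> = zero (quot_module \<C> (coboundaries \<LL> k))"
    "add \<H> = add (quot_module \<C> (coboundaries \<LL> k))"
    "smult \<H> = smult (quot_module \<C> (coboundaries \<LL> k))"
    by (simp_all add: basic_cohomology_def cohomology_def quot_module_simps set_add_def set_mult_def
        a_r_coset_def r_coset_def fun_eq_iff)
qed

lemma pullback_class_linear:
  "(\<lambda>\<omega>. B.proj (\<Phi> \<omega>)) \<in> linear_maps (cochains \<AA>) (quot_module \<C> (coboundaries \<LL> k))"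
  using linear_mapsD[OF B.proj_linear] algebra_homD[OF \<Phi>_properties(1)]
  by (intro linear_mapsI) simp_all

lemma basic_cohomology_real_space: "real_space \<H>"
proof -
  have "real_subspace ((\<lambda>\<omega>. B.proj (\<Phi> \<omega>)) ` DA.forms k) (quot_module \<C> (coboundaries \<LL> k))"
    by (rule linear_image_subspace[OF DA.\<Lambda>.real_space_axioms B.quotient_real_space
          pullback_class_linear DA.power_subspace])
  from real_subspace_is_real_space[OF B.quotient_real_space this] show ?thesis
    by (rule real_space_cong) (simp_all add: basic_cohomology_simps)
qed

interpretation H: real_space \<H> by (rule basic_cohomology_real_space)

definition vertex_list :: "'v set \<Rightarrow> 'v list" where
  "vertex_list S = (SOME w. distinct w \<and> set w = S)"

lemma vertex_list:
  assumes "S \<in> independent_sets V E k"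
  shows "set (vertex_list S) = S" "vertex_list S \<in> independent_words k"
proof -
  have S: "S \<subseteq> V" "indep S E" "card S = k"
    using assms by (auto simp: independent_sets_def)
  then have "\<exists>w. distinct w \<and> set w = S"
    using finite_V by (metis finite_distinct_list finite_subset)
  then have *: "distinct (vertex_list S) \<and> set (vertex_list S) = S"
    unfolding vertex_list_def by (rule someI_ex)
  then show "set (vertex_list S) = S" ..
  then show "vertex_list S \<in> independent_words k"
    using * S distinct_card[of "vertex_list S"] by (auto simp: independent_words_def in_lists_conv_set)
qed

definition "basis_class S = B.proj (monomial (vertex_list S))"

lemma basis_class_closed:
  assumes "S \<in> independent_sets V E k" shows "basis_class S \<in> carrier \<H>"
proof -
  let ?w = "vertex_list S"
  have w: "?w \<in> lists V" "length ?w = k"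
    using vertex_list[OF assms] by (auto simp: independent_words_def)
  have closed: "map ab_coord ?w \<in> lists (carrier (dual_space \<AA>))"
    using w(1) ab_coord_closed by auto
  have "map (dual_map \<LL> \<pi>) (map ab_coord ?w) = map coord ?w"
    using w(1) by (auto simp: dual_map_ab_coord)
  then have eq: "\<Phi> (ext_wedge (dual_space \<AA>) (map ab_coord ?w)) = monomial ?w"
    using \<Phi>_properties(3)[OF closed] by (simp only: monomial_def)
  have "ext_wedge (dual_space \<AA>) (map ab_coord ?w) \<in> DA.forms k"
    using w(2) by (intro DA.wedge_in_power closed) simp
  then show ?thesis
    unfolding basic_cohomology_simps(1) basis_class_def eq[symmetric] by (rule imageI)
qed

lemma basis_classes_closed: "basis_class ` independent_sets V E k \<subseteq> carrier \<H>"
  using basis_class_closed by blast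

lemma normal_span_class:
  assumes "a \<in> normal_span k"
  shows "B.proj a \<in> real_span \<H> (basis_class ` independent_sets V E k)"
proof -
  note spanD = real_subspaceD[OF H.real_space_axioms H.span_is_real_subspace[OF basis_classes_closed]]
  note projD = linear_mapsD[OF B.proj_linear]
  have B_zero: "B.proj b = \<zero>\<^bsub>\<H>\<^esub>" if "b \<in> coboundaries \<LL> k" for b
    using B.proj_eq_zero_iff coboundariesD(1)[OF that] that
    by (simp add: basic_cohomology_simps quot_module_simps)
  show ?thesis
    using assms[unfolded normal_span_def] normal_generators
  proof (induction rule: D.\<Lambda>.span_induct)
    case (base a)
    show ?case
    proof (cases "a \<in> coboundaries \<LL> k")
      case True
      then show ?thesis
        using B_zero spanD(2) by simp
    next
      case False
      then obtain w where w: "w \<in> independent_words k" "a = monomial w"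
        using base by blast
      let ?S = "set w"
      have S: "?S \<in> independent_sets V E k"
        using w(1) distinct_card[of w] by (auto simp: independent_words_def independent_sets_def)
      let ?v = "vertex_list ?S"
      have "mset w = mset ?v"
        using w(1) vertex_list[OF S] by (auto simp: independent_words_def set_eq_iff_mset_eq_distinct[symmetric])
      then have "mset (map coord w) = mset (map coord ?v)"
        by (metis mset_map)
      then obtain c where "monomial w = c \<odot>\<^bsub>\<C>\<^esub> monomial ?v"
        using D.ext_wedge_permute[OF _ map_coord_lists] w(1)
        unfolding monomial_def independent_words_def by blast
      then have "B.proj a = c \<odot>\<^bsub>\<H>\<^esub> basis_class ?S"
        using vertex_list(2)[OF S] projD(3)[of "monomial ?v" c]
        by (simp add: w(2) basis_class_def basic_cohomology_simps independent_words_def monomial_closed)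
      moreover have "basis_class ?S \<in> real_span \<H> (basis_class ` independent_sets V E k)"
        by (intro H.span_superset[OF basis_classes_closed] imageI S)
      ultimately show ?thesis
        using spanD(4) by simp
    qed
  next
    case zero
    then show ?case
      using B_zero[OF coboundariesD(2)] spanD(2) by simp
  next
    case (add x y)
    then show ?case
      using spanD(3) projD(2) by (simp add: basic_cohomology_simps)
  next
    case (smult c x)
    then show ?case
      using spanD(4) projD(3) by (simp add: basic_cohomology_simps)
  qed
qed

text \<open>
  The classes of the monomials of independent sets span, and the coefficients separate them.
\<close>

lemma basic_betti_eq: "basic_betti \<LL> k = card (independent_sets V E k)"
  unfolding basic_betti_def
proof (rule dim_eq_card_dual_family[where b = basis_class
      and \<kappa> = "\<lambda>S Y. the_elem (coefficient S ` Y)"])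
  show "finite (independent_sets V E k)"
    using finite_V by (simp add: independent_sets_def)
  have 0: "coefficient S b = \<zero>\<^bsub>real_line\<^esub>" if "b \<in> coboundaries \<LL> k" for S b
    using coefficient_coboundary[OF that] by simp
  note quot = B.quotient_linear_map[OF real_line_space coefficient_linear 0]
  have sub: "carrier \<H> \<subseteq> carrier (quot_module \<C> (coboundaries \<LL> k))"
    using linear_mapsD(1)[OF pullback_class_linear] DA.power_subspaceD(1)
    by (auto simp: basic_cohomology_simps)
  show "(\<lambda>Y. the_elem (coefficient S ` Y)) \<in> linear_maps \<H> real_line" for S
    by (rule linear_mapsI)
      (simp_all add: basic_cohomology_simps(2-) subsetD[OF sub] linear_mapsD[OF quot(1)[of S]])
  show "the_elem (coefficient S ` basis_class T) \<noteq> 0 \<longleftrightarrow> S = T"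
    if "S \<in> independent_sets V E k" "T \<in> independent_sets V E k" for S T
  proof -
    have "monomial (vertex_list T) \<in> carrier \<C>"
      using vertex_list(2)[OF that(2)] by (auto simp: independent_words_def intro: monomial_closed)
    then show ?thesis
      using coefficient_monomial[OF vertex_list(2)[OF that(2)], of S] vertex_list(1)[OF that(2)]
      by (simp add: basis_class_def quot(2))
  qed
  show "carrier \<H> \<subseteq> real_span \<H> (basis_class ` independent_sets V E k)"
    using normal_span_class pullback_in_normal_span by (auto simp: basic_cohomology_simps)
qed (use basic_cohomology_real_space basis_class_closed in auto)

end

end

theorem proposition21:
  fixes V :: "'v set" and E :: "'v set set" and k :: nat
  assumes "finite V" and "E \<subseteq> nsets V 2"
  shows "basic_betti (dani_mainkar V E) k = card (independent_sets V E k)"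
proof -
  interpret graph V E
    by (rule graph.intro) (rule assms)+
  show ?thesis
    by (rule basic_betti_eq)
qed

end
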